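(* Let $d\in\{2,3\}$ and $T>0$. Let $u$ be a solution of the initial value problem $$\partial_t u-\mathcal{R}_1\Delta u+u\,\partial_{x_1}u=0,\qquad u(x,0)=u_0(x),\qquad x\in\mathbb{R}^d,$$ such that $u\in C([0,T];Z_{2+\epsilon,2}(\mathbb{R}^2))$ for some $\epsilon>0$ when $d=2$, and $u\in C([0,T];Z_{3,3}(\mathbb{R}^3))$ when $d=3$. If there exist two different times $t_1,t_2\in[0,T]$ for which $$u(\cdot,t_j)\in Z_{d/2+2,\,d/2+2}(\mathbb{R}^d),\qquad j=1,2,$$ then $\widehat{u_0}(0)=0$.
   Context: Functions $u=u(x,t)$ are real-valued. $\mathcal{R}_1=-\partial_{x_1}(-\Delta)^{-1/2}$ is the Riesz transform, the Fourier multiplier operator with symbol $-i\xi_1/|\xi|$, where $\widehat f(\xi)=\int_{\mathbb{R}^d}e^{-ix\cdot\xi}f(x)\,dx$. $$Z_{s,r}(\mathbb{R}^d)=H^s(\mathbb{R}^d)\cap L^2(|x|^{2r}dx),$$ with norm $\|f\|_{H^s}+\||x|^rf\|_{L^2}$. Solutions are understood in the sense of Duhamel's formula $u(t)=e^{t\mathcal{R}_1\Delta}u_0-\int_0^te^{(t-\tau)\mathcal{R}_1\Delta}u(\tau)\partial_{x_1}u(\tau)\,d\tau$, where $e^{t\mathcal{R}_1\Delta}$ has Fourier symbol $e^{it\xi_1|\xi|}$. *)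

theory Defs
  imports "HOL-Analysis.Analysis"
begin

text \<open>
  Elements of \<open>L\<^sup>2\<close> are handled through representatives: changing a function on a Lebesgue
  null set affects no notion below, and operators on \<open>L\<^sup>2\<close> return an arbitrary representative.
  The index \<open>k\<close> names the coordinate that is called \<open>x\<^sub>1\<close> in the equation.
\<close>

definition in_L2 :: "(real^'n \<Rightarrow> 'b::real_normed_vector) \<Rightarrow> bool" where
  "in_L2 f \<longleftrightarrow> f \<in> borel_measurable lebesgue \<and> integrable lebesgue (\<lambda>x. (norm (f x))\<^sup>2)"

text \<open>Meaningful only for functions satisfying \<open>in_L2\<close>; elsewhere the value may be 0 by default.\<close>

definition L2_norm :: "(real^'n \<Rightarrow> 'b::real_normed_vector) \<Rightarrow> real" where
  "L2_norm f = sqrt (LINT x|lebesgue. (norm (f x))\<^sup>2)"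

definition fourier :: "(real^'n \<Rightarrow> real) \<Rightarrow> real^'n \<Rightarrow> complex" where
  "fourier f \<xi> = (LINT x|lebesgue. exp (- (\<i> * complex_of_real (x \<bullet> \<xi>))) * complex_of_real (f x))"

text \<open>
  The Fourier transform on \<open>L\<^sup>2\<close> (Plancherel): \<open>F\<close> is the \<open>L\<^sup>2\<close> limit, as \<open>R\<close> tends to
  infinity, of the transforms of the truncations of \<open>f\<close> to the ball of radius \<open>R\<close>. The
  squared distance is an extended nonnegative integral, so that no default value can make
  the limit hold vacuously.
\<close>

definition L2_fourier :: "(real^'n \<Rightarrow> real) \<Rightarrow> (real^'n \<Rightarrow> complex) \<Rightarrow> bool" where
  "L2_fourier f F \<longleftrightarrow> in_L2 f \<and> in_L2 F \<and>
     ((\<lambda>R. \<integral>\<^sup>+ \<xi>. ennreal ((norm (F \<xi> - fourier (\<lambda>x. indicator (cball 0 R) x * f x) \<xi>))\<^sup>2) \<partial>lebesgue)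
        \<longlongrightarrow> 0) at_top"

definition fourier_L2 :: "(real^'n \<Rightarrow> real) \<Rightarrow> real^'n \<Rightarrow> complex" where
  "fourier_L2 f = (SOME F. L2_fourier f F)"

text \<open>
  The operator with Fourier symbol \<open>m\<close>. Only symbols with \<open>m (- \<xi>) = cnj (m \<xi>)\<close> are used, which
  map real-valued functions to real-valued functions.
\<close>

definition fourier_multiplier ::
    "(real^'n \<Rightarrow> complex) \<Rightarrow> (real^'n \<Rightarrow> real) \<Rightarrow> real^'n \<Rightarrow> real" where
  "fourier_multiplier m f = (SOME g. L2_fourier g (\<lambda>\<xi>. m \<xi> * fourier_L2 f \<xi>))"

definition partial_deriv :: "'n \<Rightarrow> (real^'n \<Rightarrow> real) \<Rightarrow> real^'n \<Rightarrow> real" where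
  "partial_deriv k = fourier_multiplier (\<lambda>\<xi>. \<i> * complex_of_real (\<xi> $ k))"

text \<open>
  The group generated by \<open>\<R>\<^sub>1 \<Delta>\<close>, whose symbol is
  \<open>(- \<i> \<xi>\<^sub>1 / \<bar>\<xi>\<bar>) (- \<bar>\<xi>\<bar>\<^sup>2) = \<i> \<xi>\<^sub>1 \<bar>\<xi>\<bar>\<close>.
\<close>

definition propagator :: "'n \<Rightarrow> real \<Rightarrow> (real^'n \<Rightarrow> real) \<Rightarrow> real^'n \<Rightarrow> real" where
  "propagator k t = fourier_multiplier (\<lambda>\<xi>. exp (\<i> * complex_of_real (t * \<xi> $ k * norm \<xi>)))"

definition in_Hs :: "real \<Rightarrow> (real^'n \<Rightarrow> real) \<Rightarrow> bool" where
  "in_Hs s f \<longleftrightarrow>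
     (\<exists>F. L2_fourier f F \<and> in_L2 (\<lambda>\<xi>. complex_of_real ((1 + (norm \<xi>)\<^sup>2) powr (s / 2)) * F \<xi>))"

definition Hs_norm :: "real \<Rightarrow> (real^'n \<Rightarrow> real) \<Rightarrow> real" where
  "Hs_norm s f = L2_norm (\<lambda>\<xi>. complex_of_real ((1 + (norm \<xi>)\<^sup>2) powr (s / 2)) * fourier_L2 f \<xi>)"

definition Z_space :: "real \<Rightarrow> real \<Rightarrow> (real^'n \<Rightarrow> real) set" where
  "Z_space s r = {f. in_Hs s f \<and> in_L2 (\<lambda>x. norm x powr r * f x)}"

definition Z_norm :: "real \<Rightarrow> real \<Rightarrow> (real^'n \<Rightarrow> real) \<Rightarrow> real" where
  "Z_norm s r f = Hs_norm s f + L2_norm (\<lambda>x. norm x powr r * f x)"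

definition continuous_into_Z ::
    "real \<Rightarrow> real \<Rightarrow> real \<Rightarrow> (real \<Rightarrow> real^'n \<Rightarrow> real) \<Rightarrow> bool" where
  "continuous_into_Z T s r u \<longleftrightarrow>
     (\<forall>t\<in>{0..T}. u t \<in> Z_space s r \<and>
        ((\<lambda>\<tau>. Z_norm s r (\<lambda>x. u \<tau> x - u t x)) \<longlongrightarrow> 0) (at t within {0..T}))"

text \<open>
  The integral of an \<open>L\<^sup>2\<close>-valued function of time, as the \<open>L\<^sup>2\<close> limit of Riemann sums:
  \<open>has_integral\<close> with \<open>L2_norm\<close> for the norm. For integrands continuous into \<open>L\<^sup>2\<close>, as in the
  Duhamel formula below, this agrees with the Bochner and the Riemann integral.
\<close>

definition L2_has_integral ::
    "(real \<Rightarrow> real^'n \<Rightarrow> real) \<Rightarrow> (real^'n \<Rightarrow> real) \<Rightarrow> real \<Rightarrow> real \<Rightarrow> bool" where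
  "L2_has_integral G I a b \<longleftrightarrow>
     (\<forall>\<tau>\<in>{a..b}. in_L2 (G \<tau>)) \<and> in_L2 I \<and>
     (\<forall>e>0. \<exists>\<gamma>. gauge \<gamma> \<and>
        (\<forall>\<D>. \<D> tagged_division_of {a..b} \<and> \<gamma> fine \<D> \<longrightarrow>
           L2_norm (\<lambda>x. (\<Sum>(\<tau>, K)\<in>\<D>. measure lborel K * G \<tau> x) - I x) < e))"

definition duhamel_solution ::
    "'n \<Rightarrow> real \<Rightarrow> (real^'n \<Rightarrow> real) \<Rightarrow> (real \<Rightarrow> real^'n \<Rightarrow> real) \<Rightarrow> bool" where
  "duhamel_solution k T u0 u \<longleftrightarrow>
     (AE x in lebesgue. u 0 x = u0 x) \<and>
     (\<forall>t\<in>{0..T}. \<exists>I.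
        L2_has_integral (\<lambda>\<tau>. propagator k (t - \<tau>) (\<lambda>x. u \<tau> x * partial_deriv k (u \<tau>) x)) I 0 t \<and>
        (AE x in lebesgue. u t x = propagator k t u0 x - I x))"

end

theory Submission
  imports Defs "HOL-Probability.Characteristic_Functions"
begin

text \<open>
  Let \<open>n\<close> be the dimension and \<open>\<mu>(\<xi>) = \<xi>\<^sub>k \<bar>\<xi>\<bar>\<close>, so that the free evolution multiplies the Fourier transform by
  \<open>e\<^bsup>it\<mu>\<^esup>\<close>. The weight \<open>\<bar>x\<bar>\<^bsup>n/2+2\<^esup>\<close> on \<open>u(t)\<close> says that the transform of \<open>u(t)\<close> has \<open>n/2 + 2\<close>
  derivatives in \<open>L\<^sup>2\<close>. This is the threshold at which \<open>\<mu>\<close>, homogeneous of degree 2 but not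
  polynomial, fails to be that regular at the origin. By Duhamel's formula the transforms at the
  two times differ by
  \<open>(e\<^bsup>i t\<^sub>1 \<mu>\<^esup> - e\<^bsup>i t\<^sub>2 \<mu>\<^esup>) \<cdot> (transform of u\<^sub>0)\<close> and two nonlinear terms. Near the origin the
  first expression is \<open>i (t\<^sub>1 - t\<^sub>2)\<close> times the mean of \<open>u\<^sub>0\<close> times \<open>\<mu>\<close>, up to \<open>o(\<bar>\<xi>\<bar>\<^sup>2)\<close>. The
  nonlinear terms are harmless: by Leibniz's rule the transform of \<open>u \<partial>\<^sub>k u\<close> is \<open>i \<xi>\<^sub>k / 2\<close> times
  that of \<open>u\<^sup>2\<close>, and \<open>(1 + \<bar>x\<bar>\<^sup>2) u\<^sup>2\<close> is integrable uniformly in time, so this product, even after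
  multiplication by \<open>e\<^bsup>it\<mu>\<^esup>\<close>, is a quadratic polynomial up to \<open>O(\<bar>\<xi>\<bar>\<^sup>3)\<close>. Thus the multiple of
  \<open>\<mu>\<close> must vanish, and with it the mean of \<open>u\<^sub>0\<close>.

  Regularity of the fractional order \<open>n/2 + 2\<close> is detected without fractional derivatives, by
  integrating against a bounded function of scale \<open>h\<close> around the origin, a fourth
  difference of the indicator function of a ball (\<open>pairing\<close>). As \<open>h\<close> tends to 0 this
  functional is \<open>o(h\<^bsup>n+2\<^esup>)\<close> on the transforms at the two times (\<open>pairing_decay\<close>). It annihilates
  quadratic polynomials, hence is \<open>O(h\<^bsup>n+3\<^esup>)\<close> on the nonlinear terms (\<open>pairing_nonlinear\<close> for
  each time, \<open>pairing_L2_has_integral\<close> for the time integral). On the linear term it is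
  asymptotic to a multiple of \<open>h\<^bsup>n+2\<^esup>\<close> that is zero only if the mean is
  (\<open>pairing_linear_limit\<close>, \<open>kappa_neg\<close>).

  The functions in Duhamel's formula are given only through their Fourier transforms on \<open>L\<^sup>2\<close>.
  Plancherel's theorem identifies them, and all transforms that occur are integrable as well as
  square-integrable, so that explicit inverse transforms exhibit the multipliers
  (\<open>L2_fourier_ift\<close>, \<open>L2_fourier_multiplier\<close>).
\<close>

section \<open>Square-integrable functions\<close>

definition square_integrable :: "'a measure \<Rightarrow> ('a \<Rightarrow> 'b::{banach, second_countable_topology}) \<Rightarrow> bool" where
  "square_integrable M f \<longleftrightarrow> f \<in> borel_measurable M \<and> integrable M (\<lambda>x. (norm (f x))\<^sup>2)"

definition norm2 :: "'a measure \<Rightarrow> ('a \<Rightarrow> 'b::{banach, second_countable_topology}) \<Rightarrow> real" where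
  "norm2 M f = sqrt (LINT x|M. (norm (f x))\<^sup>2)"

lemma in_L2_iff: "in_L2 f \<longleftrightarrow> square_integrable lebesgue f"
  by (simp add: in_L2_def square_integrable_def)

lemma L2_norm_eq: "L2_norm f = norm2 lebesgue f"
  by (simp add: L2_norm_def norm2_def)

lemma square_integrableD:
  assumes "square_integrable M f"
  shows "f \<in> borel_measurable M" "integrable M (\<lambda>x. (norm (f x))\<^sup>2)"
  using assms by (auto simp: square_integrable_def)

lemma norm2_nonneg [simp]: "0 \<le> norm2 M f"
  by (simp add: norm2_def)

lemma norm2_power2: "(norm2 M f)\<^sup>2 = (LINT x|M. (norm (f x))\<^sup>2)"
  by (simp add: norm2_def)

lemma square_integrable_bound:
  fixes f :: "'a \<Rightarrow> 'b::{banach, second_countable_topology}"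
    and g :: "'a \<Rightarrow> 'c::{banach, second_countable_topology}"
  assumes f: "square_integrable M f" and g[measurable]: "g \<in> borel_measurable M"
    and le: "AE x in M. norm (g x) \<le> C * norm (f x)"
  shows "square_integrable M g"
proof -
  have [measurable]: "f \<in> borel_measurable M" using f by (simp add: square_integrable_def)
  have "integrable M (\<lambda>x. C\<^sup>2 * (norm (f x))\<^sup>2)"
    using square_integrableD(2)[OF f] by simp
  moreover have "AE x in M. norm ((norm (g x))\<^sup>2) \<le> norm (C\<^sup>2 * (norm (f x))\<^sup>2)"
    using le
  proof eventually_elim
    case (elim x)
    then show ?case using power_mono[OF elim, of 2] by (simp add: power_mult_distrib)
  qed
  ultimately have "integrable M (\<lambda>x. (norm (g x))\<^sup>2)"
    by (intro Bochner_Integration.integrable_bound[where g="\<lambda>x. (norm (g x))\<^sup>2" and f="\<lambda>x. C\<^sup>2 * (norm (f x))\<^sup>2"]) measurable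
  then show ?thesis by (simp add: square_integrable_def g)
qed

lemma norm2_mono:
  fixes f :: "'a \<Rightarrow> 'b::{banach, second_countable_topology}"
    and g :: "'a \<Rightarrow> 'c::{banach, second_countable_topology}"
  assumes f: "square_integrable M f" and g: "g \<in> borel_measurable M"
    and le: "AE x in M. norm (g x) \<le> norm (f x)"
  shows "norm2 M g \<le> norm2 M f"
proof -
  have "square_integrable M g"
    by (rule square_integrable_bound[OF f g, where C=1]) (use le in simp)
  then show ?thesis unfolding norm2_def
    using f le by (intro real_sqrt_le_mono integral_mono_AE) (auto simp: square_integrable_def power_mono)
qed

lemma square_integrable_cong_AE:
  assumes "square_integrable M f" "g \<in> borel_measurable M" "AE x in M. f x = g x"
  shows "square_integrable M g"
  by (rule square_integrable_bound[OF assms(1,2), where C=1]) (use assms(3) in auto)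

lemma norm2_cong_AE:
  assumes "f \<in> borel_measurable M" "g \<in> borel_measurable M" "AE x in M. f x = g x"
  shows "norm2 M f = norm2 M g"
  unfolding norm2_def using assms
  by (intro arg_cong[where f=sqrt] integral_cong_AE) auto

lemma square_integrable_scaleR:
  assumes "square_integrable M f"
  shows "square_integrable M (\<lambda>x. c *\<^sub>R f x)"
  using square_integrableD(1)[OF assms]
  by (intro square_integrable_bound[OF assms, where C="\<bar>c\<bar>"]) auto

lemma norm2_scaleR: "norm2 M (\<lambda>x. c *\<^sub>R f x) = \<bar>c\<bar> * norm2 M f"
  by (simp add: norm2_def power_mult_distrib real_sqrt_mult)

lemma square_integrable_add:
  assumes f: "square_integrable M f" and g: "square_integrable M g"
  shows "square_integrable M (\<lambda>x. f x + g x)"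
proof -
  have [measurable]: "f \<in> borel_measurable M" "g \<in> borel_measurable M"
    using f g by (auto simp: square_integrable_def)
  have "integrable M (\<lambda>x. 2 * (norm (f x))\<^sup>2 + 2 * (norm (g x))\<^sup>2)"
    using square_integrableD(2)[OF f] square_integrableD(2)[OF g] by simp
  moreover have "norm ((norm (f x + g x))\<^sup>2) \<le> norm (2 * (norm (f x))\<^sup>2 + 2 * (norm (g x))\<^sup>2)" for x
  proof -
    have "(norm (f x + g x))\<^sup>2 \<le> (norm (f x) + norm (g x))\<^sup>2"
      by (intro power_mono norm_triangle_ineq) simp
    also have "\<dots> \<le> 2 * (norm (f x))\<^sup>2 + 2 * (norm (g x))\<^sup>2"
      using sum_squares_bound[of "norm (f x)" "norm (g x)"] by (simp add: power2_sum)
    finally show ?thesis by simp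
  qed
  ultimately have "integrable M (\<lambda>x. (norm (f x + g x))\<^sup>2)"
    by (intro Bochner_Integration.integrable_bound[where g="\<lambda>x. (norm (f x + g x))\<^sup>2"
          and f="\<lambda>x. 2 * (norm (f x))\<^sup>2 + 2 * (norm (g x))\<^sup>2"] AE_I2) auto
  then show ?thesis by (simp add: square_integrable_def)
qed

lemma square_integrable_diff:
  assumes f: "square_integrable M f" and g: "square_integrable M g"
  shows "square_integrable M (\<lambda>x. f x - g x)"
  using square_integrable_add[OF f square_integrable_scaleR[OF g, of "-1"]] by simp

lemma integrable_norm_mult:
  assumes f: "square_integrable M f" and g: "square_integrable M g"
  shows "integrable M (\<lambda>x. norm (f x) * norm (g x))"
proof -
  have [measurable]: "f \<in> borel_measurable M" "g \<in> borel_measurable M"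
    using f g by (auto simp: square_integrable_def)
  have "integrable M (\<lambda>x. (norm (f x))\<^sup>2 + (norm (g x))\<^sup>2)"
    using square_integrableD(2)[OF f] square_integrableD(2)[OF g] by simp
  then show ?thesis
  proof (rule Bochner_Integration.integrable_bound[OF _ _ AE_I2])
    show "norm (norm (f x) * norm (g x)) \<le> norm ((norm (f x))\<^sup>2 + (norm (g x))\<^sup>2)" for x
    proof -
      have "0 \<le> norm (f x) * norm (g x)" "0 \<le> (norm (f x))\<^sup>2 + (norm (g x))\<^sup>2" by auto
      then show ?thesis
        unfolding real_norm_def using sum_squares_bound[of "norm (f x)" "norm (g x)"] by linarith
    qed
  qed measurable
qed

lemma integrable_mult_square_integrable:
  fixes f g :: "'a \<Rightarrow> 'b::{banach, second_countable_topology, real_normed_algebra}"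
  assumes f: "square_integrable M f" and g: "square_integrable M g"
  shows "integrable M (\<lambda>x. f x * g x)"
proof -
  have [measurable]: "f \<in> borel_measurable M" "g \<in> borel_measurable M"
    using f g by (auto simp: square_integrable_def)
  show ?thesis
    by (rule Bochner_Integration.integrable_bound[OF integrable_norm_mult[OF f g] _ AE_I2])
      (auto simp: norm_mult_ineq)
qed

text \<open>The square integral of \<open>t \<bar>f\<bar> - \<bar>g\<bar>\<close> is a quadratic polynomial in \<open>t\<close> without negative
  values, and its discriminant is the claim.\<close>

lemma Cauchy_Schwarz_norm2:
  assumes f: "square_integrable M f" and g: "square_integrable M g"
  shows "(LINT x|M. norm (f x) * norm (g x)) \<le> norm2 M f * norm2 M g"
proof -
  define A B X where "A = (LINT x|M. (norm (f x))\<^sup>2)" and "B = (LINT x|M. (norm (g x))\<^sup>2)"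
    and "X = (LINT x|M. norm (f x) * norm (g x))"
  note ints = square_integrableD(2)[OF f] square_integrableD(2)[OF g] integrable_norm_mult[OF f g]
  have AB: "0 \<le> A" "0 \<le> B" "0 \<le> X" by (auto simp: A_def B_def X_def)
  have q: "0 \<le> t\<^sup>2 * A - 2 * t * X + B" for t
  proof -
    have "0 \<le> (LINT x|M. (t * norm (f x) - norm (g x))\<^sup>2)" by simp
    also have "\<dots> = (LINT x|M. t\<^sup>2 * (norm (f x))\<^sup>2 - 2 * t * (norm (f x) * norm (g x)) + (norm (g x))\<^sup>2)"
      by (intro Bochner_Integration.integral_cong) (auto simp: power2_eq_square algebra_simps)
    also have "\<dots> = t\<^sup>2 * A - 2 * t * X + B"
      using ints by (simp add: A_def B_def X_def)
    finally show ?thesis .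
  qed
  have "X\<^sup>2 \<le> A * B"
  proof (cases "A = 0")
    case True
    have "X = 0"
    proof (rule ccontr)
      assume "X \<noteq> 0"
      define t where "t = (B + 1) / X"
      have "t * X = B + 1" using \<open>X \<noteq> 0\<close> by (simp add: t_def)
      then have "2 * t * X = 2 * (B + 1)" by (simp only: mult.assoc)
      then show False using q[of t] True AB by simp
    qed
    then show ?thesis using True by simp
  next
    case False
    then have "0 < A" using AB by simp
    then show ?thesis using q[of "X / A"] by (simp add: field_simps power2_eq_square)
  qed
  then have "sqrt (X\<^sup>2) \<le> sqrt (A * B)" by (rule real_sqrt_le_mono)
  then show ?thesis using AB by (simp add: real_sqrt_mult A_def B_def X_def norm2_def)
qed

lemma norm_integral_mult_le:
  fixes f g :: "'a \<Rightarrow> 'b::{banach, second_countable_topology, real_normed_algebra}"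
  assumes f: "square_integrable M f" and g: "square_integrable M g"
  shows "norm (LINT x|M. f x * g x) \<le> norm2 M f * norm2 M g"
proof -
  have "norm (LINT x|M. f x * g x) \<le> (LINT x|M. norm (f x * g x))" by (rule integral_norm_bound)
  also have "\<dots> \<le> (LINT x|M. norm (f x) * norm (g x))"
    by (intro integral_mono integrable_norm integrable_mult_square_integrable[OF f g]
        integrable_norm_mult[OF f g]) (rule norm_mult_ineq)
  also have "\<dots> \<le> norm2 M f * norm2 M g" by (rule Cauchy_Schwarz_norm2[OF f g])
  finally show ?thesis .
qed

lemma norm2_triangle:
  assumes f: "square_integrable M f" and g: "square_integrable M g"
  shows "norm2 M (\<lambda>x. f x + g x) \<le> norm2 M f + norm2 M g"
proof -
  note ints = square_integrableD(2)[OF f] square_integrableD(2)[OF g] integrable_norm_mult[OF f g]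
  have "(norm2 M (\<lambda>x. f x + g x))\<^sup>2 \<le> (LINT x|M. (norm (f x))\<^sup>2 + 2 * (norm (f x) * norm (g x)) + (norm (g x))\<^sup>2)"
    unfolding norm2_power2
  proof (intro integral_mono)
    show "(norm (f x + g x))\<^sup>2 \<le> (norm (f x))\<^sup>2 + 2 * (norm (f x) * norm (g x)) + (norm (g x))\<^sup>2" for x
      using power_mono[OF norm_triangle_ineq[of "f x" "g x"], of 2] by (simp add: power2_sum)
  qed (use ints square_integrableD(2)[OF square_integrable_add[OF f g]] in auto)
  also have "\<dots> = (norm2 M f)\<^sup>2 + 2 * (LINT x|M. norm (f x) * norm (g x)) + (norm2 M g)\<^sup>2"
    using ints by (simp add: norm2_power2)
  also have "\<dots> \<le> (norm2 M f + norm2 M g)\<^sup>2"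
    using Cauchy_Schwarz_norm2[OF f g] by (simp add: power2_sum)
  finally show ?thesis by (rule power2_le_imp_le) simp
qed

lemma norm2_minus_commute: "norm2 M (\<lambda>x. f x - g x) = norm2 M (\<lambda>x. g x - f x)"
  by (simp add: norm2_def norm_minus_commute)

lemma norm2_diff_le:
  assumes f: "square_integrable M f" and g: "square_integrable M g"
  shows "\<bar>norm2 M f - norm2 M g\<bar> \<le> norm2 M (\<lambda>x. f x - g x)"
  using norm2_triangle[OF square_integrable_diff[OF f g] g]
    norm2_triangle[OF square_integrable_diff[OF g f] f] norm2_minus_commute[of M f g]
  by simp

lemma norm2_eq_0_AE:
  assumes "square_integrable M f" "norm2 M f = 0"
  shows "AE x in M. f x = 0"
proof -
  have "(LINT x|M. (norm (f x))\<^sup>2) = 0" using assms(2) by (simp add: norm2_def)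
  then show ?thesis
    using integral_nonneg_eq_0_iff_AE[OF square_integrableD(2)[OF assms(1)]] by simp
qed

section \<open>Product integrands and the Gaussian\<close>

lemma lborel_integral_prod_Basis:
  fixes f :: "'a::euclidean_space \<Rightarrow> real \<Rightarrow> 'c::{real_normed_field,banach,second_countable_topology}"
  assumes "\<And>b. b \<in> Basis \<Longrightarrow> integrable lborel (f b)"
  shows "integrable lborel (\<lambda>x::'a. \<Prod>b\<in>Basis. f b (x \<bullet> b))"
    and "(LINT x|lborel. (\<Prod>b\<in>Basis. f b ((x::'a) \<bullet> b))) = (\<Prod>b\<in>Basis. LINT t|lborel. f b t)"
proof -
  interpret product_sigma_finite "\<lambda>b::'a. lborel :: real measure" ..
  have fb[measurable]: "\<And>b. b \<in> Basis \<Longrightarrow> f b \<in> borel_measurable borel"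
    using assms borel_measurable_integrable by fastforce
  have eq: "(\<Prod>b\<in>Basis. f b ((\<Sum>b\<in>Basis. y b *\<^sub>R b) \<bullet> b)) = (\<Prod>b\<in>Basis. f b (y b))" for y :: "'a \<Rightarrow> real"
    by (intro prod.cong) (auto simp: inner_sum_left inner_Basis if_distrib sum.delta cong: if_cong)
  have m: "(\<lambda>x::'a. \<Prod>b\<in>Basis. f b (x \<bullet> b)) \<in> borel_measurable borel" by measurable
  have m2: "(\<lambda>y. \<Sum>b\<in>Basis. y b *\<^sub>R b) \<in> (\<Pi>\<^sub>M b\<in>(Basis::'a set). lborel) \<rightarrow>\<^sub>M borel" by measurable
  show "integrable lborel (\<lambda>x::'a. \<Prod>b\<in>Basis. f b (x \<bullet> b))"
    by (subst lborel_eq, subst integrable_distr_eq[OF m2 m], subst eq)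
      (intro product_integrable_prod finite_Basis assms)
  show "(LINT x|lborel. (\<Prod>b\<in>Basis. f b ((x::'a) \<bullet> b))) = (\<Prod>b\<in>Basis. LINT t|lborel. f b t)"
    by (subst lborel_eq, subst integral_distr[OF m2 m], subst eq)
      (intro product_integral_prod finite_Basis assms)
qed

text \<open>Defined as a product, so that its Fourier integral splits into characteristic functions
  of the standard normal distribution on the line.\<close>

definition gauss :: "'a::euclidean_space \<Rightarrow> real" where
  "gauss x = (\<Prod>b\<in>Basis. std_normal_density (x \<bullet> b))"

lemma gauss_eq: "gauss (x::'a::euclidean_space) = exp (- (norm x)\<^sup>2 / 2) / sqrt (2 * pi) ^ DIM('a)"
proof -
  have "gauss x = (\<Prod>b\<in>(Basis::'a set). exp (- (x \<bullet> b)\<^sup>2 / 2)) / sqrt (2 * pi) ^ DIM('a)"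
    unfolding gauss_def std_normal_density_def prod.distrib prod_constant power_one_over by simp
  also have "(\<Prod>b\<in>(Basis::'a set). exp (- (x \<bullet> b)\<^sup>2 / 2)) = exp (\<Sum>b\<in>(Basis::'a set). - (x \<bullet> b)\<^sup>2 / 2)"
    by (simp add: exp_sum)
  also have "(\<Sum>b\<in>(Basis::'a set). - (x \<bullet> b)\<^sup>2 / 2) = - (norm x)\<^sup>2 / 2"
    unfolding power2_norm_eq_inner euclidean_inner[of x x]
    by (simp add: sum_negf sum_divide_distrib power2_eq_square)
  finally show ?thesis .
qed

lemma gauss_nonneg: "0 \<le> gauss x" by (simp add: gauss_eq)

lemma gauss_measurable [measurable]: "gauss \<in> borel_measurable borel"
  unfolding gauss_eq[abs_def] by measurable

lemma gauss_integrable: "integrable lborel gauss"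
  and gauss_integral: "(LINT x|lborel. gauss x) = 1"
  unfolding gauss_def[abs_def]
  using lborel_integral_prod_Basis[of "\<lambda>_. std_normal_density"]
  by (auto simp: integrable_normal_density integral_normal_density)

lemma std_normal_fourier:
  "integrable lborel (\<lambda>t. cis (- (t * s)) * complex_of_real (std_normal_density t))"
  "(LINT t|lborel. cis (- (t * s)) * complex_of_real (std_normal_density t)) = complex_of_real (exp (- s\<^sup>2 / 2))"
proof -
  show "integrable lborel (\<lambda>t. cis (- (t * s)) * complex_of_real (std_normal_density t))"
    by (rule Bochner_Integration.integrable_bound[OF integrable_normal_density[of 1 0]])
       (auto simp: norm_mult cis_conv_exp)
  have "complex_of_real (exp (- s\<^sup>2 / 2)) = char std_normal_distribution (- s)"
    by (simp add: char_std_normal_distribution)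
  also have "\<dots> = (LINT t|lborel. std_normal_density t *\<^sub>R iexp (- s * t))"
    unfolding char_def by (subst integral_density) (auto simp: normal_density_nonneg)
  also have "\<dots> = (LINT t|lborel. cis (- (t * s)) * complex_of_real (std_normal_density t))"
    by (intro Bochner_Integration.integral_cong) (auto simp: cis_conv_exp scaleR_conv_of_real mult_ac)
  finally show "(LINT t|lborel. cis (- (t * s)) * complex_of_real (std_normal_density t)) = complex_of_real (exp (- s\<^sup>2 / 2))" ..
qed

lemma cis_sum: "finite A \<Longrightarrow> cis (sum f A) = (\<Prod>a\<in>A. cis (f a))"
  by (induction A rule: finite_induct) (auto simp: cis_mult [symmetric])

lemma cis_inner: "cis (- ((x::'a::euclidean_space) \<bullet> \<xi>)) = (\<Prod>b\<in>Basis. cis (- ((x \<bullet> b) * (\<xi> \<bullet> b))))"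
  by (simp add: euclidean_inner[of x \<xi>] sum_negf [symmetric] cis_sum)

lemma gauss_fourier:
  fixes \<xi> :: "'a::euclidean_space"
  shows "(LINT x|lborel. cis (- (x \<bullet> \<xi>)) * complex_of_real (gauss x)) = complex_of_real (exp (- (norm \<xi>)\<^sup>2 / 2))"
proof -
  have "(LINT x|lborel. cis (- (x \<bullet> \<xi>)) * complex_of_real (gauss x))
     = (LINT x|lborel. (\<Prod>b\<in>Basis. cis (- ((x \<bullet> b) * (\<xi> \<bullet> b))) * complex_of_real (std_normal_density (x \<bullet> b))))"
    by (simp add: cis_inner gauss_def prod.distrib)
  also have "\<dots> = (\<Prod>b\<in>Basis. LINT t|lborel. cis (- (t * (\<xi> \<bullet> b))) * complex_of_real (std_normal_density t))"
    by (rule lborel_integral_prod_Basis(2)[of "\<lambda>b t. cis (- (t * (\<xi> \<bullet> b))) * complex_of_real (std_normal_density t)"])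
      (rule std_normal_fourier)
  also have "\<dots> = complex_of_real (\<Prod>b\<in>Basis. exp (- (\<xi> \<bullet> b)\<^sup>2 / 2))"
    by (simp add: std_normal_fourier)
  also have "(\<Prod>b\<in>(Basis::'a set). exp (- (\<xi> \<bullet> b)\<^sup>2 / 2)) = exp (\<Sum>b\<in>(Basis::'a set). - (\<xi> \<bullet> b)\<^sup>2 / 2)"
    by (simp add: exp_sum)
  also have "(\<Sum>b\<in>(Basis::'a set). - (\<xi> \<bullet> b)\<^sup>2 / 2) = - (norm \<xi>)\<^sup>2 / 2"
    unfolding power2_norm_eq_inner euclidean_inner[of \<xi> \<xi>]
    by (simp add: sum_negf sum_divide_distrib power2_eq_square)
  finally show ?thesis .
qed

lemma integrable_one_plus_square_powr:
  assumes "q > 1/2"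
  shows "integrable lborel (\<lambda>t::real. (1 + t\<^sup>2) powr (- q))"
proof -
  have 1: "set_integrable lborel {1..} (\<lambda>t::real. t powr (- 2 * q))"
  proof -
    have "(\<lambda>t::real. t powr (- 2 * q)) absolutely_integrable_on {1..}"
      using has_integral_powr_to_inf[of "- 2 * q" 1] assms
      by (intro nonnegative_absolutely_integrable_1) (auto simp: integrable_on_def)
    then show ?thesis unfolding set_integrable_def 
      by (subst (asm) integrable_completion) auto
  qed
  let ?g = "\<lambda>t::real. indicator {1..} t *\<^sub>R t powr (- 2 * q)"
  have g: "integrable lborel ?g" using 1 by (simp add: set_integrable_def)
  have g': "integrable lborel (\<lambda>t. ?g (- t))"
    using lborel_integrable_real_affine[OF g, of "-1" 0] by simp
  have b: "integrable lborel (\<lambda>t::real. indicator {-1..1} t :: real)"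
    by (intro integrable_real_indicator) auto
  show ?thesis
  proof (rule Bochner_Integration.integrable_bound[OF Bochner_Integration.integrable_add[OF b Bochner_Integration.integrable_add[OF g g']] _ AE_I2])
    fix t :: real
    have *: "(1 + t\<^sup>2) powr (- q) \<le> \<bar>t\<bar> powr (- 2 * q)" if "1 \<le> \<bar>t\<bar>"
    proof -
      have "(1 + t\<^sup>2) powr (- q) \<le> (\<bar>t\<bar> powr 2) powr (- q)"
        using assms that by (intro powr_mono2') auto
      then show ?thesis by (simp only: powr_powr) simp
    qed
    have **: "(1 + t\<^sup>2) powr (- q) \<le> 1"
      using assms powr_mono2'[of "- q" 1 "1 + t\<^sup>2"] by simp
    show "norm ((1 + t\<^sup>2) powr (- q)) \<le> norm (indicator {-1..1} t + (?g t + ?g (- t)))"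
      using * ** by (cases "\<bar>t\<bar> \<le> 1") (auto simp: indicator_def abs_if split: if_splits)
  qed measurable
qed

text \<open>The integrand is the \<open>n\<close>-th power of \<open>(1 + \<bar>x\<bar>\<^sup>2)\<^bsup>-p/n\<^esup>\<close>, and replacing \<open>\<bar>x\<bar>\<close> by one
  coordinate in each factor only increases it. The factors obtained are integrable on the line as
  soon as \<open>2 p > n\<close>, so the comparison costs nothing in the exponent.\<close>

lemma integrable_one_plus_norm_powr:
  assumes p: "p > real DIM('a) / 2"
  shows "integrable lborel (\<lambda>x::'a::euclidean_space. (1 + (norm x)\<^sup>2) powr (- p))"
proof -
  define q where "q = p / DIM('a)"
  have q: "q > 1/2" using p by (simp add: q_def field_simps)
  have i: "integrable lborel (\<lambda>x::'a. \<Prod>b\<in>Basis. (1 + (x \<bullet> b)\<^sup>2) powr (- q))"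
    by (rule lborel_integral_prod_Basis) (rule integrable_one_plus_square_powr[OF q])
  show ?thesis
  proof (rule Bochner_Integration.integrable_bound[OF i _ AE_I2])
    fix x :: 'a
    have "(1 + (norm x)\<^sup>2) powr (- p) = (\<Prod>b\<in>(Basis::'a set). (1 + (norm x)\<^sup>2) powr (- q))"
    proof -
      have "1 + (norm x)\<^sup>2 > 0" by (simp add: add_pos_nonneg)
      then have "(1 + (norm x)\<^sup>2) powr (- q) > 0" by simp
      then show ?thesis
        by (simp only: prod_constant powr_realpow[symmetric] powr_powr) (simp add: q_def)
    qed
    also have "\<dots> \<le> (\<Prod>b\<in>(Basis::'a set). (1 + (x \<bullet> b)\<^sup>2) powr (- q))"
    proof (intro prod_mono conjI)
      fix b :: 'a assume b: "b \<in> Basis"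
      have "(x \<bullet> b)\<^sup>2 \<le> (norm x)\<^sup>2" using Basis_le_norm[OF b, of x] by (metis abs_le_square_iff abs_norm_cancel)
      then show "(1 + (norm x)\<^sup>2) powr (- q) \<le> (1 + (x \<bullet> b)\<^sup>2) powr (- q)"
        using q by (intro powr_mono2') (auto simp: add_pos_nonneg)
    qed simp
    finally show "norm ((1 + (norm x)\<^sup>2) powr (- p)) \<le> norm (\<Prod>b\<in>(Basis::'a set). (1 + (x \<bullet> b)\<^sup>2) powr (- q))"
      by (simp add: abs_of_nonneg prod_nonneg)
  qed measurable
qed

section \<open>The Fourier integral\<close>

text \<open>The integral of \<open>fourier\<close>, but for complex-valued functions and over \<open>lborel\<close>: for Borel
  measurable \<open>f\<close> and \<open>g\<close> the function \<open>f x * g (w - x)\<close> is jointly measurable, as Fubini's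
  theorem requires.\<close>

definition ft :: "('a::euclidean_space \<Rightarrow> complex) \<Rightarrow> 'a \<Rightarrow> complex" where
  "ft f \<xi> = (LINT x|lborel. cis (- (x \<bullet> \<xi>)) * f x)"

lemma cis_measurable [measurable]: "cis \<in> borel_measurable borel"
  by (intro borel_measurable_continuous_onI continuous_intros)

lemma cnj_measurable [measurable]: "cnj \<in> borel_measurable borel"
  by (intro borel_measurable_continuous_onI continuous_intros)

lemma integrable_cis_mult:
  fixes f :: "'a \<Rightarrow> complex"
  assumes "integrable M f" and [measurable]: "\<theta> \<in> borel_measurable M"
  shows "integrable M (\<lambda>x. cis (\<theta> x) * f x)"
  by (rule Bochner_Integration.integrable_bound[OF assms(1)]) (use assms(1) in \<open>auto simp: norm_mult\<close>)

lemma norm_ft_le: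
  shows "norm (ft f \<xi>) \<le> (LINT x|lborel. norm (f x))"
proof -
  have "norm (ft f \<xi>) \<le> (LINT x|lborel. norm (cis (- (x \<bullet> \<xi>)) * f x))"
    unfolding ft_def by (rule integral_norm_bound)
  then show ?thesis by (simp add: norm_mult)
qed

lemma continuous_on_ft:
  assumes f: "integrable lborel f"
  shows "continuous_on UNIV (ft f)"
proof (rule continuous_on_sequentiallyI)
  fix u :: "nat \<Rightarrow> 'a" and a
  assume u: "u \<longlonglongrightarrow> a"
  note [measurable] = borel_measurable_integrable[OF f]
  show "(\<lambda>n. ft f (u n)) \<longlonglongrightarrow> ft f a"
    unfolding ft_def
  proof (rule integral_dominated_convergence[where w="\<lambda>x. norm (f x)"])
    show "AE x in lborel. (\<lambda>n. cis (- (x \<bullet> u n)) * f x) \<longlonglongrightarrow> cis (- (x \<bullet> a)) * f x"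
      unfolding cis_conv_exp by (intro AE_I2 tendsto_intros u)
  qed (use f in \<open>auto simp: norm_mult\<close>)
qed

lemma ft_measurable:
  assumes "integrable lborel f"
  shows "ft f \<in> borel_measurable borel"
  by (intro borel_measurable_continuous_onI continuous_on_ft assms)

lemma integrable_tensor:
  fixes f g :: "'a::euclidean_space \<Rightarrow> complex"
  assumes f: "integrable lborel f" and g: "integrable lborel g"
  shows "integrable (lborel \<Otimes>\<^sub>M lborel) (\<lambda>(x, y). cis (- (x \<bullet> y)) * f x * g y)"
proof -
  note [measurable] = borel_measurable_integrable[OF f] borel_measurable_integrable[OF g]
  show ?thesis
  proof (rule lborel_pair.Fubini_integrable)
    show "(\<lambda>(x, y). cis (- (x \<bullet> y)) * f x * g y) \<in> borel_measurable (lborel \<Otimes>\<^sub>M lborel)"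
      by measurable
    show "integrable lborel (\<lambda>x. LINT y|lborel. norm (case (x, y) of (x, y) \<Rightarrow> cis (- (x \<bullet> y)) * f x * g y))"
      using f by (simp add: norm_mult)
    show "AE x in lborel. integrable lborel (\<lambda>y. case (x, y) of (x, y) \<Rightarrow> cis (- (x \<bullet> y)) * f x * g y)"
    proof (rule AE_I2)
      fix x
      show "integrable lborel (\<lambda>y. case (x, y) of (x, y) \<Rightarrow> cis (- (x \<bullet> y)) * f x * g y)"
        using integrable_mult_left[OF integrable_cis_mult[OF g, of "\<lambda>y. - (x \<bullet> y)"], of "f x"]
        by (simp add: mult_ac)
    qed
  qed
qed

text \<open>The kernel is symmetric in its two variables, so this is Fubini's theorem.\<close>

lemma ft_multiplication_formula:
  assumes f: "integrable lborel f" and g: "integrable lborel g"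
  shows "(LINT \<xi>|lborel. ft f \<xi> * g \<xi>) = (LINT x|lborel. f x * ft g x)"
proof -
  have "(LINT \<xi>|lborel. ft f \<xi> * g \<xi>) = (LINT y|lborel. LINT x|lborel. cis (- (x \<bullet> y)) * f x * g y)"
    by (simp add: ft_def)
  also have "\<dots> = (LINT x|lborel. LINT y|lborel. cis (- (x \<bullet> y)) * f x * g y)"
    by (rule lborel_pair.Fubini_integral[OF integrable_tensor[OF f g]])
  also have "\<dots> = (LINT x|lborel. f x * ft g x)"
    unfolding ft_def by (subst integral_mult_right_zero[symmetric]) (simp add: mult_ac inner_commute)
  finally show ?thesis .
qed

lemma lborel_affine_integral:
  fixes f :: "'a::euclidean_space \<Rightarrow> 'b::{banach, second_countable_topology}"
  assumes [measurable]: "f \<in> borel_measurable borel" and c: "c \<noteq> 0"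
  shows "integrable lborel (\<lambda>x. f (t + c *\<^sub>R x)) \<longleftrightarrow> integrable lborel f"
    and "(LINT x|lborel. f x) = \<bar>c\<bar> ^ DIM('a) *\<^sub>R (LINT x|lborel. f (t + c *\<^sub>R x))"
proof -
  have c0: "\<bar>c\<bar> ^ DIM('a) \<noteq> 0" "0 \<le> \<bar>c\<bar> ^ DIM('a)" using c by auto
  show "integrable lborel (\<lambda>x. f (t + c *\<^sub>R x)) \<longleftrightarrow> integrable lborel f"
  proof -
    have "integrable lborel f \<longleftrightarrow> integrable lborel (\<lambda>x. \<bar>c\<bar> ^ DIM('a) *\<^sub>R f (t + c *\<^sub>R x))"
      by (subst lborel_affine[OF c, of t]) (simp add: integrable_density integrable_distr_eq c0)
    then show ?thesis
      using integrable_scaleR_right[of "1 / \<bar>c\<bar> ^ DIM('a)" lborel "\<lambda>x. \<bar>c\<bar> ^ DIM('a) *\<^sub>R f (t + c *\<^sub>R x)"]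
      using integrable_scaleR_right[of "\<bar>c\<bar> ^ DIM('a)" lborel "\<lambda>x. f (t + c *\<^sub>R x)"] c0 by auto
  qed
  show "(LINT x|lborel. f x) = \<bar>c\<bar> ^ DIM('a) *\<^sub>R (LINT x|lborel. f (t + c *\<^sub>R x))"
    by (subst lborel_affine[OF c, of t]) (simp add: integral_density integral_distr c0)
qed

lemma lborel_translate:
  fixes f :: "'a::euclidean_space \<Rightarrow> 'b::{banach, second_countable_topology}"
  assumes [measurable]: "f \<in> borel_measurable borel"
  shows "integrable lborel (\<lambda>x. f (x - t)) \<longleftrightarrow> integrable lborel f"
    and "(LINT x|lborel. f (x - t)) = (LINT x|lborel. f x)"
  using lborel_affine_integral[OF assms, of 1 "- t"] by simp_all

lemma lborel_reflect:
  fixes f :: "'a::euclidean_space \<Rightarrow> 'b::{banach, second_countable_topology}"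
  assumes [measurable]: "f \<in> borel_measurable borel"
  shows "integrable lborel (\<lambda>x. f (t - x)) \<longleftrightarrow> integrable lborel f"
    and "(LINT x|lborel. f (t - x)) = (LINT x|lborel. f x)"
  using lborel_affine_integral[OF assms, of "-1" t] by simp_all

lemma ft_translate:
  assumes [measurable]: "f \<in> borel_measurable borel"
  shows "ft (\<lambda>x. f (x - t)) \<xi> = cis (- (t \<bullet> \<xi>)) * ft f \<xi>"
proof -
  have "ft (\<lambda>x. f (x - t)) \<xi> = (LINT x|lborel. cis (- (t \<bullet> \<xi>)) * (cis (- ((x - t) \<bullet> \<xi>)) * f (x - t)))"
    unfolding ft_def by (intro Bochner_Integration.integral_cong) (auto simp: mult.assoc[symmetric] cis_mult inner_diff_left)
  also have "\<dots> = cis (- (t \<bullet> \<xi>)) * (LINT x|lborel. (cis (- ((x - t) \<bullet> \<xi>)) * f (x - t)))"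
    by simp
  also have "(LINT x|lborel. (cis (- ((x - t) \<bullet> \<xi>)) * f (x - t))) = ft f \<xi>"
    unfolding ft_def by (rule lborel_translate(2)[of "\<lambda>x. cis (- (x \<bullet> \<xi>)) * f x"]) measurable
  finally show ?thesis .
qed

lemma ft_scale:
  fixes f :: "'a::euclidean_space \<Rightarrow> complex"
  assumes [measurable]: "f \<in> borel_measurable borel" and c: "c \<noteq> 0"
  shows "ft f \<xi> = \<bar>c\<bar> ^ DIM('a) *\<^sub>R ft (\<lambda>x. f (c *\<^sub>R x)) (c *\<^sub>R \<xi>)"
  unfolding ft_def using lborel_affine_integral(2)[of "\<lambda>x. cis (- (x \<bullet> \<xi>)) * f x" c 0] c
  by simp

section \<open>Convolution\<close>

definition conv :: "('a::euclidean_space \<Rightarrow> complex) \<Rightarrow> ('a \<Rightarrow> complex) \<Rightarrow> 'a \<Rightarrow> complex" where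
  "conv f g w = (LINT x|lborel. f x * g (w - x))"

lemma integrable_conv_pair:
  fixes f g :: "'a::euclidean_space \<Rightarrow> complex"
  assumes f: "integrable lborel f" and g: "integrable lborel g"
  shows "integrable (lborel \<Otimes>\<^sub>M lborel) (\<lambda>(x, w). f x * g (w - x))"
proof -
  note [measurable] = borel_measurable_integrable[OF f] borel_measurable_integrable[OF g]
  show ?thesis
  proof (rule lborel_pair.Fubini_integrable)
    show "(\<lambda>(x, w). f x * g (w - x)) \<in> borel_measurable (lborel \<Otimes>\<^sub>M lborel)"
      by measurable
    have "(LINT w|lborel. norm (g (w - x))) = (LINT w|lborel. norm (g w))" for x
      by (rule lborel_translate(2)[of "\<lambda>w. norm (g w)"]) measurable
    then show "integrable lborel (\<lambda>x. LINT w|lborel. norm (case (x, w) of (x, w) \<Rightarrow> f x * g (w - x)))"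
      using f by (simp add: norm_mult)
    show "AE x in lborel. integrable lborel (\<lambda>w. case (x, w) of (x, w) \<Rightarrow> f x * g (w - x))"
      using lborel_translate(1)[of g] g by (intro AE_I2) auto
  qed
qed

lemma integrable_conv:
  assumes f: "integrable lborel f" and g: "integrable lborel g"
  shows "integrable lborel (conv f g)"
  using lborel_pair.integrable_snd[OF integrable_conv_pair[OF f g]] by (simp add: conv_def[abs_def])

lemma ft_conv:
  assumes f: "integrable lborel f" and g: "integrable lborel g"
  shows "ft (conv f g) \<xi> = ft f \<xi> * ft g \<xi>"
proof -
  note [measurable] = borel_measurable_integrable[OF f] borel_measurable_integrable[OF g]
  have i: "integrable (lborel \<Otimes>\<^sub>M lborel) (\<lambda>(x, w). cis (- (w \<bullet> \<xi>)) * (f x * g (w - x)))"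
    using integrable_cis_mult[OF integrable_conv_pair[OF f g], of "\<lambda>(x, w). - (w \<bullet> \<xi>)"]
    by (simp add: case_prod_beta')
  have "ft (conv f g) \<xi> = (LINT w|lborel. LINT x|lborel. cis (- (w \<bullet> \<xi>)) * (f x * g (w - x)))"
    by (simp add: ft_def conv_def)
  also have "\<dots> = (LINT x|lborel. LINT w|lborel. cis (- (w \<bullet> \<xi>)) * (f x * g (w - x)))"
    by (rule lborel_pair.Fubini_integral[OF i])
  also have "\<dots> = (LINT x|lborel. f x * ft (\<lambda>w. g (w - x)) \<xi>)"
    unfolding ft_def by (subst integral_mult_right_zero[symmetric]) (simp add: mult_ac)
  also have "\<dots> = ft f \<xi> * ft g \<xi>"
    by (subst ft_translate) (auto simp: ft_def[of f] mult_ac simp flip: integral_mult_right_zero)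
  finally show ?thesis .
qed


section \<open>Plancherel's theorem for integrable and square-integrable functions\<close>

definition clip :: "real \<Rightarrow> complex \<Rightarrow> complex" where
  "clip R z = z /\<^sub>R max 1 (norm z / R)"

definition cutoff :: "real \<Rightarrow> 'a::euclidean_space \<Rightarrow> real" where
  "cutoff R x = max 0 (min 1 (R + 1 - norm x))"

lemma cutoff_bounds: "0 \<le> cutoff R x" "cutoff R x \<le> 1" "norm x > R + 1 \<Longrightarrow> cutoff R x = 0"
  "norm x \<le> R \<Longrightarrow> cutoff R x = 1"
  by (auto simp: cutoff_def)

lemma clip_bounds: "R > 0 \<Longrightarrow> norm (clip R z) \<le> R" "norm (clip R z) \<le> norm z" "R > 0 \<Longrightarrow> norm z \<le> R \<Longrightarrow> clip R z = z"
proof -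
  show "norm (clip R z) \<le> norm z"
    using mult_left_mono[of 1 "max 1 (norm z / R)" "norm z"]
    by (simp add: clip_def mult.commute[of "inverse _"] divide_inverse[symmetric] divide_le_eq)
  show "norm (clip R z) \<le> R" if "R > 0"
  proof -
    have "norm z = R * (norm z / R)" using that by simp
    also have "\<dots> \<le> R * max 1 (norm z / R)" using that by (intro mult_left_mono) auto
    finally show ?thesis by (simp add: clip_def divide_inverse[symmetric] pos_divide_le_eq less_max_iff_disj mult.commute)
  qed
  show "clip R z = z" if "R > 0" "norm z \<le> R"
    using that by (simp add: clip_def max_def)
qed

lemma continuous_on_clip: "continuous_on UNIV (clip R)"
  unfolding clip_def[abs_def] divide_inverse
  by (intro continuous_intros) (auto simp: max_def split: if_splits)

lemma continuous_on_cutoff: "continuous_on UNIV (cutoff R)"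
  unfolding cutoff_def[abs_def] by (intro continuous_intros)

lemma integrable_indicator_cball: "integrable lborel (\<lambda>x::'a::euclidean_space. C * indicator (cball 0 R) x :: real)"
  by (intro integrable_mult_right integrable_real_indicator) (auto intro!: emeasure_bounded_finite[unfolded infinity_ennreal_def] bounded_cball)

text \<open>Measurability alone yields continuous approximants almost everywhere; clipping their
  values and cutting off their supports makes dominated convergence applicable.\<close>

lemma continuous_dense_L2:
  fixes f :: "'a::euclidean_space \<Rightarrow> complex"
  assumes f: "square_integrable lborel f" and e: "e > 0"
  obtains g R B where "continuous_on UNIV g" "\<And>x. norm x > R \<Longrightarrow> g x = 0" "\<And>x. norm (g x) \<le> B"
    "norm2 lborel (\<lambda>x. f x - g x) < e"
proof -
  have [measurable]: "f \<in> borel_measurable borel" using square_integrableD(1)[OF f] by simp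
  have cm[measurable]: "clip R \<in> borel_measurable borel" "cutoff R \<in> borel_measurable borel" for R
    by (auto intro!: borel_measurable_continuous_onI continuous_on_clip continuous_on_cutoff)
  have "f \<in> borel_measurable lebesgue" by (intro measurable_completion) simp
  then have "f measurable_on UNIV"
    using lebesgue_measurable_imp_measurable_on[of f UNIV] by simp
  then obtain N g where N: "negligible N" and g: "\<And>n. continuous_on UNIV (g n)"
    and lim: "\<And>x. x \<notin> N \<Longrightarrow> (\<lambda>n. g n x) \<longlonglongrightarrow> f x"
    unfolding measurable_on_def by (auto split: if_splits)
  have [measurable]: "g n \<in> borel_measurable borel" for n
    using g by (intro borel_measurable_continuous_onI)
  define h where "h R x = cutoff R x *\<^sub>R clip R (f x)" for R :: nat and x
  have 1: "(\<lambda>R. LINT x|lborel. (norm (f x - h (Suc R) x))\<^sup>2) \<longlonglongrightarrow> (LINT x|(lborel::'a measure). (norm (0::complex))\<^sup>2)"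
  proof (rule integral_dominated_convergence[where w="\<lambda>x. 4 * (norm (f x))\<^sup>2"])
    show "integrable lborel (\<lambda>x. 4 * (norm (f x))\<^sup>2)" using square_integrableD(2)[OF f] by simp
    show "AE x in lborel. (\<lambda>R. (norm (f x - h (Suc R) x))\<^sup>2) \<longlonglongrightarrow> (norm (0::complex))\<^sup>2"
    proof (rule AE_I2)
      fix x
      obtain R0 :: nat where R0: "max (norm x) (norm (f x)) \<le> R0" using real_arch_simple by blast
      have "f x - h (Suc R) x = 0" if "R0 \<le> R" for R
      proof -
        have "norm x \<le> real (Suc R)" "norm (f x) \<le> real (Suc R)" using R0 that by auto
        then show ?thesis by (simp only: h_def cutoff_bounds clip_bounds) (simp add: clip_bounds)
      qed
      then show "(\<lambda>R. (norm (f x - h (Suc R) x))\<^sup>2) \<longlonglongrightarrow> (norm (0::complex))\<^sup>2"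
        by (intro tendsto_eventually) (auto simp: eventually_sequentially)
    qed
    show "AE x in lborel. norm ((norm (f x - h (Suc R) x))\<^sup>2) \<le> 4 * (norm (f x))\<^sup>2" for R
    proof (rule AE_I2)
      fix x
      have "norm (h (Suc R) x) \<le> 1 * norm (f x)"
        unfolding h_def norm_scaleR
          by (intro mult_mono) (use cutoff_bounds clip_bounds in \<open>auto simp: cutoff_def\<close>)
      then have "norm (f x - h (Suc R) x) \<le> 2 * norm (f x)"
        using norm_triangle_ineq4[of "f x" "h (Suc R) x"] by linarith
      from power_mono[OF this, of 2] show "norm ((norm (f x - h (Suc R) x))\<^sup>2) \<le> 4 * (norm (f x))\<^sup>2"
        by (simp add: power_mult_distrib)
    qed
    show "(\<lambda>x. (norm (f x - h (Suc R) x))\<^sup>2) \<in> borel_measurable lborel" for R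
      unfolding h_def by measurable
  qed (auto)
  have "(\<lambda>R. norm2 lborel (\<lambda>x. f x - h (Suc R) x)) \<longlonglongrightarrow> 0"
    unfolding norm2_def using tendsto_real_sqrt[OF 1] by simp
  then have "eventually (\<lambda>R. norm2 lborel (\<lambda>x. f x - h (Suc R) x) < e / 2) sequentially"
    using e by (intro order_tendstoD(2)) auto
  then obtain R' where R': "norm2 lborel (\<lambda>x. f x - h (Suc R') x) < e / 2"
    by (auto simp: eventually_sequentially)
  define R where "R = Suc R'"
  define k where "k n x = cutoff R x *\<^sub>R clip R (g n x)" for n x
  have h_bound: "norm (h R x) \<le> real R * indicator (cball 0 (real R + 1)) x" for x
    using mult_mono[OF cutoff_bounds(2)[of R x] clip_bounds(1)[of R "f x"]] cutoff_bounds(1)[of R x] cutoff_bounds(3)[of R x]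
    by (auto simp: h_def R_def indicator_def)
  have k_bound: "norm (k n x) \<le> real R * indicator (cball 0 (real R + 1)) x" for n x
    using mult_mono[OF cutoff_bounds(2)[of R x] clip_bounds(1)[of R "g n x"]] cutoff_bounds(1)[of R x] cutoff_bounds(3)[of R x]
    by (auto simp: k_def R_def indicator_def)
  have bound: "(norm (h R x - k n x))\<^sup>2 \<le> (2 * real R)\<^sup>2 * indicator (cball 0 (real R + 1)) x" for n x
  proof -
    have "norm (h R x - k n x) \<le> 2 * real R * indicator (cball 0 (real R + 1)) x"
      using norm_triangle_ineq4[of "h R x" "k n x"] h_bound[of x] k_bound[of n x] by linarith
    from power_mono[OF this, of 2] show ?thesis by (auto simp: power_mult_distrib indicator_def)
  qed
  have hm[measurable]: "h R \<in> borel_measurable borel" "k n \<in> borel_measurable borel" for n R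
    unfolding h_def[abs_def] k_def[abs_def] by measurable
  have "AE x in lebesgue. x \<notin> N" using N by (simp add: negligible_iff_null_sets AE_not_in)
  then have AEN: "AE x in lborel. x \<notin> N" by (simp add: AE_completion_iff)
  have 2: "(\<lambda>n. LINT x|lborel. (norm (h R x - k n x))\<^sup>2) \<longlonglongrightarrow> (LINT x|(lborel::'a measure). (norm (0::complex))\<^sup>2)"
  proof (rule integral_dominated_convergence[where w="\<lambda>x. (2 * real R)\<^sup>2 * indicator (cball 0 (real R + 1)) x"])
    show "integrable lborel (\<lambda>x::'a. (2 * real R)\<^sup>2 * indicator (cball 0 (real R + 1)) x :: real)"
      by (rule integrable_indicator_cball)
    show "AE x in lborel. (\<lambda>n. (norm (h R x - k n x))\<^sup>2) \<longlonglongrightarrow> (norm (0::complex))\<^sup>2"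
      using AEN
    proof eventually_elim
      case (elim x)
      have "(\<lambda>n. clip R (g n x)) \<longlonglongrightarrow> clip R (f x)"
        by (rule continuous_on_tendsto_compose[OF continuous_on_clip lim[OF elim]]) auto
      then have "(\<lambda>n. k n x) \<longlonglongrightarrow> h R x" unfolding k_def h_def by (intro tendsto_intros)
      then have "(\<lambda>n. h R x - k n x) \<longlonglongrightarrow> h R x - h R x" by (intro tendsto_intros)
      then show ?case by (intro tendsto_power tendsto_norm) simp
    qed
  qed (use bound in auto)
  have "(\<lambda>n. norm2 lborel (\<lambda>x. h R x - k n x)) \<longlonglongrightarrow> 0"
    unfolding norm2_def using tendsto_real_sqrt[OF 2] by simp
  then have "eventually (\<lambda>n. norm2 lborel (\<lambda>x. h R x - k n x) < e / 2) sequentially"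
    using e by (intro order_tendstoD(2)) auto
  then obtain n where n: "norm2 lborel (\<lambda>x. h R x - k n x) < e / 2"
    by (auto simp: eventually_sequentially)
  have hf: "square_integrable lborel (h R)"
  proof (rule square_integrable_bound[OF f, where C=1])
    show "AE x in lborel. norm (h R x) \<le> 1 * norm (f x)"
      unfolding h_def norm_scaleR by (intro AE_I2 mult_mono) (use cutoff_bounds clip_bounds in \<open>auto simp: cutoff_def\<close>)
  qed measurable
  have "integrable lborel (\<lambda>x. (norm (h R x - k n x))\<^sup>2)"
    by (rule Bochner_Integration.integrable_bound[OF integrable_indicator_cball[of "(2 * real R)\<^sup>2" "real R + 1"] _ AE_I2]) (use bound in auto)
  then have hk: "square_integrable lborel (\<lambda>x. h R x - k n x)" by (simp add: square_integrable_def)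
  have "norm2 lborel (\<lambda>x. f x - k n x) = norm2 lborel (\<lambda>x. (f x - h R x) + (h R x - k n x))" by simp
  also have "\<dots> \<le> norm2 lborel (\<lambda>x. f x - h R x) + norm2 lborel (\<lambda>x. h R x - k n x)"
    by (intro norm2_triangle square_integrable_diff f hf hk)
  also have "\<dots> < e" using R' n by (simp add: R_def)
  finally have "norm2 lborel (\<lambda>x. f x - k n x) < e" .
  moreover have "continuous_on UNIV (k n)"
    unfolding k_def by (intro continuous_on_scaleR continuous_on_cutoff continuous_on_compose2[OF continuous_on_clip g]) auto
  ultimately show thesis
  proof (rule that[rotated 3])
    show "k n x = 0" if "norm x > real R + 1" for x using that by (simp add: k_def cutoff_bounds)
    show "norm (k n x) \<le> R" for x
      using k_bound[of n x] by (cases "norm x \<le> real R + 1") auto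
  qed
qed

lemma square_integrable_translate:
  assumes f: "square_integrable lborel (f :: 'a::euclidean_space \<Rightarrow> complex)"
  shows "square_integrable lborel (\<lambda>x. f (x - w))" "norm2 lborel (\<lambda>x. f (x - w)) = norm2 lborel f"
proof -
  have [measurable]: "f \<in> borel_measurable borel" using square_integrableD(1)[OF f] by simp
  show "square_integrable lborel (\<lambda>x. f (x - w))" "norm2 lborel (\<lambda>x. f (x - w)) = norm2 lborel f"
    using square_integrableD(2)[OF f] lborel_translate[of "\<lambda>x. (norm (f x))\<^sup>2" w]
    by (auto simp: square_integrable_def norm2_def)
qed

text \<open>For a continuous function of bounded support this is dominated convergence, and
  translations preserve the \<open>L\<^sup>2\<close> distance to such an approximant.\<close>

lemma translation_continuous_L2:
  assumes f: "square_integrable lborel (f :: 'a::euclidean_space \<Rightarrow> complex)" and w: "w \<longlonglongrightarrow> 0"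
  shows "(\<lambda>n. norm2 lborel (\<lambda>x. f (x - w n) - f x)) \<longlonglongrightarrow> 0"
proof (rule LIMSEQ_I)
  fix e :: real assume e: "0 < e"
  then obtain g R B where g: "continuous_on UNIV g" "\<And>x. norm x > R \<Longrightarrow> g x = 0" "\<And>x. norm (g x) \<le> B"
    and fg: "norm2 lborel (\<lambda>x. f x - g x) < e / 4"
    using continuous_dense_L2[OF f, of "e / 4"] by (metis zero_less_divide_iff zero_less_numeral)
  have [measurable]: "g \<in> borel_measurable borel" using g(1) by (intro borel_measurable_continuous_onI)
  have B: "0 \<le> B" using g(3)[of 0] norm_ge_zero order_trans by blast
  have bg: "(norm (g x))\<^sup>2 \<le> B\<^sup>2 * indicator (cball 0 R) x" for x
    using power_mono[OF g(3)[of x], of 2] g(2)[of x] by (auto simp: indicator_def)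
  have "integrable lborel (\<lambda>x. (norm (g x))\<^sup>2)"
    by (rule Bochner_Integration.integrable_bound[OF integrable_indicator_cball[of "B\<^sup>2" R] _ AE_I2]) (use bg in auto)
  then have sg: "square_integrable lborel g" by (simp add: square_integrable_def)
  obtain n0 where n0: "\<And>n. n \<ge> n0 \<Longrightarrow> norm (w n) < 1" using LIMSEQ_D[OF w, of 1] by auto
  have "(\<lambda>n. LINT x|lborel. (norm (g (x - w (n + n0)) - g x))\<^sup>2) \<longlonglongrightarrow> (LINT x|(lborel::'a measure). (norm (0::complex))\<^sup>2)"
  proof (rule integral_dominated_convergence[where w="\<lambda>x. (2 * B)\<^sup>2 * indicator (cball 0 (R + 1)) x"])
    show "integrable lborel (\<lambda>x::'a. (2 * B)\<^sup>2 * indicator (cball 0 (R + 1)) x :: real)"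
      by (rule integrable_indicator_cball)
    show "AE x in lborel. (\<lambda>n. (norm (g (x - w (n + n0)) - g x))\<^sup>2) \<longlonglongrightarrow> (norm (0::complex))\<^sup>2"
    proof (rule AE_I2)
      fix x
      have "(\<lambda>n. x - w (n + n0)) \<longlonglongrightarrow> x - 0" by (intro tendsto_intros LIMSEQ_ignore_initial_segment w)
      then have "(\<lambda>n. g (x - w (n + n0))) \<longlonglongrightarrow> g x"
        by (intro continuous_on_tendsto_compose[OF g(1)]) auto
      then have "(\<lambda>n. g (x - w (n + n0)) - g x) \<longlonglongrightarrow> g x - g x" by (intro tendsto_intros)
      then show "(\<lambda>n. (norm (g (x - w (n + n0)) - g x))\<^sup>2) \<longlonglongrightarrow> (norm (0::complex))\<^sup>2"
        by (intro tendsto_power tendsto_norm) simp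
    qed
    show "AE x in lborel. norm ((norm (g (x - w (n + n0)) - g x))\<^sup>2) \<le> (2 * B)\<^sup>2 * indicator (cball 0 (R + 1)) x" for n
    proof (rule AE_I2)
      fix x
      show "norm ((norm (g (x - w (n + n0)) - g x))\<^sup>2) \<le> (2 * B)\<^sup>2 * indicator (cball 0 (R + 1)) x"
      proof (cases "norm x \<le> R + 1")
        case True
        have "norm (g (x - w (n + n0)) - g x) \<le> 2 * B"
          using norm_triangle_ineq4[of "g (x - w (n + n0))" "g x"] g(3)[of "x - w (n + n0)"] g(3)[of x] by linarith
        from power_mono[OF this, of 2] show ?thesis using True by simp
      next
        case False
        have "norm x \<le> norm (x - w (n + n0)) + norm (w (n + n0))"
          using norm_triangle_ineq[of "x - w (n + n0)" "w (n + n0)"] by simp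
        then have "norm (x - w (n + n0)) > R" "norm x > R" using False n0[of "n + n0"] by auto
        then show ?thesis using g(2) by simp
      qed
    qed
  qed auto
  from tendsto_real_sqrt[OF this] have "(\<lambda>n. norm2 lborel (\<lambda>x. g (x - w (n + n0)) - g x)) \<longlonglongrightarrow> 0"
    by (simp add: norm2_def)
  then have "(\<lambda>n. norm2 lborel (\<lambda>x. g (x - w n) - g x)) \<longlonglongrightarrow> 0"
    by (rule LIMSEQ_offset)
  then obtain N where N: "\<And>n. n \<ge> N \<Longrightarrow> norm2 lborel (\<lambda>x. g (x - w n) - g x) < e / 2"
    using LIMSEQ_D[of _ 0 "e / 2"] e by fastforce
  show "\<exists>no. \<forall>n\<ge>no. norm (norm2 lborel (\<lambda>x. f (x - w n) - f x) - 0) < e"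
  proof (intro exI allI impI)
    fix n assume n: "N \<le> n"
    note fgs = square_integrable_diff[OF f sg] square_integrable_diff[OF sg f]
    note tr = square_integrable_translate[OF fgs(1), of "w n"]
    note gg = square_integrable_diff[OF square_integrable_translate(1)[OF sg, of "w n"] sg]
    have "norm2 lborel (\<lambda>x. f (x - w n) - f x)
        = norm2 lborel (\<lambda>x. (f (x - w n) - g (x - w n)) + ((g (x - w n) - g x) + (g x - f x)))" by simp
    also have "\<dots> \<le> norm2 lborel (\<lambda>x. f (x - w n) - g (x - w n)) + norm2 lborel (\<lambda>x. (g (x - w n) - g x) + (g x - f x))"
      by (intro norm2_triangle square_integrable_add tr gg fgs)
    also have "\<dots> \<le> norm2 lborel (\<lambda>x. f (x - w n) - g (x - w n)) + (norm2 lborel (\<lambda>x. g (x - w n) - g x) + norm2 lborel (\<lambda>x. g x - f x))"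
      by (intro add_left_mono norm2_triangle gg fgs)
    also have "\<dots> < e"
      using tr(2) fg N[OF n] norm2_minus_commute[of lborel f g] by simp
    finally show "norm (norm2 lborel (\<lambda>x. f (x - w n) - f x) - 0) < e" by simp
  qed
qed


text \<open>The square of \<open>\<bar>ft f\<bar>\<close> is the Fourier integral of the autocorrelation of \<open>f\<close>. Testing it
  against Gaussians that increase to 1 turns the left side, through the multiplication
  formula, into averages of the autocorrelation around 0, where it is continuous with value
  the square integral of \<open>f\<close>.\<close>

theorem Plancherel_integrable:
  fixes f :: "'a::euclidean_space \<Rightarrow> complex"
  assumes f1: "integrable lborel f" and f2: "square_integrable lborel f"
  shows "square_integrable lborel (ft f)"
    and "(norm2 lborel (ft f))\<^sup>2 = (2 * pi) ^ DIM('a) * (norm2 lborel f)\<^sup>2"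
proof -
  note [measurable] = borel_measurable_integrable[OF f1] ft_measurable[OF f1]
  define f' where "f' x = cnj (f (- x))" for x
  (* A w is the integral of f x * cnj (f (x - w)) *)
  define A where "A = conv f f'"
  (* K m increases to 1 with m, while its transform is (2 pi)^n times an approximate identity *)
  define K where "K m \<xi> = complex_of_real (exp (- (norm (\<xi> /\<^sub>R m))\<^sup>2 / 2))" for m and \<xi> :: 'a
  let ?N = "DIM('a)"
  have f'1: "integrable lborel f'"
    using lborel_reflect(1)[of f 0] f1 unfolding f'_def by (intro integrable_cnj) simp
  have ftf': "ft f' \<xi> = cnj (ft f \<xi>)" for \<xi>
  proof -
    have "ft f' \<xi> = (LINT x|lborel. cis (- ((0 - x) \<bullet> - \<xi>)) * cnj (f (0 - x)))"
      by (simp add: ft_def f'_def)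
    also have "\<dots> = (LINT x|lborel. cis (- (x \<bullet> - \<xi>)) * cnj (f x))"
      by (rule lborel_reflect(2)[of "\<lambda>x. cis (- (x \<bullet> - \<xi>)) * cnj (f x)"]) measurable
    also have "\<dots> = (LINT x|lborel. cnj (cis (- (x \<bullet> \<xi>)) * f x))"
      by (simp add: cis_cnj)
    also have "\<dots> = cnj (ft f \<xi>)" unfolding ft_def by (rule Bochner_Integration.integral_cnj)
    finally show ?thesis .
  qed
  have A1: "integrable lborel A" unfolding A_def by (rule integrable_conv[OF f1 f'1])
  note [measurable] = borel_measurable_integrable[OF A1]
  have ftA: "ft A \<xi> = complex_of_real ((norm (ft f \<xi>))\<^sup>2)" for \<xi>
    by (simp add: A_def ft_conv[OF f1 f'1] ftf' complex_norm_square del: of_real_power)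
  have A_eq: "A w = (LINT x|lborel. f x * cnj (f (x - w)))" for w
    by (simp add: A_def conv_def f'_def)
  have sq_cnj: "square_integrable lborel (\<lambda>x. cnj (g x))" "norm2 lborel (\<lambda>x. cnj (g x)) = norm2 lborel g"
    if "square_integrable lborel g" for g :: "'a \<Rightarrow> complex"
    using that by (auto simp: square_integrable_def norm2_def)
  have A_bound: "norm (A w) \<le> (norm2 lborel f)\<^sup>2" for w
    unfolding A_eq power2_eq_square
    using norm_integral_mult_le[OF f2 sq_cnj(1)[OF square_integrable_translate(1)[OF f2, of w]]]
      sq_cnj(2)[OF square_integrable_translate(1)[OF f2, of w]] square_integrable_translate(2)[OF f2, of w]
    by simp
  have A0: "A 0 = complex_of_real ((norm2 lborel f)\<^sup>2)"
    by (simp add: A_eq norm2_power2 complex_norm_square[symmetric] del: of_real_power)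
  have A_lim: "(\<lambda>n. A (w n)) \<longlonglongrightarrow> A 0" if w: "w \<longlonglongrightarrow> 0" for w
  proof (rule LIM_zero_cancel, rule Lim_null_comparison)
    show "(\<lambda>n. norm2 lborel f * norm2 lborel (\<lambda>x. f (x - w n) - f x)) \<longlonglongrightarrow> 0"
      using tendsto_mult_left[OF translation_continuous_L2[OF f2 w], of "norm2 lborel f"] by simp
    have "norm (A (w n) - A 0) \<le> norm2 lborel f * norm2 lborel (\<lambda>x. f (x - w n) - f x)" for n
    proof -
      note d = square_integrable_diff[OF square_integrable_translate(1)[OF f2, of "w n"] f2]
      have "A (w n) - A 0 = (LINT x|lborel. f x * cnj (f (x - w n) - f x))"
        unfolding A_eq
        by (subst Bochner_Integration.integral_diff[symmetric])
          (auto intro!: integrable_mult_square_integrable f2 sq_cnj square_integrable_translate simp: algebra_simps)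
      then show ?thesis
        using norm_integral_mult_le[OF f2 sq_cnj(1)[OF d]] sq_cnj(2)[OF d] by simp
    qed
    then show "\<forall>\<^sub>F n in sequentially. norm (A (w n) - A 0) \<le> norm2 lborel f * norm2 lborel (\<lambda>x. f (x - w n) - f x)"
      by simp
  qed
  have c: "sqrt (2 * pi) ^ ?N * sqrt (2 * pi) ^ ?N = (2 * pi) ^ ?N"
    by (simp only: power_mult_distrib[symmetric] real_sqrt_mult_self) simp
  have K_eq: "K m = (\<lambda>\<xi>. complex_of_real (sqrt (2 * pi) ^ ?N) * complex_of_real (gauss (\<xi> /\<^sub>R m)))" for m
    by (simp add: fun_eq_iff K_def gauss_eq)
  have K1: "integrable lborel (K m)" if "m > 0" for m
    using lborel_affine_integral(1)[of "\<lambda>x::'a. gauss x" "inverse m" 0] gauss_integrable that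
    unfolding K_eq by (intro integrable_mult_right integrable_of_real) simp
  have ftK: "ft (K m) x = complex_of_real ((2 * pi) ^ ?N * m ^ ?N * gauss (m *\<^sub>R x))" if m: "m > 0" for m x
  proof -
    have "ft (K m) x = m ^ ?N *\<^sub>R ft (\<lambda>\<xi>. complex_of_real (sqrt (2 * pi) ^ ?N) * complex_of_real (gauss \<xi>)) (m *\<^sub>R x)"
      using ft_scale[of "K m" m x] m by (simp add: K_eq)
    also have "ft (\<lambda>\<xi>. complex_of_real (sqrt (2 * pi) ^ ?N) * complex_of_real (gauss \<xi>)) (m *\<^sub>R x)
       = complex_of_real (sqrt (2 * pi) ^ ?N) * complex_of_real (exp (- (norm (m *\<^sub>R x))\<^sup>2 / 2))"
      unfolding ft_def gauss_fourier[symmetric]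
      by (subst integral_mult_right_zero[symmetric]) (simp add: mult_ac)
    also have "exp (- (norm (m *\<^sub>R x))\<^sup>2 / 2) = sqrt (2 * pi) ^ ?N * gauss (m *\<^sub>R x)"
      by (simp add: gauss_eq)
    finally show ?thesis unfolding c[symmetric] by (simp add: scaleR_conv_of_real mult_ac)
  qed
  have key: "(LINT \<xi>|lborel. (norm (ft f \<xi>))\<^sup>2 * exp (- (norm (\<xi> /\<^sub>R m))\<^sup>2 / 2))
      = Re (complex_of_real ((2 * pi) ^ ?N) * (LINT z|lborel. A (z /\<^sub>R m) * gauss z))"
    if m: "m > 0" for m
  proof -
    have "complex_of_real (LINT \<xi>|lborel. (norm (ft f \<xi>))\<^sup>2 * exp (- (norm (\<xi> /\<^sub>R m))\<^sup>2 / 2))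
       = (LINT \<xi>|lborel. ft A \<xi> * K m \<xi>)"
      by (subst integral_complex_of_real[symmetric]) (simp add: ftA K_def)
    also have "\<dots> = (LINT x|lborel. A x * ft (K m) x)"
      by (rule ft_multiplication_formula[OF A1 K1[OF m]])
    also have "\<dots> = inverse m ^ ?N *\<^sub>R (LINT z|lborel. A (z /\<^sub>R m) * ft (K m) (z /\<^sub>R m))"
      using lborel_affine_integral(2)[of "\<lambda>x. A x * ft (K m) x" "inverse m" 0] m ft_measurable[OF K1[OF m]] by simp
    also have "(LINT z|lborel. A (z /\<^sub>R m) * ft (K m) (z /\<^sub>R m))
        = (LINT z|lborel. complex_of_real ((2 * pi) ^ ?N * m ^ ?N) * (A (z /\<^sub>R m) * gauss z))"
      using m by (intro Bochner_Integration.integral_cong) (auto simp: ftK)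
    also have "\<dots> = complex_of_real ((2 * pi) ^ ?N * m ^ ?N) * (LINT z|lborel. (A (z /\<^sub>R m) * gauss z))"
      by simp
    also have "inverse m ^ ?N *\<^sub>R (complex_of_real ((2 * pi) ^ ?N * m ^ ?N) * X) = complex_of_real ((2 * pi) ^ ?N) * X" for X
    proof -
      have "inverse m ^ ?N * ((2 * pi) ^ ?N * m ^ ?N) = (2 * pi) ^ ?N"
        using m by (simp add: power_inverse)
      then show ?thesis
        unfolding scaleR_conv_of_real mult.assoc[symmetric] of_real_mult[symmetric] by (simp only:)
    qed
    finally have "Re (complex_of_real (LINT \<xi>|lborel. (norm (ft f \<xi>))\<^sup>2 * exp (- (norm (\<xi> /\<^sub>R m))\<^sup>2 / 2)))
       = Re (complex_of_real ((2 * pi) ^ ?N) * (LINT z|lborel. A (z /\<^sub>R m) * gauss z))"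
      by (rule arg_cong)
    then show ?thesis by (simp only: Re_complex_of_real)
  qed
  define F where "F m \<xi> = (norm (ft f \<xi>))\<^sup>2 * exp (- (norm (\<xi> /\<^sub>R real (Suc m)))\<^sup>2 / 2)" for m \<xi>
  have lim: "(\<lambda>m. integral\<^sup>L lborel (F m)) \<longlonglongrightarrow> (2 * pi) ^ ?N * (norm2 lborel f)\<^sup>2"
  proof -
    have "(\<lambda>m. LINT z|lborel. A (z /\<^sub>R real (Suc m)) * gauss z) \<longlonglongrightarrow> (LINT z|lborel. A 0 * complex_of_real (gauss (z::'a)))"
    proof (rule integral_dominated_convergence[where w="\<lambda>z. (norm2 lborel f)\<^sup>2 * gauss z"])
      show "integrable lborel (\<lambda>z::'a. (norm2 lborel f)\<^sup>2 * gauss z)" by (intro integrable_mult_right gauss_integrable)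
      show "AE z in lborel. (\<lambda>m. A (z /\<^sub>R real (Suc m)) * gauss z) \<longlonglongrightarrow> A 0 * complex_of_real (gauss z)"
      proof (intro AE_I2 tendsto_mult tendsto_const A_lim)
        fix z :: 'a
        have "(\<lambda>m. inverse (real (Suc m)) *\<^sub>R z) \<longlonglongrightarrow> 0 *\<^sub>R z"
          by (intro tendsto_intros LIMSEQ_inverse_real_of_nat)
        then show "(\<lambda>m. z /\<^sub>R real (Suc m)) \<longlonglongrightarrow> 0" by simp
      qed
      show "AE z in lborel. norm (A (z /\<^sub>R real (Suc m)) * gauss z) \<le> (norm2 lborel f)\<^sup>2 * gauss z" for m
        using A_bound gauss_nonneg by (intro AE_I2) (auto simp: norm_mult intro!: mult_mono)
    qed measurable
    also have "(LINT z|lborel. A 0 * complex_of_real (gauss (z::'a))) = A 0"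
      by (simp add: gauss_integral)
    finally have "(\<lambda>m. Re (complex_of_real ((2 * pi) ^ ?N) * (LINT z|lborel. A (z /\<^sub>R real (Suc m)) * gauss z))) \<longlonglongrightarrow> Re (complex_of_real ((2 * pi) ^ ?N) * A 0)"
      by (intro tendsto_intros)
    moreover have "Re (complex_of_real ((2 * pi) ^ ?N) * A 0) = (2 * pi) ^ ?N * (norm2 lborel f)\<^sup>2"
      unfolding A0 of_real_mult[symmetric] by (rule Re_complex_of_real)
    moreover have "integral\<^sup>L lborel (F m) = Re (complex_of_real ((2 * pi) ^ ?N) * (LINT z|lborel. A (z /\<^sub>R real (Suc m)) * gauss z))" for m
      using key[of "real (Suc m)"] unfolding F_def by simp
    ultimately show ?thesis by simp
  qed
  have F_int: "integrable lborel (F m)" for m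
  proof -
    have "integrable lborel (\<lambda>\<xi>. (LINT x|lborel. norm (f x))\<^sup>2 * norm (K (real (Suc m)) \<xi>))"
      using K1[of "real (Suc m)"] by simp
    then show ?thesis
    proof (rule Bochner_Integration.integrable_bound[OF _ _ AE_I2])
      fix \<xi>
      show "norm (F m \<xi>) \<le> norm ((LINT x|lborel. norm (f x))\<^sup>2 * norm (K (real (Suc m)) \<xi>))"
        unfolding F_def K_def using power_mono[OF norm_ft_le[of f \<xi>], of 2]
        by (auto simp: abs_mult intro!: mult_right_mono)
    qed (simp add: F_def[abs_def])
  qed
  have mono: "AE \<xi> in lborel. mono (\<lambda>m. F m \<xi>)"
  proof (intro AE_I2 incseq_SucI)
    fix \<xi> :: 'a and m
    have "inverse (real (Suc (Suc m))) \<le> inverse (real (Suc m))" by (simp add: field_simps)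
    then have "norm (\<xi> /\<^sub>R real (Suc (Suc m))) \<le> norm (\<xi> /\<^sub>R real (Suc m))"
      by (simp add: mult_right_mono)
    then have "(norm (\<xi> /\<^sub>R real (Suc (Suc m))))\<^sup>2 \<le> (norm (\<xi> /\<^sub>R real (Suc m)))\<^sup>2"
      by (intro power_mono) auto
    then show "F m \<xi> \<le> F (Suc m) \<xi>" unfolding F_def by (intro mult_left_mono) auto
  qed
  have ptw: "AE \<xi> in lborel. (\<lambda>m. F m \<xi>) \<longlonglongrightarrow> (norm (ft f \<xi>))\<^sup>2"
  proof (rule AE_I2)
    fix \<xi> :: 'a
    have "(\<lambda>m. inverse (real (Suc m)) *\<^sub>R \<xi>) \<longlonglongrightarrow> 0 *\<^sub>R \<xi>"
      by (intro tendsto_intros LIMSEQ_inverse_real_of_nat)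
    then have "(\<lambda>m. F m \<xi>) \<longlonglongrightarrow> (norm (ft f \<xi>))\<^sup>2 * exp (- (norm (0 *\<^sub>R \<xi>))\<^sup>2 / 2)"
      unfolding F_def
      by (intro tendsto_mult tendsto_const tendsto_exp tendsto_divide tendsto_minus tendsto_power tendsto_norm) auto
    then show "(\<lambda>m. F m \<xi>) \<longlonglongrightarrow> (norm (ft f \<xi>))\<^sup>2" by simp
  qed
  have "has_bochner_integral lborel (\<lambda>\<xi>. (norm (ft f \<xi>))\<^sup>2) ((2 * pi) ^ ?N * (norm2 lborel f)\<^sup>2)"
    by (rule has_bochner_integral_monotone_convergence[OF F_int mono ptw lim]) measurable
  then show "square_integrable lborel (ft f)"
    "(norm2 lborel (ft f))\<^sup>2 = (2 * pi) ^ DIM('a) * (norm2 lborel f)\<^sup>2"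
    by (auto simp: square_integrable_def norm2_power2 has_bochner_integral_iff)
qed

section \<open>The Fourier transform on square-integrable functions\<close>

lemma lebesgue_lborel:
  fixes g :: "'a::euclidean_space \<Rightarrow> 'b::{banach, second_countable_topology}"
  assumes "g \<in> borel_measurable borel"
  shows "integrable lebesgue g \<longleftrightarrow> integrable lborel g"
    and "integral\<^sup>L lebesgue g = integral\<^sup>L lborel g"
    and "square_integrable lebesgue g \<longleftrightarrow> square_integrable lborel g"
    and "norm2 lebesgue g = norm2 lborel g"
    and "g \<in> borel_measurable lebesgue"
proof -
  have g[measurable]: "g \<in> borel_measurable lborel" using assms by simp
  show "integrable lebesgue g \<longleftrightarrow> integrable lborel g" "integral\<^sup>L lebesgue g = integral\<^sup>L lborel g"
    by (rule integrable_completion integral_completion, rule g)+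
  show m: "g \<in> borel_measurable lebesgue" by (rule measurable_completion[OF g])
  have n: "(\<lambda>x. (norm (g x))\<^sup>2) \<in> borel_measurable lborel" by measurable
  show "square_integrable lebesgue g \<longleftrightarrow> square_integrable lborel g" "norm2 lebesgue g = norm2 lborel g"
    using m g by (simp_all add: square_integrable_def norm2_def integrable_completion[OF n] integral_completion[OF n])
qed

lemma borel_representative:
  fixes f :: "'a::euclidean_space \<Rightarrow> real"
  assumes "f \<in> borel_measurable lebesgue"
  obtains f' where "f' \<in> borel_measurable borel" "AE x in lebesgue. f x = f' x"
  using completion_ex_borel_measurable_real[OF assms] by (auto dest: AE_completion)

lemma fourier_eq_ft:
  fixes f f' :: "real^'n \<Rightarrow> real"
  assumes f: "f \<in> borel_measurable lebesgue" and f': "f' \<in> borel_measurable borel"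
    and ae: "AE x in lebesgue. f x = f' x"
  shows "fourier f = ft (\<lambda>x. complex_of_real (f' x))"
proof
  fix \<xi> :: "real^'n"
  note [measurable] = f f'
  have c: "exp (- (\<i> * complex_of_real (x \<bullet> \<xi>))) = cis (- (x \<bullet> \<xi>))" for x
    by (simp add: cis_conv_exp)
  have m: "(\<lambda>x. cis (- (x \<bullet> \<xi>)) * complex_of_real (f' x)) \<in> borel_measurable borel" by measurable
  have mc: "(\<lambda>x. cis (- (x \<bullet> \<xi>))) \<in> borel_measurable lebesgue"
    by (intro lebesgue_lborel(5)) measurable
  have "fourier f \<xi> = (LINT x|lebesgue. cis (- (x \<bullet> \<xi>)) * complex_of_real (f' x))"
    unfolding fourier_def c
    using ae by (intro integral_cong_AE borel_measurable_times mc lebesgue_lborel(5)[OF m])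
      (auto intro!: borel_measurable_of_real f elim: eventually_mono)
  then show "fourier f \<xi> = ft (\<lambda>x. complex_of_real (f' x)) \<xi>"
    by (simp add: lebesgue_lborel(2)[OF m] ft_def)
qed

lemma fourier_cong_AE:
  fixes f g :: "real^'n \<Rightarrow> real"
  assumes f: "f \<in> borel_measurable lebesgue" and ae: "AE x in lebesgue. f x = g x"
  shows "fourier f = fourier g"
proof -
  have g: "g \<in> borel_measurable lebesgue" using borel_measurable_AE[OF f ae] .
  obtain f' where f': "f' \<in> borel_measurable borel" "AE x in lebesgue. f x = f' x"
    using borel_representative[OF f] .
  have "AE x in lebesgue. g x = f' x" using f'(2) ae by eventually_elim simp
  then show ?thesis using fourier_eq_ft[OF f f'] fourier_eq_ft[OF g f'(1)] by simp
qed

lemma fourier_linear: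
  fixes f g :: "real^'n \<Rightarrow> real"
  assumes f: "integrable lebesgue f" and g: "integrable lebesgue g"
  shows "fourier (\<lambda>x. a * f x + g x) \<xi> = complex_of_real a * fourier f \<xi> + fourier g \<xi>"
proof -
  have mc: "(\<lambda>x. - (x \<bullet> \<xi>)) \<in> borel_measurable lebesgue"
    by (intro lebesgue_lborel(5)) measurable
  have c: "exp (- (\<i> * complex_of_real (x \<bullet> \<xi>))) = cis (- (x \<bullet> \<xi>))" for x
    by (simp add: cis_conv_exp)
  have i: "integrable lebesgue (\<lambda>x. cis (- (x \<bullet> \<xi>)) * complex_of_real (h x))" if "integrable lebesgue h" for h
    by (intro integrable_cis_mult mc integrable_of_real that)
  show ?thesis unfolding fourier_def c
    using i[OF f] i[OF g]
    by (simp add: distrib_left mult.left_commute[of "cis _" "complex_of_real a"])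
qed

lemma norm_fourier_le: "norm (fourier f \<xi>) \<le> (LINT x|lebesgue. \<bar>f x\<bar>)"
proof -
  have "norm (fourier f \<xi>) \<le> (LINT x|lebesgue. norm (exp (- (\<i> * complex_of_real (x \<bullet> \<xi>))) * complex_of_real (f x)))"
    unfolding fourier_def by (rule integral_norm_bound)
  then show ?thesis by (simp add: norm_mult)
qed

lemma fourier_uminus: "fourier f (- \<xi>) = cnj (fourier f \<xi>)"
  unfolding fourier_def by (subst Bochner_Integration.integral_cnj[symmetric]) (simp add: exp_cnj)

lemma integrable_representative:
  fixes f :: "real^'n \<Rightarrow> real"
  assumes f: "integrable lebesgue f"
  obtains f' where "f' \<in> borel_measurable borel" "AE x in lebesgue. f x = f' x"
    "integrable lborel f'" "fourier f = ft (\<lambda>x. complex_of_real (f' x))"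
proof -
  have fm: "f \<in> borel_measurable lebesgue" using f by (rule borel_measurable_integrable)
  then obtain f' where f': "f' \<in> borel_measurable borel" "AE x in lebesgue. f x = f' x"
    using borel_representative by blast
  have "integrable lebesgue f'"
    using integrable_cong_AE[OF fm lebesgue_lborel(5)[OF f'(1)] f'(2)] f by simp
  then show thesis
    using that[OF f' _ fourier_eq_ft[OF fm f']] lebesgue_lborel(1)[OF f'(1)] by simp
qed

lemma continuous_on_fourier:
  fixes f :: "real^'n \<Rightarrow> real"
  assumes f: "integrable lebesgue f"
  shows "continuous_on UNIV (fourier f)"
proof -
  obtain f' where "integrable lborel f'" "fourier f = ft (\<lambda>x. complex_of_real (f' x))"
    using integrable_representative[OF f] by metis
  then show ?thesis using continuous_on_ft[of "\<lambda>x. complex_of_real (f' x)"] by simp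
qed

lemma fourier_borel:
  fixes f :: "real^'n \<Rightarrow> real"
  shows "integrable lebesgue f \<Longrightarrow> fourier f \<in> borel_measurable borel"
  by (intro borel_measurable_continuous_onI continuous_on_fourier)

lemma Plancherel_fourier:
  fixes f :: "real^'n \<Rightarrow> real"
  assumes f1: "integrable lebesgue f" and f2: "square_integrable lebesgue f"
  shows "square_integrable lebesgue (fourier f)"
    and "norm2 lebesgue (fourier f) = sqrt ((2 * pi) ^ CARD('n)) * norm2 lebesgue f"
proof -
  obtain f' where f': "f' \<in> borel_measurable borel" "AE x in lebesgue. f x = f' x" "integrable lborel f'"
    and ff: "fourier f = ft (\<lambda>x. complex_of_real (f' x))"
    using integrable_representative[OF f1] .
  let ?g = "\<lambda>x. complex_of_real (f' x)"
  have g: "?g \<in> borel_measurable borel" using f'(1) by simp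
  have n: "norm2 lebesgue f = norm2 lborel f'"
    using norm2_cong_AE[OF square_integrableD(1)[OF f2] lebesgue_lborel(5)[OF f'(1)] f'(2)]
      lebesgue_lborel(4)[OF f'(1)] by simp
  have "square_integrable lborel f'"
    using square_integrable_cong_AE[OF f2 lebesgue_lborel(5)[OF f'(1)] f'(2)]
      lebesgue_lborel(3)[OF f'(1)] by simp
  then have g2: "square_integrable lborel ?g" using g by (simp add: square_integrable_def)
  have g1: "integrable lborel ?g" using f'(3) by simp
  note P = Plancherel_integrable[OF g1 g2]
  have b: "fourier f \<in> borel_measurable borel" by (rule fourier_borel[OF f1])
  show "square_integrable lebesgue (fourier f)"
    using P(1) lebesgue_lborel(3)[OF b] by (simp add: ff)
  have "(norm2 lebesgue (fourier f))\<^sup>2 = (2 * pi) ^ CARD('n) * (norm2 lebesgue f)\<^sup>2"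
  proof -
    have "norm2 lborel ?g = norm2 lborel f'" by (simp add: norm2_def)
    then show ?thesis using P(2) lebesgue_lborel(4)[OF b] by (simp add: ff n)
  qed
  then have "sqrt ((norm2 lebesgue (fourier f))\<^sup>2) = sqrt ((2 * pi) ^ CARD('n) * (norm2 lebesgue f)\<^sup>2)"
    by simp
  then show "norm2 lebesgue (fourier f) = sqrt ((2 * pi) ^ CARD('n)) * norm2 lebesgue f"
    by (simp add: real_sqrt_mult)
qed

definition truncate :: "real \<Rightarrow> (real^'n \<Rightarrow> real) \<Rightarrow> real^'n \<Rightarrow> real" where
  "truncate R f x = indicator (cball 0 R) x * f x"

lemma truncate_L2:
  fixes f :: "real^'n \<Rightarrow> real"
  assumes f: "square_integrable lebesgue f"
  shows "square_integrable lebesgue (truncate R f)" "integrable lebesgue (truncate R f)"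
    and "((\<lambda>R. norm2 lebesgue (\<lambda>x. f x - truncate R f x)) \<longlongrightarrow> 0) at_top"
    and "((\<lambda>R. norm2 lebesgue (truncate R f)) \<longlongrightarrow> norm2 lebesgue f) at_top"
proof -
  note fm[measurable] = square_integrableD(1)[OF f]
  have im: "(indicator (cball 0 R) :: real^'n \<Rightarrow> real) \<in> borel_measurable lebesgue" for R
    by (intro lebesgue_lborel(5) borel_measurable_indicator) simp
  have tm[measurable]: "truncate R f \<in> borel_measurable lebesgue" for R
    unfolding truncate_def[abs_def] by (intro borel_measurable_times im fm)
  show t2: "square_integrable lebesgue (truncate R f)" for R
    by (rule square_integrable_bound[OF f tm, where C=1]) (auto simp: truncate_def indicator_def)
  have "integrable lborel (indicator (cball 0 R) :: real^'n \<Rightarrow> real)"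
    using integrable_indicator_cball[of 1 R] by simp
  then have "integrable lebesgue (indicator (cball 0 R) :: real^'n \<Rightarrow> real)"
    by (subst lebesgue_lborel(1)) (auto intro!: borel_measurable_indicator)
  moreover have "(norm (indicator (cball 0 R) x :: real))\<^sup>2 = indicator (cball 0 R) x" for x :: "real^'n"
    by (simp add: indicator_def)
  ultimately have "square_integrable lebesgue (indicator (cball 0 R) :: real^'n \<Rightarrow> real)"
    using im by (simp add: square_integrable_def)
  from integrable_mult_square_integrable[OF this f]
  show "integrable lebesgue (truncate R f)" by (simp add: truncate_def[abs_def])
  have "((\<lambda>R. LINT x|lebesgue. (norm (f x - truncate R f x))\<^sup>2) \<longlongrightarrow> (LINT x|(lebesgue :: (real^'n) measure). 0)) at_top"
  proof (rule integral_dominated_convergence_at_top[where w="\<lambda>x. (norm (f x))\<^sup>2"])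
    show "AE x in lebesgue. ((\<lambda>R. (norm (f x - truncate R f x))\<^sup>2) \<longlongrightarrow> 0) at_top"
    proof (rule AE_I2)
      fix x
      have "eventually (\<lambda>R. (norm (f x - truncate R f x))\<^sup>2 = 0) at_top"
        using eventually_ge_at_top[of "norm x"] by eventually_elim (simp add: truncate_def)
      then show "((\<lambda>R. (norm (f x - truncate R f x))\<^sup>2) \<longlongrightarrow> 0) at_top" by (rule tendsto_eventually)
    qed
    show "\<forall>\<^sub>F R in at_top. AE x in lebesgue. norm ((norm (f x - truncate R f x))\<^sup>2) \<le> (norm (f x))\<^sup>2"
      by (intro always_eventually allI AE_I2) (auto simp: truncate_def indicator_def)
  qed (use square_integrableD(2)[OF f] in auto)
  from tendsto_real_sqrt[OF this] show lim: "((\<lambda>R. norm2 lebesgue (\<lambda>x. f x - truncate R f x)) \<longlongrightarrow> 0) at_top"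
    by (simp add: norm2_def)
  show "((\<lambda>R. norm2 lebesgue (truncate R f)) \<longlongrightarrow> norm2 lebesgue f) at_top"
  proof (rule LIM_zero_cancel, rule Lim_null_comparison[OF always_eventually lim], rule allI)
    fix R
    show "norm (norm2 lebesgue (truncate R f) - norm2 lebesgue f) \<le> norm2 lebesgue (\<lambda>x. f x - truncate R f x)"
      using norm2_diff_le[OF f t2[of R]] by (simp add: abs_minus_commute)
  qed
qed

text \<open>For square-integrable \<open>f\<close> and \<open>F\<close> the extended integral is finite, so the limit is one
  of real norms, to which the triangle inequality applies.\<close>

lemma L2_fourier_iff:
  "L2_fourier f F \<longleftrightarrow> square_integrable lebesgue f \<and> square_integrable lebesgue F \<and>
    ((\<lambda>R. norm2 lebesgue (\<lambda>\<xi>. F \<xi> - fourier (truncate R f) \<xi>)) \<longlongrightarrow> 0) at_top"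
proof -
  have "((\<lambda>R. \<integral>\<^sup>+ \<xi>. ennreal ((norm (F \<xi> - fourier (\<lambda>x. indicator (cball 0 R) x * f x) \<xi>))\<^sup>2) \<partial>lebesgue) \<longlongrightarrow> 0) at_top
    \<longleftrightarrow> ((\<lambda>R. norm2 lebesgue (\<lambda>\<xi>. F \<xi> - fourier (truncate R f) \<xi>)) \<longlongrightarrow> 0) at_top"
    if f: "square_integrable lebesgue f" and F: "square_integrable lebesgue F"
  proof -
    let ?n = "\<lambda>R. norm2 lebesgue (\<lambda>\<xi>. F \<xi> - fourier (truncate R f) \<xi>)"
    have t: "truncate R f = (\<lambda>x. indicator (cball 0 R) x * f x)" for R
      by (simp add: truncate_def[abs_def])
    have "(\<integral>\<^sup>+ \<xi>. ennreal ((norm (F \<xi> - fourier (\<lambda>x. indicator (cball 0 R) x * f x) \<xi>))\<^sup>2) \<partial>lebesgue) = ennreal ((?n R)\<^sup>2)" for R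
      unfolding norm2_power2 t[symmetric]
      by (intro nn_integral_eq_integral square_integrableD(2) square_integrable_diff F
          Plancherel_fourier(1) truncate_L2(1,2) f) auto
    then have "((\<lambda>R. \<integral>\<^sup>+ \<xi>. ennreal ((norm (F \<xi> - fourier (\<lambda>x. indicator (cball 0 R) x * f x) \<xi>))\<^sup>2) \<partial>lebesgue) \<longlongrightarrow> 0) at_top
      \<longleftrightarrow> ((\<lambda>R. ennreal ((?n R)\<^sup>2)) \<longlongrightarrow> ennreal 0) at_top" by simp
    also have "\<dots> \<longleftrightarrow> ((\<lambda>R. (?n R)\<^sup>2) \<longlongrightarrow> 0) at_top"
      by (intro tendsto_ennreal_iff) auto
    also have "\<dots> \<longleftrightarrow> (?n \<longlongrightarrow> 0) at_top"
    proof
      assume "((\<lambda>R. (?n R)\<^sup>2) \<longlongrightarrow> 0) at_top"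
      from tendsto_real_sqrt[OF this] show "(?n \<longlongrightarrow> 0) at_top" by simp
    next
      assume "(?n \<longlongrightarrow> 0) at_top"
      from tendsto_power[OF this, of 2] show "((\<lambda>R. (?n R)\<^sup>2) \<longlongrightarrow> 0) at_top" by simp
    qed
    finally show ?thesis .
  qed
  then show ?thesis by (auto simp: L2_fourier_def in_L2_iff)
qed

lemma L2_fourierD:
  assumes "L2_fourier f F"
  shows "square_integrable lebesgue f" "square_integrable lebesgue F"
    "((\<lambda>R. norm2 lebesgue (\<lambda>\<xi>. F \<xi> - fourier (truncate R f) \<xi>)) \<longlongrightarrow> 0) at_top"
  using assms by (auto simp: L2_fourier_iff)

lemma fourier_truncate_L2:
  "square_integrable lebesgue f \<Longrightarrow> square_integrable lebesgue (fourier (truncate R f))"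
  by (intro Plancherel_fourier(1) truncate_L2)

lemma L2_fourier_cong:
  assumes L: "L2_fourier f F" and f: "AE x in lebesgue. f x = f' x" and F: "AE \<xi> in lebesgue. F \<xi> = F' \<xi>"
  shows "L2_fourier f' F'"
proof -
  note D = L2_fourierD[OF L]
  have fm: "f' \<in> borel_measurable lebesgue" using borel_measurable_AE[OF square_integrableD(1)[OF D(1)] f] .
  have Fm: "F' \<in> borel_measurable lebesgue" using borel_measurable_AE[OF square_integrableD(1)[OF D(2)] F] .
  have t: "fourier (truncate R f) = fourier (truncate R f')" for R
    using f by (intro fourier_cong_AE square_integrableD(1)[OF truncate_L2(1)[OF D(1)]])
      (auto simp: truncate_def elim: eventually_mono)
  have "norm2 lebesgue (\<lambda>\<xi>. F \<xi> - fourier (truncate R f) \<xi>) = norm2 lebesgue (\<lambda>\<xi>. F' \<xi> - fourier (truncate R f') \<xi>)" for R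
    unfolding t[symmetric]
    using F by (intro norm2_cong_AE borel_measurable_diff square_integrableD(1)[OF D(2)] Fm
        square_integrableD(1)[OF fourier_truncate_L2[OF D(1)]]) (auto elim: eventually_mono)
  then show ?thesis
    using D square_integrable_cong_AE[OF D(1) fm f] square_integrable_cong_AE[OF D(2) Fm F]
    by (simp add: L2_fourier_iff)
qed

lemma L2_fourier_linear:
  assumes f: "L2_fourier f F" and g: "L2_fourier g G"
  shows "L2_fourier (\<lambda>x. a * f x + g x) (\<lambda>\<xi>. complex_of_real a * F \<xi> + G \<xi>)"
proof -
  note Df = L2_fourierD[OF f] and Dg = L2_fourierD[OF g]
  have s1: "square_integrable lebesgue (\<lambda>x. a * f x + g x)"
    using square_integrable_add[OF square_integrable_scaleR[OF Df(1), of a] Dg(1)] by simp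
  have s2: "square_integrable lebesgue (\<lambda>\<xi>. complex_of_real a * F \<xi> + G \<xi>)"
    using square_integrable_add[OF square_integrable_scaleR[OF Df(2), of a] Dg(2)] by (simp add: scaleR_conv_of_real)
  have t: "truncate R (\<lambda>x. a * f x + g x) = (\<lambda>x. a * truncate R f x + truncate R g x)" for R
    by (simp add: truncate_def[abs_def] algebra_simps)
  have le: "norm2 lebesgue (\<lambda>\<xi>. complex_of_real a * F \<xi> + G \<xi> - fourier (truncate R (\<lambda>x. a * f x + g x)) \<xi>)
     \<le> \<bar>a\<bar> * norm2 lebesgue (\<lambda>\<xi>. F \<xi> - fourier (truncate R f) \<xi>) + norm2 lebesgue (\<lambda>\<xi>. G \<xi> - fourier (truncate R g) \<xi>)" for R
  proof -
    have "complex_of_real a * F \<xi> + G \<xi> - fourier (truncate R (\<lambda>x. a * f x + g x)) \<xi>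
      = a *\<^sub>R (F \<xi> - fourier (truncate R f) \<xi>) + (G \<xi> - fourier (truncate R g) \<xi>)" for \<xi>
      unfolding t fourier_linear[OF truncate_L2(2)[OF Df(1)] truncate_L2(2)[OF Dg(1)]]
      by (simp add: scaleR_conv_of_real algebra_simps)
    then have "norm2 lebesgue (\<lambda>\<xi>. complex_of_real a * F \<xi> + G \<xi> - fourier (truncate R (\<lambda>x. a * f x + g x)) \<xi>)
      = norm2 lebesgue (\<lambda>\<xi>. a *\<^sub>R (F \<xi> - fourier (truncate R f) \<xi>) + (G \<xi> - fourier (truncate R g) \<xi>))" by (simp only:)
    also have "\<dots> \<le> norm2 lebesgue (\<lambda>\<xi>. a *\<^sub>R (F \<xi> - fourier (truncate R f) \<xi>)) + norm2 lebesgue (\<lambda>\<xi>. G \<xi> - fourier (truncate R g) \<xi>)"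
      by (intro norm2_triangle square_integrable_scaleR square_integrable_diff Df(2) Dg(2) fourier_truncate_L2 Df(1) Dg(1))
    finally show ?thesis by (simp only: norm2_scaleR)
  qed
  have "((\<lambda>R. \<bar>a\<bar> * norm2 lebesgue (\<lambda>\<xi>. F \<xi> - fourier (truncate R f) \<xi>) + norm2 lebesgue (\<lambda>\<xi>. G \<xi> - fourier (truncate R g) \<xi>)) \<longlongrightarrow> \<bar>a\<bar> * 0 + 0) at_top"
    by (intro tendsto_intros Df(3) Dg(3))
  then have "((\<lambda>R. \<bar>a\<bar> * norm2 lebesgue (\<lambda>\<xi>. F \<xi> - fourier (truncate R f) \<xi>) + norm2 lebesgue (\<lambda>\<xi>. G \<xi> - fourier (truncate R g) \<xi>)) \<longlongrightarrow> 0) at_top"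
    by simp
  from Lim_null_comparison[OF always_eventually this,
      of "\<lambda>R. norm2 lebesgue (\<lambda>\<xi>. complex_of_real a * F \<xi> + G \<xi> - fourier (truncate R (\<lambda>x. a * f x + g x)) \<xi>)"]
  show ?thesis using le s1 s2 by (simp add: L2_fourier_iff)
qed

lemma L2_fourier_diff:
  assumes f: "L2_fourier f F" and g: "L2_fourier g G"
  shows "L2_fourier (\<lambda>x. f x - g x) (\<lambda>\<xi>. F \<xi> - G \<xi>)"
  using L2_fourier_linear[OF g f, of "-1"] by (simp add: algebra_simps)

lemma L2_fourier_zero: "L2_fourier (\<lambda>x::real^'n. 0) (\<lambda>\<xi>. 0)"
proof -
  have "fourier (truncate R (\<lambda>x::real^'n. 0)) \<xi> = 0" for R \<xi>
    by (simp add: truncate_def[abs_def] fourier_def)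
  then show ?thesis by (simp add: L2_fourier_iff square_integrable_def norm2_def)
qed

lemma L2_fourier_sum:
  assumes "finite A" "\<And>i. i \<in> A \<Longrightarrow> L2_fourier (f i) (F i)"
  shows "L2_fourier (\<lambda>x. \<Sum>i\<in>A. a i * f i x) (\<lambda>\<xi>. \<Sum>i\<in>A. complex_of_real (a i) * F i \<xi>)"
  using assms
proof (induction A rule: finite_induct)
  case empty
  then show ?case by (simp add: L2_fourier_zero)
next
  case (insert i A)
  then show ?case using L2_fourier_linear[of "f i" "F i" _ _ "a i"] by simp
qed

text \<open>Both norms are limits of the norms for the truncations, which are integrable.\<close>

lemma Plancherel_L2_fourier:
  fixes f :: "real^'n \<Rightarrow> real"
  assumes "L2_fourier f F"
  shows "norm2 lebesgue F = sqrt ((2 * pi) ^ CARD('n)) * norm2 lebesgue f"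
proof -
  note D = L2_fourierD[OF assms]
  have "((\<lambda>R. norm2 lebesgue (fourier (truncate R f))) \<longlongrightarrow> norm2 lebesgue F) at_top"
  proof (rule LIM_zero_cancel, rule Lim_null_comparison[OF always_eventually D(3)], rule allI)
    fix R
    show "norm (norm2 lebesgue (fourier (truncate R f)) - norm2 lebesgue F) \<le> norm2 lebesgue (\<lambda>\<xi>. F \<xi> - fourier (truncate R f) \<xi>)"
      using norm2_diff_le[OF D(2) fourier_truncate_L2[OF D(1), of R]] by (simp add: abs_minus_commute)
  qed
  moreover have "((\<lambda>R. norm2 lebesgue (fourier (truncate R f))) \<longlongrightarrow> sqrt ((2 * pi) ^ CARD('n)) * norm2 lebesgue f) at_top"
    unfolding Plancherel_fourier(2)[OF truncate_L2(2,1)[OF D(1)]]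
    by (intro tendsto_intros truncate_L2(4) D(1))
  ultimately show ?thesis by (rule tendsto_unique[OF trivial_limit_at_top_linorder])
qed

lemma L2_fourier_unique:
  assumes "L2_fourier f F" "L2_fourier f G"
  shows "AE \<xi> in lebesgue. F \<xi> = G \<xi>"
proof -
  have d: "L2_fourier (\<lambda>x. f x - f x) (\<lambda>\<xi>. F \<xi> - G \<xi>)" by (rule L2_fourier_diff[OF assms])
  have "norm2 lebesgue (\<lambda>\<xi>. F \<xi> - G \<xi>) = 0"
    using Plancherel_L2_fourier[OF d] by (simp add: norm2_def)
  from norm2_eq_0_AE[OF L2_fourierD(2)[OF d] this] show ?thesis by simp
qed

text \<open>By Plancherel, a difference with vanishing transform has norm 0.\<close>

lemma L2_fourier_injective:
  assumes f: "L2_fourier f F" and g: "L2_fourier g F"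
  shows "AE x in lebesgue. f x = g x"
proof -
  have d: "L2_fourier (\<lambda>x. f x - g x) (\<lambda>\<xi>. F \<xi> - F \<xi>)" by (rule L2_fourier_diff[OF f g])
  have "norm2 lebesgue (\<lambda>x. f x - g x) = 0"
    using Plancherel_L2_fourier[OF d] by (simp add: norm2_def)
  from norm2_eq_0_AE[OF L2_fourierD(1)[OF d] this] show ?thesis by simp
qed

lemma L2_fourier_fourier:
  fixes f :: "real^'n \<Rightarrow> real"
  assumes f1: "integrable lebesgue f" and f2: "square_integrable lebesgue f"
  shows "L2_fourier f (fourier f)"
proof -
  have "norm2 lebesgue (\<lambda>\<xi>. fourier f \<xi> - fourier (truncate R f) \<xi>)
    = sqrt ((2 * pi) ^ CARD('n)) * norm2 lebesgue (\<lambda>x. f x - truncate R f x)" for R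
  proof -
    have "fourier f \<xi> - fourier (truncate R f) \<xi> = fourier (\<lambda>x. f x - truncate R f x) \<xi>" for \<xi>
      using fourier_linear[OF truncate_L2(2)[OF f2] f1, of "-1"] by simp
    then show ?thesis
      using Plancherel_fourier(2)[OF Bochner_Integration.integrable_diff[OF f1 truncate_L2(2)[OF f2]] square_integrable_diff[OF f2 truncate_L2(1)[OF f2]]]
      by simp
  qed
  then show ?thesis
    using tendsto_mult_left[OF truncate_L2(3)[OF f2], of "sqrt ((2 * pi) ^ CARD('n))"] f2 Plancherel_fourier(1)[OF f1 f2]
    by (simp add: L2_fourier_iff)
qed

lemma L2_fourier_eq_fourier:
  assumes "L2_fourier f F" "integrable lebesgue f"
  shows "AE \<xi> in lebesgue. F \<xi> = fourier f \<xi>"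
  by (rule L2_fourier_unique[OF assms(1) L2_fourier_fourier[OF assms(2) L2_fourierD(1)[OF assms(1)]]])

lemma L2_fourier_fourier_L2:
  "L2_fourier f F \<Longrightarrow> L2_fourier f (fourier_L2 f)"
  unfolding fourier_L2_def by (rule someI[of "L2_fourier f"])

definition ift :: "(real^'n \<Rightarrow> complex) \<Rightarrow> real^'n \<Rightarrow> complex" where
  "ift F x = ft F (- x) /\<^sub>R (2 * pi) ^ CARD('n)"

text \<open>Expanding the square and moving the transform over by the multiplication formula,
  the squared distance of \<open>F\<close> from the transform of a truncation of its inverse transform \<open>g\<close>
  is the square integral of \<open>F\<close> minus \<open>(2\<pi>)\<^sup>n\<close> times that of the truncation. By Plancherel
  for \<open>F\<close> this tends to 0.\<close>

theorem L2_fourier_ift: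
  fixes F :: "real^'n \<Rightarrow> complex"
  assumes F1: "integrable lborel F" and F2: "square_integrable lborel F"
    and g: "\<And>x. complex_of_real (g x) = ift F x"
  shows "L2_fourier g F"
proof -
  define c where "c = (2 * pi) ^ CARD('n)"
  have c: "c > 0" by (simp add: c_def)
  note [measurable] = borel_measurable_integrable[OF F1] ft_measurable[OF F1]
  have Fm: "F \<in> borel_measurable borel" by simp
  have gR: "g = (\<lambda>x. Re (ift F x))" using g by (metis Re_complex_of_real)
  have gm[measurable]: "g \<in> borel_measurable borel" unfolding gR ift_def[abs_def] by measurable
  have ng: "(norm (g x))\<^sup>2 = (norm (ft F (- x)))\<^sup>2 / c\<^sup>2" for x
  proof -
    have "norm (g x) = norm (complex_of_real (g x))" by simp
    then show ?thesis unfolding g using c by (simp add: ift_def c_def power_mult_distrib divide_inverse power_inverse)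
  qed
  note P = Plancherel_integrable[OF F1 F2]
  have P2: "(LINT x|lborel. (norm (ft F x))\<^sup>2) = c * (norm2 lborel F)\<^sup>2"
    using P(2) by (simp add: norm2_power2[symmetric] c_def)
  have reflF: "integrable lborel (\<lambda>x. (norm (ft F (- x)))\<^sup>2)"
    "(LINT x|lborel. (norm (ft F (- x)))\<^sup>2) = (LINT x|lborel. (norm (ft F x))\<^sup>2)"
    using lborel_reflect[of "\<lambda>x. (norm (ft F x))\<^sup>2" 0] square_integrableD(2)[OF P(1)] by simp_all
  have g2: "square_integrable lborel g"
    unfolding square_integrable_def ng using reflF(1) by simp
  have g2': "square_integrable lebesgue g" using g2 lebesgue_lborel(3)[OF gm] by simp
  have ng2: "c * (norm2 lborel g)\<^sup>2 = (norm2 lborel F)\<^sup>2"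
  proof -
    have "(norm2 lborel g)\<^sup>2 = c * (norm2 lborel F)\<^sup>2 / c\<^sup>2"
      unfolding norm2_power2[of lborel g] ng using reflF(2) P2 by simp
    then show ?thesis using c by (simp add: power2_eq_square)
  qed
  have tm[measurable]: "truncate R g \<in> borel_measurable borel" for R
    unfolding truncate_def[abs_def]
    by (intro borel_measurable_times borel_measurable_indicator gm) simp
  have key: "(norm2 lebesgue (\<lambda>\<xi>. F \<xi> - fourier (truncate R g) \<xi>))\<^sup>2 = (norm2 lborel F)\<^sup>2 - c * (norm2 lebesgue (truncate R g))\<^sup>2" for R
  proof -
    define h where "h x = complex_of_real (truncate R g x)" for x
    have hm[measurable]: "h \<in> borel_measurable borel" unfolding h_def[abs_def] by measurable
    have "integrable lborel (truncate R g)"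
      using truncate_L2(2)[OF g2', of R] lebesgue_lborel(1)[OF tm] by simp
    then have h1: "integrable lborel h" by (simp add: h_def[abs_def])
    have "square_integrable lborel (truncate R g)"
      using truncate_L2(1)[OF g2', of R] lebesgue_lborel(3)[OF tm] by simp
    then have h2: "square_integrable lborel h" by (simp add: h_def[abs_def] square_integrable_def)
    have nh: "norm2 lborel h = norm2 lebesgue (truncate R g)"
      using lebesgue_lborel(4)[OF tm, of R] by (simp add: h_def[abs_def] norm2_def)
    have fh: "fourier (truncate R g) = ft h"
      unfolding h_def[abs_def] by (rule fourier_eq_ft[OF lebesgue_lborel(5)[OF tm] tm]) simp
    have [measurable]: "ft h \<in> borel_measurable borel" by (rule ft_measurable[OF h1])
    note Ph = Plancherel_integrable[OF h1 h2]
    have cF1: "integrable lborel (\<lambda>\<xi>. cnj (F \<xi>))" using F1 by simp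
    have cF2: "square_integrable lborel (\<lambda>\<xi>. cnj (F \<xi>))" using F2 by (simp add: square_integrable_def)
    have ftc: "ft (\<lambda>\<xi>. cnj (F \<xi>)) x = complex_of_real (c * g x)" for x
    proof -
      have "ft (\<lambda>\<xi>. cnj (F \<xi>)) x = (LINT \<xi>|lborel. cnj (cis (- (\<xi> \<bullet> (- x))) * F \<xi>))"
        unfolding ft_def by (simp add: cis_cnj)
      also have "\<dots> = cnj (ft F (- x))"
        unfolding ft_def by (rule Bochner_Integration.integral_cnj)
      also have "ft F (- x) = complex_of_real (c * g x)"
      proof -
        have "complex_of_real (c * g x) = complex_of_real c * (inverse c *\<^sub>R ft F (- x))"
          unfolding of_real_mult g ift_def c_def[symmetric] by (rule refl)
        then show ?thesis using c by (simp add: scaleR_conv_of_real)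
      qed
      finally show ?thesis by simp
    qed
    have "(LINT \<xi>|lborel. ft h \<xi> * cnj (F \<xi>)) = (LINT x|lborel. h x * ft (\<lambda>\<xi>. cnj (F \<xi>)) x)"
      by (rule ft_multiplication_formula[OF h1 cF1])
    also have "\<dots> = (LINT x|lborel. complex_of_real (c * (norm (h x))\<^sup>2))"
    proof (intro Bochner_Integration.integral_cong refl)
      fix x
      have "(norm (h x))\<^sup>2 = truncate R g x * g x"
        by (simp add: h_def truncate_def indicator_def power2_eq_square)
      then show "h x * ft (\<lambda>\<xi>. cnj (F \<xi>)) x = complex_of_real (c * (norm (h x))\<^sup>2)"
        by (simp add: ftc h_def)
    qed
    also have "\<dots> = complex_of_real (c * (norm2 lborel h)\<^sup>2)"
      unfolding norm2_power2 by (subst integral_complex_of_real) simp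
    finally have cross: "Re (LINT \<xi>|lborel. ft h \<xi> * cnj (F \<xi>)) = c * (norm2 lborel h)\<^sup>2" by simp
    have i: "integrable lborel (\<lambda>\<xi>. ft h \<xi> * cnj (F \<xi>))"
      by (rule integrable_mult_square_integrable[OF Ph(1) cF2])
    have ex: "(norm (F \<xi> - ft h \<xi>))\<^sup>2 = (norm (F \<xi>))\<^sup>2 - 2 * Re (ft h \<xi> * cnj (F \<xi>)) + (norm (ft h \<xi>))\<^sup>2" for \<xi>
      unfolding cmod_power2 by (simp add: power2_eq_square algebra_simps)
    have "(norm2 lborel (\<lambda>\<xi>. F \<xi> - ft h \<xi>))\<^sup>2 = (norm2 lborel F)\<^sup>2 - 2 * Re (LINT \<xi>|lborel. ft h \<xi> * cnj (F \<xi>)) + (norm2 lborel (ft h))\<^sup>2"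
      unfolding norm2_power2 ex
      using i square_integrableD(2)[OF F2] square_integrableD(2)[OF Ph(1)]
      by (simp del: times_complex.simps)
    also have "\<dots> = (norm2 lborel F)\<^sup>2 - c * (norm2 lborel h)\<^sup>2"
      unfolding cross using Ph(2) by (simp add: c_def)
    finally show ?thesis
      using lebesgue_lborel(4)[of "\<lambda>\<xi>. F \<xi> - ft h \<xi>"] by (simp add: fh nh)
  qed
  have "((\<lambda>R. (norm2 lborel F)\<^sup>2 - c * (norm2 lebesgue (truncate R g))\<^sup>2) \<longlongrightarrow> (norm2 lborel F)\<^sup>2 - c * (norm2 lebesgue g)\<^sup>2) at_top"
    by (intro tendsto_intros truncate_L2(4) g2')
  then have "((\<lambda>R. (norm2 lebesgue (\<lambda>\<xi>. F \<xi> - fourier (truncate R g) \<xi>))\<^sup>2) \<longlongrightarrow> 0) at_top"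
    using lebesgue_lborel(4)[OF gm] ng2 by (simp add: key)
  from tendsto_real_sqrt[OF this]
  show ?thesis using g2' F2 lebesgue_lborel(3)[OF Fm] by (simp add: L2_fourier_iff)
qed

section \<open>Multipliers with integrable output\<close>

lemma square_integrable_weight:
  assumes "a > real DIM('a) / 2"
  shows "square_integrable lborel (\<lambda>x::'a::euclidean_space. (1 + (norm x)\<^sup>2) powr (- a / 2))"
proof -
  have "(norm ((1 + (norm x)\<^sup>2) powr (- a / 2)))\<^sup>2 = (1 + (norm x)\<^sup>2) powr (- a)" for x :: 'a
  proof -
    have "(1 + (norm x)\<^sup>2) powr (- a / 2) * (1 + (norm x)\<^sup>2) powr (- a / 2) = (1 + (norm x)\<^sup>2) powr (- a)"
      unfolding powr_add[symmetric] by simp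
    then show ?thesis by (simp add: power2_eq_square)
  qed
  then show ?thesis using integrable_one_plus_norm_powr[OF assms] by (simp add: square_integrable_def)
qed

text \<open>By the Cauchy-Schwarz inequality, more than \<open>n/2\<close> powers of the weight buy
  integrability.\<close>

lemma integrable_of_weighted_L2:
  fixes f :: "real^'n \<Rightarrow> 'b::{banach, second_countable_topology}"
  assumes f: "square_integrable lebesgue (\<lambda>x. (1 + (norm x)\<^sup>2) powr (s / 2) *\<^sub>R f x)"
    and fm: "f \<in> borel_measurable lebesgue" and g: "g \<in> borel_measurable lebesgue"
    and a: "s - a > real CARD('n) / 2"
    and le: "AE x in lebesgue. norm (g x) \<le> (1 + (norm x)\<^sup>2) powr (a / 2) * norm (f x)"
  shows "integrable lebesgue (g :: real^'n \<Rightarrow> 'b)"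
proof -
  let ?w = "\<lambda>x::real^'n. (1 + (norm x)\<^sup>2) powr (- (s - a) / 2)"
  have wm: "?w \<in> borel_measurable borel" by measurable
  have w: "square_integrable lebesgue ?w"
    using square_integrable_weight[of "s - a", where 'a="real^'n"] a lebesgue_lborel(3)[OF wm] by simp
  show ?thesis
  proof (rule Bochner_Integration.integrable_bound[OF integrable_norm_mult[OF w f] g])
    show "AE x in lebesgue. norm (g x) \<le> norm (norm (?w x) * norm ((1 + (norm x)\<^sup>2) powr (s / 2) *\<^sub>R f x))"
      using le
    proof eventually_elim
      case (elim x)
      have "(1 + (norm x)\<^sup>2) powr (a / 2) = ?w x * (1 + (norm x)\<^sup>2) powr (s / 2)"
        unfolding powr_add[symmetric] by (simp add: field_simps)
      then show ?case using elim by (simp add: mult.assoc abs_mult)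
    qed
  qed
qed

lemma cnj_ft_hermitian:
  assumes [measurable]: "F \<in> borel_measurable borel" and h: "\<And>\<xi>. F (- \<xi>) = cnj (F \<xi>)"
  shows "cnj (ft F x) = ft F x"
proof -
  have "cnj (ft F x) = (LINT \<xi>|lborel. cnj (cis (- (\<xi> \<bullet> x)) * F \<xi>))"
    unfolding ft_def by (rule Bochner_Integration.integral_cnj[symmetric])
  also have "\<dots> = (LINT \<xi>|lborel. cis (- ((0 - \<xi>) \<bullet> x)) * F (0 - \<xi>))"
    by (simp add: cis_cnj h)
  also have "\<dots> = ft F x"
    unfolding ft_def by (rule lborel_reflect(2)[of "\<lambda>\<xi>. cis (- (\<xi> \<bullet> x)) * F \<xi>" 0]) measurable
  finally show ?thesis .
qed

lemma ift_hermitian: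
  assumes "F \<in> borel_measurable borel" "\<And>\<xi>. F (- \<xi>) = cnj (F \<xi>)"
  shows "complex_of_real (Re (ift F x)) = ift F x"
proof -
  have "cnj (ift F x) = ift F x"
    unfolding ift_def complex_cnj_scaleR cnj_ft_hermitian[OF assms] by (rule refl)
  then show ?thesis by (simp add: complex_eq_iff)
qed

text \<open>\<open>fourier_multiplier\<close> chooses a function with the right transform. The inverse transform of
  the product is such a function, and it is real because the product is Hermitian.\<close>

lemma L2_fourier_multiplier:
  fixes Q :: "real^'n \<Rightarrow> complex"
  assumes w: "L2_fourier w Q"
    and m1: "integrable lborel (\<lambda>\<xi>. m \<xi> * Q \<xi>)" and m2: "square_integrable lborel (\<lambda>\<xi>. m \<xi> * Q \<xi>)"
    and h: "\<And>\<xi>. m (- \<xi>) * Q (- \<xi>) = cnj (m \<xi> * Q \<xi>)"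
  shows "L2_fourier (fourier_multiplier m w) (\<lambda>\<xi>. m \<xi> * Q \<xi>)"
proof -
  have b: "(\<lambda>\<xi>. m \<xi> * Q \<xi>) \<in> borel_measurable borel" using borel_measurable_integrable[OF m1] by simp
  have g: "L2_fourier (\<lambda>x. Re (ift (\<lambda>\<xi>. m \<xi> * Q \<xi>) x)) (\<lambda>\<xi>. m \<xi> * Q \<xi>)"
    by (rule L2_fourier_ift[OF m1 m2]) (rule ift_hermitian[OF b h])
  have ae: "AE \<xi> in lebesgue. m \<xi> * fourier_L2 w \<xi> = m \<xi> * Q \<xi>"
    using L2_fourier_unique[OF L2_fourier_fourier_L2[OF w] w] by eventually_elim simp
  have "L2_fourier (\<lambda>x. Re (ift (\<lambda>\<xi>. m \<xi> * Q \<xi>) x)) (\<lambda>\<xi>. m \<xi> * fourier_L2 w \<xi>)"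
    using ae by (intro L2_fourier_cong[OF g]) (auto elim: eventually_mono)
  then have "L2_fourier (fourier_multiplier m w) (\<lambda>\<xi>. m \<xi> * fourier_L2 w \<xi>)"
    unfolding fourier_multiplier_def by (rule someI[of "\<lambda>g. L2_fourier g (\<lambda>\<xi>. m \<xi> * fourier_L2 w \<xi>)"])
  then show ?thesis by (rule L2_fourier_cong[OF _ _ ae]) simp
qed

section \<open>The transform of the nonlinearity\<close>

text \<open>The convolution is integrable, and bounded by the Cauchy-Schwarz inequality.\<close>

lemma conv_bounded_L2:
  fixes U V :: "'a::euclidean_space \<Rightarrow> complex"
  assumes U: "integrable lborel U" "square_integrable lborel U"
    and V: "integrable lborel V" "square_integrable lborel V"
  shows "square_integrable lborel (conv U V)"
proof -
  note c = integrable_conv[OF U(1) V(1)]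
  have Vm[measurable]: "V \<in> borel_measurable borel" using borel_measurable_integrable[OF V(1)] by simp
  let ?B = "norm2 lborel U * norm2 lborel V"
  have b: "norm (conv U V w) \<le> ?B" for w
  proof -
    have s: "square_integrable lborel (\<lambda>x. V (w - x))" "norm2 lborel (\<lambda>x. V (w - x)) = norm2 lborel V"
      using square_integrableD(2)[OF V(2)] lborel_reflect[of "\<lambda>x. (norm (V x))\<^sup>2" w]
      by (auto simp: square_integrable_def norm2_def)
    show ?thesis unfolding conv_def using norm_integral_mult_le[OF U(2) s(1)] s(2) by simp
  qed
  have "integrable lborel (\<lambda>w. (norm (conv U V w))\<^sup>2)"
  proof (rule Bochner_Integration.integrable_bound[OF integrable_mult_right[OF integrable_norm[OF c], of ?B] _ AE_I2])
    fix w
    have "(norm (conv U V w))\<^sup>2 \<le> ?B * norm (conv U V w)"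
      unfolding power2_eq_square by (intro mult_right_mono b) simp
    then show "norm ((norm (conv U V w))\<^sup>2) \<le> norm (?B * norm (conv U V w))" by (simp add: abs_mult)
  qed (use borel_measurable_integrable[OF c] in measurable)
  then show ?thesis using borel_measurable_integrable[OF c] by (simp add: square_integrable_def)
qed

text \<open>A product of two inverse transforms is the inverse transform of the convolution.\<close>

lemma L2_fourier_product:
  fixes U V :: "real^'n \<Rightarrow> complex"
  assumes U: "integrable lborel U" "square_integrable lborel U" "\<And>\<xi>. U (- \<xi>) = cnj (U \<xi>)"
    and V: "integrable lborel V" "square_integrable lborel V" "\<And>\<xi>. V (- \<xi>) = cnj (V \<xi>)"
    and u: "L2_fourier u U" and v: "L2_fourier v V"
  shows "L2_fourier (\<lambda>x. u x * v x) (\<lambda>\<xi>. conv U V \<xi> / (2 * pi) ^ CARD('n))"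
proof -
  define c where "c = (2 * pi) ^ CARD('n)"
  have c: "c > 0" by (simp add: c_def)
  have b: "U \<in> borel_measurable borel" "V \<in> borel_measurable borel"
    using borel_measurable_integrable[OF U(1)] borel_measurable_integrable[OF V(1)] by auto
  note hU = ift_hermitian[OF b(1) U(3)] and hV = ift_hermitian[OF b(2) V(3)]
  have "AE x in lebesgue. u x = Re (ift U x)"
    by (rule L2_fourier_injective[OF u L2_fourier_ift[OF U(1,2) hU]])
  moreover have "AE x in lebesgue. v x = Re (ift V x)"
    by (rule L2_fourier_injective[OF v L2_fourier_ift[OF V(1,2) hV]])
  ultimately have ae: "AE x in lebesgue. Re (ift U x) * Re (ift V x) = u x * v x"
    by eventually_elim simp
  define H where "H = (\<lambda>\<xi>. inverse c *\<^sub>R conv U V \<xi>)"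
  have H: "integrable lborel H" "square_integrable lborel H"
    unfolding H_def by (intro integrable_scaleR_right integrable_conv U V square_integrable_scaleR conv_bounded_L2)+
  have ftH: "ft H x = inverse c *\<^sub>R (ft U x * ft V x)" for x
  proof -
    have "ft H x = inverse c *\<^sub>R ft (conv U V) x"
      unfolding ft_def H_def by (subst integral_scaleR_right[symmetric]) simp
    then show ?thesis by (simp add: ft_conv U V)
  qed
  have "L2_fourier (\<lambda>x. Re (ift U x) * Re (ift V x)) H"
  proof (rule L2_fourier_ift[OF H])
    show "complex_of_real (Re (ift U x) * Re (ift V x)) = ift H x" for x
      unfolding of_real_mult hU hV by (simp add: ift_def ftH c_def)
  qed
  from L2_fourier_cong[OF this ae, of H] show ?thesis
    using c by (simp add: H_def c_def scaleR_conv_of_real divide_inverse mult.commute)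
qed

text \<open>Leibniz's rule on the Fourier side: reflecting the convolution variable exchanges
  \<open>\<eta>\<^sub>k\<close> with \<open>\<xi>\<^sub>k - \<eta>\<^sub>k\<close>, and the two halves add up to \<open>\<xi>\<^sub>k\<close>.\<close>

lemma conv_coordinate_multiplier:
  fixes U :: "real^'n \<Rightarrow> complex"
  assumes U: "square_integrable lborel U" and V: "square_integrable lborel (\<lambda>\<xi>. \<i> * complex_of_real (\<xi> $ k) * U \<xi>)"
  shows "conv U (\<lambda>\<xi>. \<i> * complex_of_real (\<xi> $ k) * U \<xi>) w = \<i> * complex_of_real (w $ k) / 2 * conv U U w"
proof -
  let ?V = "\<lambda>\<xi>. \<i> * complex_of_real (\<xi> $ k) * U \<xi>"
  have [measurable]: "U \<in> borel_measurable borel" "?V \<in> borel_measurable borel"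
    using square_integrableD(1)[OF U] square_integrableD(1)[OF V] by simp_all
  have UV: "integrable lborel (\<lambda>x. U x * ?V (w - x))"
  proof (rule integrable_mult_square_integrable[OF U])
    show "square_integrable lborel (\<lambda>x. ?V (w - x))"
      using square_integrableD(2)[OF V] lborel_reflect(1)[of "\<lambda>x. (norm (?V x))\<^sup>2" w]
      by (auto simp: square_integrable_def)
  qed
  have refl: "integrable lborel (\<lambda>x. U (w - x) * ?V x)" "(LINT x|lborel. U (w - x) * ?V x) = (LINT x|lborel. U x * ?V (w - x))"
    using lborel_reflect[of "\<lambda>x. U x * ?V (w - x)" w] UV by simp_all
  have "2 * conv U ?V w = (LINT x|lborel. U x * ?V (w - x)) + (LINT x|lborel. U (w - x) * ?V x)"
    unfolding refl(2) conv_def by simp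
  also have "\<dots> = (LINT x|lborel. U x * ?V (w - x) + U (w - x) * ?V x)"
    using UV refl(1) by (rule Bochner_Integration.integral_add[symmetric])
  also have "\<dots> = (LINT x|lborel. \<i> * complex_of_real (w $ k) * (U x * U (w - x)))"
    by (intro Bochner_Integration.integral_cong HOL.refl) (simp add: algebra_simps)
  also have "\<dots> = \<i> * complex_of_real (w $ k) * conv U U w"
    unfolding conv_def by (rule integral_mult_right_zero)
  finally show ?thesis by (simp add: field_simps)
qed

lemma L2_fourier_nonlinearity:
  fixes u :: "real^'n \<Rightarrow> real" and k :: 'n
  defines "Q \<equiv> \<lambda>\<xi>. \<i> * complex_of_real (\<xi> $ k) / 2 * fourier (\<lambda>x. (u x)\<^sup>2) \<xi>"
  assumes u1: "integrable lebesgue u" and u2: "square_integrable lebesgue u"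
    and U1: "integrable lborel (fourier u)"
    and V1: "integrable lborel (\<lambda>\<xi>. \<i> * complex_of_real (\<xi> $ k) * fourier u \<xi>)"
    and V2: "square_integrable lborel (\<lambda>\<xi>. \<i> * complex_of_real (\<xi> $ k) * fourier u \<xi>)"
  shows "L2_fourier (\<lambda>x. u x * partial_deriv k u x) Q" "integrable lborel Q" "square_integrable lborel Q"
proof -
  let ?U = "fourier u" and ?V = "\<lambda>\<xi>. \<i> * complex_of_real (\<xi> $ k) * fourier u \<xi>"
  let ?c = "complex_of_real ((2 * pi) ^ CARD('n))"
  have uU: "L2_fourier u ?U" by (rule L2_fourier_fourier[OF u1 u2])
  have Ub: "?U \<in> borel_measurable borel" by (rule fourier_borel[OF u1])
  have U2: "square_integrable lborel ?U"
    using L2_fourierD(2)[OF uU] lebesgue_lborel(3)[OF Ub] by simp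
  have hU: "?U (- \<xi>) = cnj (?U \<xi>)" for \<xi> by (rule fourier_uminus)
  have hV: "?V (- \<xi>) = cnj (?V \<xi>)" for \<xi> by (simp add: fourier_uminus)
  have v: "L2_fourier (partial_deriv k u) ?V"
    unfolding partial_deriv_def by (rule L2_fourier_multiplier[OF uU V1 V2]) (simp add: fourier_uminus)
  have P: "L2_fourier (\<lambda>x. u x * partial_deriv k u x) (\<lambda>\<xi>. conv ?U ?V \<xi> / ?c)"
    using L2_fourier_product[OF U1 U2 hU V1 V2 hV uU v] by simp
  have S: "L2_fourier (\<lambda>x. (u x)\<^sup>2) (\<lambda>\<xi>. conv ?U ?U \<xi> / ?c)"
    using L2_fourier_product[OF U1 U2 hU U1 U2 hU uU uU] by (simp add: power2_eq_square)
  have i: "integrable lebesgue (\<lambda>x. (u x)\<^sup>2)" using square_integrableD(2)[OF u2] by simp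
  have ae: "AE \<xi> in lebesgue. conv ?U ?V \<xi> / ?c = Q \<xi>"
    using L2_fourier_eq_fourier[OF S i]
  proof eventually_elim
    case (elim \<xi>)
    show ?case unfolding Q_def elim[symmetric] conv_coordinate_multiplier[OF U2 V2] by simp
  qed
  show PQ: "L2_fourier (\<lambda>x. u x * partial_deriv k u x) Q"
    by (rule L2_fourier_cong[OF P _ ae]) simp
  have Qb: "Q \<in> borel_measurable borel"
    using fourier_borel[OF i] unfolding Q_def by measurable
  show "square_integrable lborel Q" using L2_fourierD(2)[OF PQ] lebesgue_lborel(3)[OF Qb] by simp
  have I: "integrable lborel (\<lambda>\<xi>. conv ?U ?V \<xi> / ?c)"
    using integrable_conv[OF U1 V1] by simp
  have "AE \<xi> in lborel. conv ?U ?V \<xi> / ?c = Q \<xi>"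
    using ae by (simp only: AE_completion_iff)
  from integrable_cong_AE[OF borel_measurable_integrable[OF I] _ this] I Qb
  show "integrable lborel Q" by simp
qed

section \<open>A test functional of scale \<open>h\<close> at the origin\<close>

text \<open>The weights of a fourth difference. The order 4 exceeds \<open>n/2 + 2\<close> in dimensions up to 3, and a
  fourth difference annihilates the quadratic polynomials.\<close>

definition diff4 :: "nat \<Rightarrow> real" where
  "diff4 j = (- 1) ^ j * real (4 choose j)"

lemma sum_diff4:
  fixes X :: "nat \<Rightarrow> 'a::real_vector"
  shows "(\<Sum>j\<le>4. diff4 j *\<^sub>R X j) = X 0 - 4 *\<^sub>R X 1 + 6 *\<^sub>R X 2 - 4 *\<^sub>R X 3 + X 4"
proof -
  have b: "(4 choose 0) = (1::nat)" "(4 choose 1) = (4::nat)" "(4 choose 2) = (6::nat)" "(4 choose 3) = (4::nat)" "(4 choose 4) = (1::nat)"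
    by (simp_all add: eval_nat_numeral)
  have d: "diff4 0 = 1" "diff4 1 = - 4" "diff4 2 = 6" "diff4 3 = - 4" "diff4 4 = 1"
    unfolding diff4_def b by simp_all
  have "{..4::nat} = {0, 1, 2, 3, 4}" by auto
  then have "(\<Sum>j\<le>4. diff4 j *\<^sub>R X j) = diff4 0 *\<^sub>R X 0 + (diff4 1 *\<^sub>R X 1 + (diff4 2 *\<^sub>R X 2 + (diff4 3 *\<^sub>R X 3 + diff4 4 *\<^sub>R X 4)))"
    by simp
  then show ?thesis unfolding d by (simp add: algebra_simps)
qed

lemma sum_abs_diff4: "(\<Sum>j\<le>4. \<bar>diff4 j\<bar>) = 16"
proof -
  have "{..4::nat} = {0, 1, 2, 3, 4}" by auto
  then show ?thesis by (simp add: diff4_def abs_mult eval_nat_numeral)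
qed

text \<open>The ball is centred at minus the unit vector in direction \<open>k\<close>, so that the five translates in
  \<open>test\<close> sit at \<open>-1, 0, 1, 2, 3\<close> on that axis. At the symmetric nodes \<open>-2, \<dots>, 2\<close> the
  fourth difference of the odd function \<open>t \<bar>t\<bar>\<close> would vanish.\<close>

definition bump :: "'n \<Rightarrow> real \<Rightarrow> real \<Rightarrow> real^'n \<Rightarrow> real" where
  "bump k \<rho> h \<xi> = indicator (ball (- axis k 1) \<rho>) (\<xi> /\<^sub>R h)"

definition test :: "'n \<Rightarrow> real \<Rightarrow> real \<Rightarrow> real^'n \<Rightarrow> real" where
  "test k \<rho> h \<xi> = (\<Sum>j\<le>4. diff4 j * bump k \<rho> h (\<xi> - (h * real j) *\<^sub>R axis k 1))"

definition pairing :: "'n \<Rightarrow> real \<Rightarrow> real \<Rightarrow> (real^'n \<Rightarrow> complex) \<Rightarrow> complex" where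
  "pairing k \<rho> h F = (LINT \<xi>|lebesgue. F \<xi> * complex_of_real (test k \<rho> h \<xi>))"

lemma bump_measurable [measurable]: "bump (k::'n::finite) \<rho> h \<in> borel_measurable borel"
proof -
  have "(\<lambda>\<xi>::real^'n. \<xi> /\<^sub>R h) \<in> borel_measurable borel"
    by (intro borel_measurable_continuous_onI continuous_intros)
  then have "(\<lambda>\<xi>::real^'n. indicator (ball (- axis k 1) \<rho>) (\<xi> /\<^sub>R h) :: real) \<in> borel_measurable borel"
    using measurable_compose[of "\<lambda>\<xi>::real^'n. \<xi> /\<^sub>R h" borel borel "indicator (ball (- axis k 1) \<rho>) :: real^'n \<Rightarrow> real" borel]
    by (simp add: borel_measurable_indicator)
  then show ?thesis by (simp add: bump_def[abs_def])
qed

lemma test_measurable [measurable]: "test k \<rho> h \<in> borel_measurable borel"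
  unfolding test_def[abs_def] by measurable

lemma bump_bounds: "0 \<le> bump k \<rho> h \<xi>" "bump k \<rho> h \<xi> \<le> 1"
  by (auto simp: bump_def indicator_def)

lemma bump_support:
  assumes "0 < h" "bump k \<rho> h \<xi> \<noteq> 0"
  shows "norm \<xi> < h * (1 + \<rho>)"
proof -
  have "norm (\<xi> /\<^sub>R h) < 1 + \<rho>"
  proof -
    have "dist (- axis k 1) (\<xi> /\<^sub>R h) < \<rho>"
      using assms(2) by (auto simp: bump_def indicator_def split: if_splits)
    then show ?thesis
      using dist_triangle[of 0 "\<xi> /\<^sub>R h" "- axis k 1"] by (simp add: dist_0_norm norm_axis_1)
  qed
  then show ?thesis using assms(1) by (simp add: field_simps)
qed

text \<open>With \<open>\<rho> \<le> 1\<close> the translate by \<open>h j\<close> lies within \<open>h (1 + \<rho> + j) \<le> 6 h\<close> of the origin.\<close>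

lemma bump_translate_bound:
  assumes "0 < h" "\<rho> \<le> 1" "j \<le> 4"
  shows "\<bar>bump k \<rho> h (\<xi> - (h * real j) *\<^sub>R axis k 1)\<bar> \<le> indicator (cball 0 (6 * h)) \<xi>"
proof (cases "bump k \<rho> h (\<xi> - (h * real j) *\<^sub>R axis k 1) = 0")
  case False
  have "norm \<xi> \<le> norm (\<xi> - (h * real j) *\<^sub>R axis k 1) + norm ((h * real j) *\<^sub>R (axis k 1 :: real^'a))"
    using norm_triangle_ineq[of "\<xi> - (h * real j) *\<^sub>R axis k 1" "(h * real j) *\<^sub>R (axis k 1 :: real^'a)"] by simp
  also have "\<dots> \<le> h * (1 + \<rho>) + h * real j"
    using bump_support[OF assms(1) False] assms by (simp add: norm_axis_1)
  also have "\<dots> \<le> h * (1 + 1) + h * 4" using assms by (intro add_mono mult_left_mono) auto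
  finally have "\<xi> \<in> cball 0 (6 * h)" by simp
  then show ?thesis using bump_bounds[of k \<rho> h "\<xi> - (h * real j) *\<^sub>R axis k 1"] by simp
qed simp

lemma test_bound:
  assumes "0 < h" "\<rho> \<le> 1"
  shows "\<bar>test k \<rho> h \<xi>\<bar> \<le> 16 * indicator (cball 0 (6 * h)) \<xi>"
proof -
  have "\<bar>test k \<rho> h \<xi>\<bar> \<le> (\<Sum>j\<le>4. \<bar>diff4 j * bump k \<rho> h (\<xi> - (h * real j) *\<^sub>R axis k 1)\<bar>)"
    unfolding test_def by (rule sum_abs)
  also have "\<dots> \<le> (\<Sum>j\<le>4. \<bar>diff4 j\<bar> * indicator (cball 0 (6 * h)) \<xi>)"
    unfolding abs_mult by (intro sum_mono mult_left_mono bump_translate_bound assms) auto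
  also have "\<dots> = 16 * indicator (cball 0 (6 * h)) \<xi>"
    by (simp add: sum_distrib_right[symmetric] sum_abs_diff4)
  finally show ?thesis .
qed

lemma integrable_bounded_support:
  fixes b :: "'a::euclidean_space \<Rightarrow> real"
  assumes [measurable]: "b \<in> borel_measurable borel" and b: "\<And>x. \<bar>b x\<bar> \<le> C * indicator (cball 0 R) x"
  shows "integrable lborel b" "square_integrable lborel b"
proof -
  show "integrable lborel b"
    by (rule Bochner_Integration.integrable_bound[OF integrable_indicator_cball[of C R] _ AE_I2]) (use b in \<open>auto intro: order_trans[OF b]\<close>)
  have "(b x)\<^sup>2 \<le> C\<^sup>2 * indicator (cball 0 R) x" for x
    using power_mono[OF b[of x], of 2] by (auto simp: power_mult_distrib indicator_def split: if_splits)
  then have "integrable lborel (\<lambda>x. (b x)\<^sup>2)"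
    by (intro Bochner_Integration.integrable_bound[OF integrable_indicator_cball[of "C\<^sup>2" R] _ AE_I2]) auto
  then show "square_integrable lborel b" by (simp add: square_integrable_def)
qed

lemma test_L2:
  assumes "0 < h" "\<rho> \<le> 1"
  shows "square_integrable lebesgue (\<lambda>\<xi>. complex_of_real (test k \<rho> h \<xi>))"
proof -
  have m: "(\<lambda>\<xi>. complex_of_real (test k \<rho> h \<xi>)) \<in> borel_measurable borel" by measurable
  show ?thesis using integrable_bounded_support(2)[OF test_measurable test_bound[OF assms]] lebesgue_lborel(3)[OF m]
    by (simp add: square_integrable_def)
qed

lemma pairing_L2_bound:
  assumes "0 < h" "\<rho> \<le> 1" "square_integrable lebesgue F"
  shows "norm (pairing k \<rho> h F) \<le> norm2 lebesgue F * norm2 lebesgue (\<lambda>\<xi>. complex_of_real (test k \<rho> h \<xi>))"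
  unfolding pairing_def by (rule norm_integral_mult_le[OF assms(3) test_L2[OF assms(1,2)]])

lemma pairing_diff:
  assumes "0 < h" "\<rho> \<le> 1" "square_integrable lebesgue F" "square_integrable lebesgue G"
  shows "pairing k \<rho> h (\<lambda>\<xi>. F \<xi> - G \<xi>) = pairing k \<rho> h F - pairing k \<rho> h G"
  unfolding pairing_def
  using integrable_mult_square_integrable[OF assms(3) test_L2[OF assms(1,2)], of k]
    integrable_mult_square_integrable[OF assms(4) test_L2[OF assms(1,2)], of k]
  by (simp add: left_diff_distrib)

lemma integrable_continuous_bounded_support:
  fixes F :: "'a::euclidean_space \<Rightarrow> complex" and b :: "'a \<Rightarrow> real"
  assumes F: "continuous_on UNIV F" and [measurable]: "b \<in> borel_measurable borel"
    and b: "\<And>x. \<bar>b x\<bar> \<le> C * indicator (cball 0 R) x"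
  shows "integrable lborel (\<lambda>x. F x * complex_of_real (b x))"
proof -
  have [measurable]: "F \<in> borel_measurable borel" using F by (rule borel_measurable_continuous_onI)
  have "bounded (F ` cball 0 R)"
    by (intro compact_imp_bounded compact_continuous_image continuous_on_subset[OF F]) auto
  then obtain M where M: "\<forall>x\<in>cball 0 R. norm (F x) \<le> M" unfolding bounded_iff by auto
  show ?thesis
  proof (rule Bochner_Integration.integrable_bound[OF integrable_mult_right[OF integrable_bounded_support(1)[OF assms(2) b], of M] _ AE_I2])
    fix x
    show "norm (F x * complex_of_real (b x)) \<le> norm (M * b x)"
    proof (cases "x \<in> cball 0 R")
      case True
      have "norm (F x) \<le> \<bar>M\<bar>" using bspec[OF M True] by simp
      then show ?thesis by (simp add: norm_mult abs_mult mult_right_mono)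
    next
      case False
      then show ?thesis using b[of x] by simp
    qed
  qed measurable
qed

text \<open>Rescaling to \<open>h = 1\<close> and shifting each translate back moves the fourth difference from the
  test function onto \<open>F\<close>.\<close>

lemma pairing_fourth_difference:
  fixes F :: "real^'n \<Rightarrow> complex"
  assumes F: "continuous_on UNIV F" and h: "0 < h" and \<rho>: "\<rho> \<le> 1"
  shows "pairing k \<rho> h F = complex_of_real (h ^ CARD('n)) *
    (LINT \<eta>|lborel. complex_of_real (indicator (ball (- axis k 1) \<rho>) \<eta>) *
       (\<Sum>j\<le>4. diff4 j *\<^sub>R F (h *\<^sub>R (\<eta> + real j *\<^sub>R axis k 1))))"
proof -
  let ?e = "axis k 1 :: real^'n" and ?B = "ball (- axis k 1) \<rho> :: (real^'n) set"
  have Fm[measurable]: "F \<in> borel_measurable borel" using F by (rule borel_measurable_continuous_onI)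
  have m: "(\<lambda>\<xi>. F \<xi> * complex_of_real (test k \<rho> h \<xi>)) \<in> borel_measurable borel" by measurable
  define G where "G j \<xi> = F \<xi> * complex_of_real (bump k \<rho> h (\<xi> - (h * real j) *\<^sub>R ?e))" for j and \<xi>
  have Gm: "G j \<in> borel_measurable borel" for j unfolding G_def[abs_def] by measurable
  have Gi: "integrable lborel (G j)" if "j \<le> 4" for j
    unfolding G_def[abs_def]
  proof (rule integrable_continuous_bounded_support[OF F])
    show "(\<lambda>\<xi>. bump k \<rho> h (\<xi> - (h * real j) *\<^sub>R ?e)) \<in> borel_measurable borel" by measurable
    show "\<bar>bump k \<rho> h (\<xi> - (h * real j) *\<^sub>R ?e)\<bar> \<le> 1 * indicator (cball 0 (6 * h)) \<xi>" for \<xi>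
      unfolding mult_1 by (rule bump_translate_bound[OF h \<rho> that])
  qed
  have Gh: "G j ((h * real j) *\<^sub>R ?e + h *\<^sub>R \<eta>) = complex_of_real (indicator ?B \<eta>) * F (h *\<^sub>R (\<eta> + real j *\<^sub>R ?e))" for j \<eta>
  proof -
    have "(h * real j) *\<^sub>R ?e + h *\<^sub>R \<eta> = h *\<^sub>R (\<eta> + real j *\<^sub>R ?e)" by (simp add: scaleR_add_right add.commute)
    moreover have "(h *\<^sub>R (\<eta> + real j *\<^sub>R ?e) - (h * real j) *\<^sub>R ?e) /\<^sub>R h = \<eta>"
      using h by (simp add: scaleR_add_right)
    ultimately show ?thesis by (simp only: G_def bump_def mult.commute)
  qed
  have Gint: "(LINT \<xi>|lborel. G j \<xi>) = h ^ CARD('n) *\<^sub>R (LINT \<eta>|lborel. complex_of_real (indicator ?B \<eta>) * F (h *\<^sub>R (\<eta> + real j *\<^sub>R ?e)))" for j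
    using lborel_affine_integral(2)[OF Gm[of j], where c=h and t="(h * real j) *\<^sub>R ?e"] h
    by (simp only: Gh abs_of_pos) simp
  have "pairing k \<rho> h F = (LINT \<xi>|lborel. F \<xi> * complex_of_real (test k \<rho> h \<xi>))"
    unfolding pairing_def by (rule lebesgue_lborel(2)[OF m])
  also have "\<dots> = (LINT \<xi>|lborel. (\<Sum>j\<le>4. diff4 j *\<^sub>R G j \<xi>))"
    unfolding test_def G_def of_real_sum of_real_mult sum_distrib_left scaleR_conv_of_real
    by (simp only: mult.left_commute)
  also have "\<dots> = (\<Sum>j\<le>4. diff4 j *\<^sub>R (LINT \<xi>|lborel. G j \<xi>))"
    by (subst Bochner_Integration.integral_sum) (auto intro!: integrable_scaleR_right Gi)
  also have "\<dots> = (\<Sum>j\<le>4. diff4 j *\<^sub>R (h ^ CARD('n) *\<^sub>R (LINT \<eta>|lborel. complex_of_real (indicator ?B \<eta>) * F (h *\<^sub>R (\<eta> + real j *\<^sub>R ?e)))))"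
    by (simp only: Gint)
  also have "\<dots> = h ^ CARD('n) *\<^sub>R (\<Sum>j\<le>4. diff4 j *\<^sub>R (LINT \<eta>|lborel. complex_of_real (indicator ?B \<eta>) * F (h *\<^sub>R (\<eta> + real j *\<^sub>R ?e))))"
    by (simp only: scaleR_sum_right scaleR_left_commute)
  also have "(\<Sum>j\<le>4. diff4 j *\<^sub>R (LINT \<eta>|lborel. complex_of_real (indicator ?B \<eta>) * F (h *\<^sub>R (\<eta> + real j *\<^sub>R ?e))))
     = (LINT \<eta>|lborel. (\<Sum>j\<le>4. diff4 j *\<^sub>R (complex_of_real (indicator ?B \<eta>) * F (h *\<^sub>R (\<eta> + real j *\<^sub>R ?e)))))"
  proof (subst Bochner_Integration.integral_sum)
    fix j :: nat assume "j \<in> {..4}"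
    then have "integrable lborel (\<lambda>\<eta>. G j ((h * real j) *\<^sub>R ?e + h *\<^sub>R \<eta>))"
      using lborel_affine_integral(1)[OF Gm[of j], where c=h and t="(h * real j) *\<^sub>R ?e"] Gi[of j] h by simp
    then show "integrable lborel (\<lambda>\<eta>. diff4 j *\<^sub>R (complex_of_real (indicator ?B \<eta>) * F (h *\<^sub>R (\<eta> + real j *\<^sub>R ?e))))"
      by (simp add: Gh)
  qed simp
  also have "\<dots> = (LINT \<eta>|lborel. complex_of_real (indicator ?B \<eta>) * (\<Sum>j\<le>4. diff4 j *\<^sub>R F (h *\<^sub>R (\<eta> + real j *\<^sub>R ?e))))"
    by (simp add: sum_distrib_left)
  finally show ?thesis by (simp add: scaleR_conv_of_real)
qed

text \<open>Along the line through \<open>\<eta>\<close> in direction \<open>k\<close> the function is a quadratic polynomial, which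
  a fourth difference annihilates.\<close>

lemma pairing_quadratic_eq_0:
  fixes a b :: complex and m :: "real^'n"
  assumes h: "0 < h" and \<rho>: "\<rho> \<le> 1"
  shows "pairing k \<rho> h (\<lambda>\<xi>. complex_of_real (\<xi> $ k) * (a + b * complex_of_real (m \<bullet> \<xi>))) = 0"
proof -
  let ?P = "\<lambda>\<xi>. complex_of_real (\<xi> $ k) * (a + b * complex_of_real (m \<bullet> \<xi>))"
  have c: "continuous_on UNIV ?P" by (intro continuous_intros)
  have P: "?P (h *\<^sub>R (\<eta> + real j *\<^sub>R axis k 1)) = complex_of_real h * (complex_of_real (\<eta> $ k) + of_nat j)
      * (a + b * (complex_of_real h * (complex_of_real (m \<bullet> \<eta>) + of_nat j * complex_of_real (m $ k))))" for \<eta> j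
    by (simp add: inner_add_right inner_axis)
  have z: "(\<Sum>j\<le>4. diff4 j *\<^sub>R ?P (h *\<^sub>R (\<eta> + real j *\<^sub>R axis k 1))) = 0" for \<eta>
    unfolding P sum_diff4 by (simp add: scaleR_conv_of_real algebra_simps)
  show ?thesis unfolding pairing_fourth_difference[OF c h \<rho>] z by simp
qed

lemma measure_cball_scale:
  assumes "0 < h"
  shows "(LINT \<xi>|lborel. indicator (cball 0 (6 * h)) (\<xi>::real^'n)) = h ^ CARD('n) * measure lborel (cball (0::real^'n) 6)"
proof -
  have "(LINT \<xi>|lborel. indicator (cball 0 (6 * h)) (\<xi>::real^'n) :: real)
      = h ^ CARD('n) *\<^sub>R (LINT \<xi>|lborel. indicator (cball 0 (6 * h)) (0 + h *\<^sub>R (\<xi>::real^'n)))"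
  proof -
    have "(indicator (cball 0 (6 * h)) :: real^'n \<Rightarrow> real) \<in> borel_measurable borel"
      by (intro borel_measurable_indicator) simp
    from lborel_affine_integral(2)[OF this, of h 0] show ?thesis using assms by (simp only: abs_of_pos) simp
  qed
  also have "(\<lambda>\<xi>::real^'n. indicator (cball 0 (6 * h)) (0 + h *\<^sub>R \<xi>) :: real) = indicator (cball 0 6)"
    using assms by (auto simp: fun_eq_iff indicator_def)
  finally show ?thesis by simp
qed

text \<open>The polynomial part contributes nothing. The test function is at most 16 and lives in
  the ball of radius \<open>6 h\<close>, whence the factor \<open>3456 = 16 \<cdot> 6\<^sup>3\<close>.\<close>

lemma pairing_cubic_remainder:
  fixes F :: "real^'n \<Rightarrow> complex"
  assumes F: "square_integrable lebesgue F" and K: "0 \<le> K"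
    and le: "AE \<xi> in lebesgue. norm (F \<xi> - complex_of_real (\<xi> $ k) * (a + b * complex_of_real (m \<bullet> \<xi>))) \<le> K * norm \<xi> ^ 3"
    and h: "0 < h" and \<rho>: "\<rho> \<le> 1"
  shows "norm (pairing k \<rho> h F) \<le> 3456 * K * measure lborel (cball (0::real^'n) 6) * h ^ (CARD('n) + 3)"
proof -
  let ?P = "\<lambda>\<xi>. complex_of_real (\<xi> $ k) * (a + b * complex_of_real (m \<bullet> \<xi>))"
  let ?t = "\<lambda>\<xi>. complex_of_real (test k \<rho> h \<xi>)"
  have Pc: "continuous_on UNIV ?P" by (intro continuous_intros)
  then have Pm: "?P \<in> borel_measurable borel" by (rule borel_measurable_continuous_onI)
  have Ptm: "(\<lambda>\<xi>. ?P \<xi> * ?t \<xi>) \<in> borel_measurable borel" using Pm by measurable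
  have iF: "integrable lebesgue (\<lambda>\<xi>. F \<xi> * ?t \<xi>)"
    by (rule integrable_mult_square_integrable[OF F test_L2[OF h \<rho>]])
  have iP: "integrable lebesgue (\<lambda>\<xi>. ?P \<xi> * ?t \<xi>)"
    unfolding lebesgue_lborel(1)[OF Ptm]
    by (rule integrable_continuous_bounded_support[OF Pc test_measurable test_bound[OF h \<rho>]])
  let ?I = "indicator (cball 0 (6 * h)) :: real^'n \<Rightarrow> real"
  have Im: "?I \<in> borel_measurable borel" by (intro borel_measurable_indicator) simp
  have iI: "integrable lebesgue (\<lambda>\<xi>. K * (6 * h) ^ 3 * 16 * ?I \<xi>)"
    using integrable_indicator_cball[of 1 "6 * h", where 'a="real^'n"] lebesgue_lborel(1)[OF Im] by simp
  have "pairing k \<rho> h F = pairing k \<rho> h F - pairing k \<rho> h ?P"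
    by (simp add: pairing_quadratic_eq_0[OF h \<rho>])
  also have "\<dots> = (LINT \<xi>|lebesgue. (F \<xi> - ?P \<xi>) * ?t \<xi>)"
    unfolding pairing_def by (subst Bochner_Integration.integral_diff[symmetric, OF iF iP]) (simp only: left_diff_distrib)
  finally have eq: "pairing k \<rho> h F = (LINT \<xi>|lebesgue. (F \<xi> - ?P \<xi>) * ?t \<xi>)" .
  have "norm (pairing k \<rho> h F) \<le> (LINT \<xi>|lebesgue. norm ((F \<xi> - ?P \<xi>) * ?t \<xi>))"
    unfolding eq by (rule integral_norm_bound)
  also have "\<dots> \<le> (LINT \<xi>|lebesgue. K * (6 * h) ^ 3 * 16 * ?I \<xi>)"
  proof (rule integral_mono_AE[OF _ iI])
    show "integrable lebesgue (\<lambda>\<xi>. norm ((F \<xi> - ?P \<xi>) * ?t \<xi>))"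
      using Bochner_Integration.integrable_diff[OF iF iP] by (intro integrable_norm) (simp only: left_diff_distrib)
    show "AE \<xi> in lebesgue. norm ((F \<xi> - ?P \<xi>) * ?t \<xi>) \<le> K * (6 * h) ^ 3 * 16 * ?I \<xi>"
      using le
    proof eventually_elim
      case (elim \<xi>)
      show ?case
      proof (cases "norm \<xi> \<le> 6 * h")
        case True
        have "norm (F \<xi> - ?P \<xi>) \<le> K * (6 * h) ^ 3"
          using elim mult_left_mono[OF power_mono[OF True, of 3] K] by simp
        moreover have "\<bar>test k \<rho> h \<xi>\<bar> \<le> 16" using test_bound[OF h \<rho>, of k \<xi>] True by simp
        ultimately have "norm (F \<xi> - ?P \<xi>) * \<bar>test k \<rho> h \<xi>\<bar> \<le> K * (6 * h) ^ 3 * 16"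
          using K h by (intro mult_mono) auto
        then show ?thesis using True by (simp add: norm_mult)
      next
        case False
        then show ?thesis using test_bound[OF h \<rho>, of k \<xi>] by simp
      qed
    qed
  qed
  also have "\<dots> = K * (6 * h) ^ 3 * 16 * (h ^ CARD('n) * measure lborel (cball (0::real^'n) 6))"
    using lebesgue_lborel(2)[OF Im] measure_cball_scale[OF h, where 'n='n] by simp
  also have "\<dots> = 3456 * K * measure lborel (cball (0::real^'n) 6) * h ^ (CARD('n) + 3)"
    by (simp add: power_add power_mult_distrib)
  finally show ?thesis .
qed

section \<open>Weighted decay makes the pairing small\<close>

lemma norm_one_minus_cis_le: "norm (1 - cis \<theta>) \<le> \<bar>\<theta>\<bar>" "norm (1 - cis \<theta>) \<le> 2"
proof -
  show "norm (1 - cis \<theta>) \<le> \<bar>\<theta>\<bar>"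
    using iexp_approx1[of \<theta> 0] by (simp add: cis_conv_exp norm_minus_commute)
  show "norm (1 - cis \<theta>) \<le> 2"
    using norm_triangle_ineq4[of 1 "cis \<theta>"] by simp
qed

lemma norm_cis_second_order: "norm (cis \<theta> - 1 - \<i> * complex_of_real \<theta>) \<le> \<theta>\<^sup>2 / 2"
  using iexp_approx1[of \<theta> 1] by (simp add: cis_conv_exp diff_diff_eq power2_eq_square)

lemma bump_integrable:
  assumes "0 < h" "\<rho> \<le> 1"
  shows "integrable lborel (\<lambda>\<xi>. complex_of_real (bump k \<rho> h \<xi>))"
    and "square_integrable lborel (\<lambda>\<xi>. complex_of_real (bump k \<rho> h \<xi>))"
    and "(norm2 lborel (\<lambda>\<xi>. complex_of_real (bump (k::'n::finite) \<rho> h \<xi>)))\<^sup>2 = h ^ CARD('n) * measure lborel (ball (- axis k 1 :: real^'n) \<rho>)"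
proof -
  have b: "\<bar>bump k \<rho> h \<xi>\<bar> \<le> 1 * indicator (cball 0 (6 * h)) \<xi>" for \<xi>
    using bump_translate_bound[OF assms, of 0 k \<xi>] by simp
  note i = integrable_bounded_support[OF bump_measurable b]
  show "integrable lborel (\<lambda>\<xi>. complex_of_real (bump k \<rho> h \<xi>))" using i(1) by simp
  show "square_integrable lborel (\<lambda>\<xi>. complex_of_real (bump k \<rho> h \<xi>))"
    using i(2) by (simp add: square_integrable_def)
  have "(norm2 lborel (\<lambda>\<xi>. complex_of_real (bump k \<rho> h \<xi>)))\<^sup>2 = (LINT \<xi>|lborel. bump k \<rho> h \<xi>)"
    unfolding norm2_power2 by (intro Bochner_Integration.integral_cong) (auto simp: bump_def indicator_def)
  also have "\<dots> = h ^ CARD('n) *\<^sub>R (LINT \<xi>|lborel. bump k \<rho> h (0 + h *\<^sub>R \<xi>))"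
    using lborel_affine_integral(2)[OF bump_measurable, of h k \<rho> h 0] assms(1) by (simp only: abs_of_pos) simp
  also have "(\<lambda>\<xi>. bump k \<rho> h (0 + h *\<^sub>R \<xi>)) = indicator (ball (- axis k 1) \<rho>)"
    using assms(1) by (simp add: bump_def fun_eq_iff)
  finally show "(norm2 lborel (\<lambda>\<xi>. complex_of_real (bump k \<rho> h \<xi>)))\<^sup>2 = h ^ CARD('n) * measure lborel (ball (- axis k 1 :: real^'n) \<rho>)"
    by simp
qed

lemma ft_test:
  fixes x :: "real^'n"
  assumes "0 < h" "\<rho> \<le> 1"
  shows "ft (\<lambda>\<xi>. complex_of_real (test k \<rho> h \<xi>)) x
    = (1 - cis (- (h * x $ k))) ^ 4 * ft (\<lambda>\<xi>. complex_of_real (bump k \<rho> h \<xi>)) x"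
proof -
  let ?b = "\<lambda>\<xi>. complex_of_real (bump k \<rho> h \<xi>)"
  let ?z = "cis (- (h * x $ k))"
  let ?t = "\<lambda>j. (h * real j) *\<^sub>R (axis k 1 :: real^'n)"
  have bm: "?b \<in> borel_measurable borel" by measurable
  note bi = bump_integrable(1)[OF assms, of k]
  have i: "integrable lborel (\<lambda>\<xi>. cis (- (\<xi> \<bullet> x)) * ?b (\<xi> - ?t j))" for j
    using lborel_translate(1)[OF bm, of "?t j"] bi by (intro integrable_cis_mult) auto
  have z: "cis (- (?t j \<bullet> x)) = ?z ^ j" for j
    by (simp only: Complex.DeMoivre) (simp add: inner_axis' mult_ac)
  have "ft (\<lambda>\<xi>. complex_of_real (test k \<rho> h \<xi>)) x
     = (LINT \<xi>|lborel. (\<Sum>j\<le>4. diff4 j *\<^sub>R (cis (- (\<xi> \<bullet> x)) * ?b (\<xi> - ?t j))))"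
    unfolding ft_def test_def of_real_sum of_real_mult sum_distrib_left scaleR_conv_of_real
    by (simp only: mult.left_commute)
  also have "\<dots> = (\<Sum>j\<le>4. diff4 j *\<^sub>R ft (\<lambda>\<xi>. ?b (\<xi> - ?t j)) x)"
    unfolding ft_def by (subst Bochner_Integration.integral_sum) (auto intro!: integrable_scaleR_right i)
  also have "\<dots> = (\<Sum>j\<le>4. diff4 j *\<^sub>R (?z ^ j * ft ?b x))"
    by (simp only: ft_translate[OF bm] z)
  also have "\<dots> = (1 - ?z) ^ 4 * ft ?b x"
    unfolding sum_diff4 by (simp add: scaleR_conv_of_real power4_eq_xxxx power3_eq_cube power2_eq_square algebra_simps)
  finally show ?thesis .
qed

text \<open>Moving the transform from \<open>fourier f\<close> to the test function produces the factor
  \<open>(1 - e\<^bsup>-i h x\<^sub>k\<^esup>)\<^sup>4\<close>, which is at most \<open>4 (h \<bar>x\<bar>)\<^bsup>n/2 + 2\<^esup>\<close> because \<open>n/2 + 2 \<le> 4\<close>. That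
  bound alone gives \<open>O(h\<^bsup>n+2\<^esup>)\<close>. Since \<open>n/2 + 2 < 4\<close> strictly, the factor divided by
  \<open>h\<^bsup>n/2 + 2\<^esup>\<close> also tends to 0 at every \<open>x\<close>, and dominated convergence improves this to
  \<open>o(h\<^bsup>n+2\<^esup>)\<close>.\<close>

lemma pairing_decay:
  fixes f :: "real^'n \<Rightarrow> real"
  assumes n: "CARD('n) < 4" and \<rho>: "\<rho> \<le> 1"
    and f1: "integrable lebesgue f" and f2: "square_integrable lebesgue f"
    and w: "square_integrable lebesgue (\<lambda>x. norm x powr (real CARD('n) / 2 + 2) * f x)"
    and h0: "\<And>i::nat. 0 < h i" and hl: "h \<longlonglongrightarrow> 0"
  shows "(\<lambda>i. pairing k \<rho> (h i) (fourier f) / complex_of_real (h i ^ (CARD('n) + 2))) \<longlonglongrightarrow> 0"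
proof -
  let ?N = "CARD('n)"
  obtain g where gm[measurable]: "g \<in> borel_measurable borel" and fg: "AE x in lebesgue. f x = g x"
    and g1: "integrable lborel g" and ff: "fourier f = ft (\<lambda>x. complex_of_real (g x))"
    using integrable_representative[OF f1] .
  define c where "c = (2 * pi) ^ ?N"
  define b where "b = measure lborel (ball (- axis k 1 :: real^'n) \<rho>)"
  have pw: "(norm x powr (real ?N / 2 + 2))\<^sup>2 = norm x ^ (?N + 4)" for x :: "real^'n"
  proof (cases "x = 0")
    case False
    then have "(norm x powr (real ?N / 2 + 2))\<^sup>2 = norm x powr (real (?N + 4))"
      by (simp add: power2_eq_square powr_add[symmetric])
    moreover have "norm x powr (real (?N + 4)) = norm x ^ (?N + 4)"
      by (rule powr_realpow) (use False in simp)
    ultimately show ?thesis by (simp only:)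
  qed simp
  have gw: "integrable lborel (\<lambda>x. norm x ^ (?N + 4) * (g x)\<^sup>2)"
  proof -
    have wm: "(\<lambda>x. norm x powr (real ?N / 2 + 2) * g x) \<in> borel_measurable borel" by measurable
    have "square_integrable lebesgue (\<lambda>x. norm x powr (real ?N / 2 + 2) * g x)"
      by (rule square_integrable_cong_AE[OF w lebesgue_lborel(5)[OF wm]]) (use fg in \<open>auto elim: eventually_mono\<close>)
    then have "square_integrable lborel (\<lambda>x. norm x powr (real ?N / 2 + 2) * g x)"
      using lebesgue_lborel(3)[OF wm] by simp
    from square_integrableD(2)[OF this] show ?thesis
      by (simp only: real_norm_def power2_abs power_mult_distrib pw)
  qed
  (* the integrand of the squared L2 norm of f times the factor, divided by h^(n + 4) *)
  define J where "J i x = norm (1 - cis (- (h i * x $ k))) ^ 8 / h i ^ (?N + 4) * (g x)\<^sup>2" for i and x :: "real^'n"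
  have Jm: "J i \<in> borel_measurable borel" for i unfolding J_def[abs_def] by measurable
  have a8: "norm (1 - cis (- (h i * x $ k))) ^ 8 / h i ^ (?N + 4) \<le> 16 * norm x ^ (?N + 4)" for i x
  proof -
    let ?a = "norm (1 - cis (- (h i * x $ k)))"
    have "?a \<le> h i * norm x"
      using norm_one_minus_cis_le(1)[of "- (h i * x $ k)"] component_le_norm_cart[of x k] h0[of i]
      by (simp add: abs_mult) (meson mult_left_mono less_imp_le order_trans)
    then have "?a ^ (?N + 4) \<le> (h i * norm x) ^ (?N + 4)" by (rule power_mono) simp
    moreover have "?a ^ (4 - ?N) \<le> 2 ^ 4"
    proof -
      have "?a ^ (4 - ?N) \<le> 2 ^ (4 - ?N)" by (rule power_mono[OF norm_one_minus_cis_le(2)]) simp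
      also have "\<dots> \<le> (2::real) ^ 4" by (rule power_increasing) auto
      finally show ?thesis .
    qed
    ultimately have "?a ^ (?N + 4) * ?a ^ (4 - ?N) \<le> (h i * norm x) ^ (?N + 4) * 2 ^ 4"
      using h0[of i] by (intro mult_mono) auto
    moreover have "?a ^ (?N + 4) * ?a ^ (4 - ?N) = ?a ^ 8" using n by (simp add: power_add[symmetric])
    ultimately show ?thesis using h0[of i] by (simp add: power_mult_distrib pos_divide_le_eq mult_ac)
  qed
  have Jb: "norm (J i x) \<le> 16 * (norm x ^ (?N + 4) * (g x)\<^sup>2)" for i x
  proof -
    have "norm (J i x) = norm (1 - cis (- (h i * x $ k))) ^ 8 / h i ^ (?N + 4) * (g x)\<^sup>2"
      using h0[of i] by (simp add: J_def)
    also have "\<dots> \<le> 16 * norm x ^ (?N + 4) * (g x)\<^sup>2" by (intro mult_right_mono a8) simp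
    finally show ?thesis by (simp add: mult.assoc)
  qed
  have J0: "(\<lambda>i. LINT x|lborel. J i x) \<longlonglongrightarrow> (LINT x|(lborel :: (real^'n) measure). 0)"
  proof (rule integral_dominated_convergence[where w="\<lambda>x. 16 * (norm x ^ (?N + 4) * (g x)\<^sup>2)"])
    show "integrable lborel (\<lambda>x. 16 * (norm x ^ (?N + 4) * (g x)\<^sup>2))" using gw by simp
    show "AE x in lborel. norm (J i x) \<le> 16 * (norm x ^ (?N + 4) * (g x)\<^sup>2)" for i
      by (intro AE_I2 Jb)
    show "AE x in lborel. (\<lambda>i. J i x) \<longlonglongrightarrow> 0"
    proof (rule AE_I2)
      fix x
      have "(\<lambda>i. h i ^ (4 - ?N) * \<bar>x $ k\<bar> ^ 8 * (g x)\<^sup>2) \<longlonglongrightarrow> 0 ^ (4 - ?N) * \<bar>x $ k\<bar> ^ 8 * (g x)\<^sup>2"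
        by (intro tendsto_intros hl)
      then have lim: "(\<lambda>i. h i ^ (4 - ?N) * \<bar>x $ k\<bar> ^ 8 * (g x)\<^sup>2) \<longlonglongrightarrow> 0" using n by (simp add: power_0_left)
      show "(\<lambda>i. J i x) \<longlonglongrightarrow> 0"
      proof (rule Lim_null_comparison[OF always_eventually lim], rule allI)
        fix i
        have "norm (1 - cis (- (h i * x $ k))) ^ 8 \<le> \<bar>- (h i * x $ k)\<bar> ^ 8"
          by (rule power_mono[OF norm_one_minus_cis_le(1)]) simp
        also have "\<dots> = h i ^ (?N + 4) * (h i ^ (4 - ?N) * \<bar>x $ k\<bar> ^ 8)"
          using h0[of i] n by (simp add: abs_mult power_mult_distrib mult.assoc[symmetric] power_add[symmetric])
        finally have "norm (1 - cis (- (h i * x $ k))) ^ 8 / h i ^ (?N + 4) \<le> h i ^ (4 - ?N) * \<bar>x $ k\<bar> ^ 8"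
          using h0[of i] by (simp add: pos_divide_le_eq mult_ac)
        then have "norm (1 - cis (- (h i * x $ k))) ^ 8 / h i ^ (?N + 4) * (g x)\<^sup>2 \<le> h i ^ (4 - ?N) * \<bar>x $ k\<bar> ^ 8 * (g x)\<^sup>2"
          by (rule mult_right_mono) simp
        then show "norm (J i x) \<le> h i ^ (4 - ?N) * \<bar>x $ k\<bar> ^ 8 * (g x)\<^sup>2"
          using h0[of i] by (simp add: J_def)
      qed
    qed
  qed (auto simp: Jm)
  have key: "(norm (pairing k \<rho> (h i) (fourier f) / complex_of_real (h i ^ (?N + 2))))\<^sup>2 \<le> c * b * (LINT x|lborel. J i x)" for i
  proof -
    let ?t = "\<lambda>\<xi>. complex_of_real (test k \<rho> (h i) \<xi>)" and ?b = "\<lambda>\<xi>. complex_of_real (bump k \<rho> (h i) \<xi>)"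
    let ?G = "\<lambda>x. complex_of_real (g x) * (1 - cis (- (h i * x $ k))) ^ 4"
    note bi = bump_integrable[OF h0[of i] \<rho>, of k]
    note P = Plancherel_integrable[OF bi(1,2)]
    have gc: "integrable lborel (\<lambda>x. complex_of_real (g x))" using g1 by simp
    have ti: "integrable lborel ?t"
      using integrable_bounded_support(1)[OF test_measurable test_bound[OF h0[of i] \<rho>, of k]] by simp
    have ftm[measurable]: "ft (\<lambda>x. complex_of_real (g x)) \<in> borel_measurable borel" by (rule ft_measurable[OF gc])
    have "(\<lambda>\<xi>. fourier f \<xi> * ?t \<xi>) \<in> borel_measurable borel" unfolding ff by measurable
    then have "pairing k \<rho> (h i) (fourier f) = (LINT \<xi>|lborel. fourier f \<xi> * ?t \<xi>)"
      unfolding pairing_def by (rule lebesgue_lborel(2))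
    also have "\<dots> = (LINT x|lborel. complex_of_real (g x) * ft ?t x)"
      unfolding ff by (rule ft_multiplication_formula[OF gc ti])
    also have "\<dots> = (LINT x|lborel. ?G x * ft ?b x)"
      by (simp only: ft_test[OF h0[of i] \<rho>] mult.assoc)
    finally have p: "pairing k \<rho> (h i) (fourier f) = (LINT x|lborel. ?G x * ft ?b x)" .
    have Gm: "?G \<in> borel_measurable borel" by measurable
    have Gn: "(norm (?G x))\<^sup>2 = h i ^ (?N + 4) * J i x" for x
      using h0[of i] by (simp add: J_def norm_mult norm_power power_mult_distrib power_mult[symmetric])
    have Gi: "integrable lborel (\<lambda>x. (norm (?G x))\<^sup>2)"
    proof -
      have "integrable lborel (J i)"
      proof (rule Bochner_Integration.integrable_bound[OF integrable_mult_right[OF gw, of 16] _ AE_I2])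
        show "J i \<in> borel_measurable lborel" using Jm by simp
        show "norm (J i x) \<le> norm (16 * (norm x ^ (?N + 4) * (g x)\<^sup>2))" for x
          using Jb[of i x] by (simp add: abs_mult)
      qed
      then show ?thesis unfolding Gn by simp
    qed
    have G2: "square_integrable lborel ?G" using Gi Gm by (simp add: square_integrable_def)
    have "norm (pairing k \<rho> (h i) (fourier f)) \<le> norm2 lborel ?G * norm2 lborel (ft ?b)"
      unfolding p by (rule norm_integral_mult_le[OF G2 P(1)])
    then have "(norm (pairing k \<rho> (h i) (fourier f)))\<^sup>2 \<le> (norm2 lborel ?G * norm2 lborel (ft ?b))\<^sup>2"
      by (rule power_mono) simp
    also have "\<dots> = (h i ^ (?N + 4) * (LINT x|lborel. J i x)) * (c * (h i ^ ?N * b))"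
    proof -
      have "(norm2 lborel ?G)\<^sup>2 = h i ^ (?N + 4) * (LINT x|lborel. J i x)"
        unfolding norm2_power2 Gn by simp
      moreover have "(norm2 lborel (ft ?b))\<^sup>2 = c * (h i ^ ?N * b)"
        using P(2) bi(3) by (simp add: c_def b_def)
      ultimately show ?thesis by (simp only: power_mult_distrib)
    qed
    also have "\<dots> = (h i ^ (?N + 2))\<^sup>2 * (c * b * (LINT x|lborel. J i x))"
    proof -
      have "h i ^ (?N + 4) * h i ^ ?N = (h i ^ (?N + 2))\<^sup>2"
        unfolding power_mult[symmetric] power_add[symmetric] by (rule arg_cong[where f="power (h i)"]) simp
      moreover have "(A * X) * (c * (B * b)) = (A * B) * (c * b * X)" for A B X by (simp add: mult_ac)
      ultimately show ?thesis by (simp only:)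
    qed
    also have "\<dots> = (c * b * (LINT x|lborel. J i x)) * (h i ^ (?N + 2))\<^sup>2" by (rule mult.commute)
    finally have F: "(norm (pairing k \<rho> (h i) (fourier f)))\<^sup>2 \<le> (c * b * (LINT x|lborel. J i x)) * (h i ^ (?N + 2))\<^sup>2" .
    have Hp: "0 < h i ^ (?N + 2)" using h0[of i] by simp
    show ?thesis
      unfolding norm_divide norm_of_real abs_of_pos[OF Hp] power_divide pos_divide_le_eq[OF zero_less_power[OF Hp]]
      by (rule F)
  qed
  have lim: "(\<lambda>i. c * b * (LINT x|lborel. J i x)) \<longlonglongrightarrow> 0"
    using tendsto_mult_left[OF J0, of "c * b"] by simp
  define X where "X i = pairing k \<rho> (h i) (fourier f) / complex_of_real (h i ^ (?N + 2))" for i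
  have "(\<lambda>i. (norm (X i))\<^sup>2) \<longlonglongrightarrow> 0"
  proof (rule Lim_null_comparison[OF always_eventually lim], rule allI)
    show "norm ((norm (X i))\<^sup>2) \<le> c * b * (LINT x|lborel. J i x)" for i
      using key[of i] unfolding X_def[symmetric] by simp
  qed
  from tendsto_real_sqrt[OF this] have "(\<lambda>i. norm (X i)) \<longlonglongrightarrow> 0" by simp
  then have "X \<longlonglongrightarrow> 0" by (rule tendsto_norm_zero_cancel)
  then show ?thesis unfolding X_def .
qed

section \<open>The nonlinear term is quadratic up to third order\<close>

text \<open>Taylor's formula for \<open>e\<^bsup>-i x \<bullet> \<xi>\<^esup>\<close> under the integral. Here \<open>a\<close> is the integral of \<open>w\<close>
  and \<open>m\<close> its first moment.\<close>

lemma fourier_first_order_expansion: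
  fixes w :: "real^'n \<Rightarrow> real"
  assumes w0: "integrable lebesgue w" and w2: "integrable lebesgue (\<lambda>x. (norm x)\<^sup>2 * w x)"
  obtains a :: real and m :: "real^'n" where
    "\<And>\<xi>. norm (fourier w \<xi> - complex_of_real a + \<i> * complex_of_real (m \<bullet> \<xi>)) \<le> (norm \<xi>)\<^sup>2 * (LINT x|lebesgue. (norm x)\<^sup>2 * \<bar>w x\<bar>)"
proof -
  define a where "a = (LINT x|lebesgue. w x)"
  define m where "m = (LINT x|lebesgue. w x *\<^sub>R x)"
  have bound: "norm (fourier w \<xi> - complex_of_real a + \<i> * complex_of_real (m \<bullet> \<xi>)) \<le> (norm \<xi>)\<^sup>2 * (LINT x|lebesgue. (norm x)\<^sup>2 * \<bar>w x\<bar>)" for \<xi>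
  proof -
    have idm: "(\<lambda>x::real^'n. x) \<in> borel_measurable lebesgue" by (rule lebesgue_lborel(5)) simp
    have wm: "w \<in> borel_measurable lebesgue" using w0 by (rule borel_measurable_integrable)
    have w1: "integrable lebesgue (\<lambda>x. w x *\<^sub>R x)"
    proof (rule Bochner_Integration.integrable_bound[OF Bochner_Integration.integrable_add[OF integrable_norm[OF w0] integrable_norm[OF w2]] _ AE_I2])
      show "(\<lambda>x. w x *\<^sub>R x) \<in> borel_measurable lebesgue" by (intro borel_measurable_scaleR wm idm)
      fix x :: "real^'n"
      have "2 * norm x \<le> (norm x)\<^sup>2 + 1" using sum_squares_bound[of "norm x" 1] by simp
      moreover have "0 \<le> norm x" by simp
      ultimately have "norm x \<le> 1 + (norm x)\<^sup>2" by linarith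
      then have "\<bar>w x\<bar> * norm x \<le> \<bar>w x\<bar> * (1 + (norm x)\<^sup>2)" by (rule mult_left_mono) simp
      then show "norm (w x *\<^sub>R x) \<le> norm (norm (w x) + norm ((norm x)\<^sup>2 * w x))"
        by (simp add: algebra_simps abs_mult)
    qed
    have c: "exp (- (\<i> * complex_of_real (x \<bullet> \<xi>))) = cis (- (x \<bullet> \<xi>))" for x
      by (simp add: cis_conv_exp)
    have mc: "(\<lambda>x::real^'n. - (x \<bullet> \<xi>)) \<in> borel_measurable lebesgue"
      by (intro lebesgue_lborel(5)) measurable
    have i1: "integrable lebesgue (\<lambda>x. cis (- (x \<bullet> \<xi>)) * complex_of_real (w x))"
      by (intro integrable_cis_mult mc integrable_of_real w0)
    have i2: "integrable lebesgue (\<lambda>x. complex_of_real (w x))" using w0 by simp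
    have i3: "integrable lebesgue (\<lambda>x. complex_of_real ((w x *\<^sub>R x) \<bullet> \<xi>))"
      by (intro integrable_of_real integrable_inner_left w1)
    have "m \<bullet> \<xi> = (LINT x|lebesgue. (w x *\<^sub>R x) \<bullet> \<xi>)"
      unfolding m_def using w1 by (simp only: integral_inner_left)
    then have "complex_of_real (m \<bullet> \<xi>) = (LINT x|lebesgue. complex_of_real ((w x *\<^sub>R x) \<bullet> \<xi>))"
      by (simp only: integral_complex_of_real)
    moreover have "complex_of_real a = (LINT x|lebesgue. complex_of_real (w x))"
      unfolding a_def by (simp only: integral_complex_of_real)
    ultimately have "fourier w \<xi> - complex_of_real a + \<i> * complex_of_real (m \<bullet> \<xi>)
      = (LINT x|lebesgue. cis (- (x \<bullet> \<xi>)) * complex_of_real (w x) - complex_of_real (w x) + \<i> * complex_of_real ((w x *\<^sub>R x) \<bullet> \<xi>))"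
      using i1 i2 i3
      by (simp only: fourier_def c Bochner_Integration.integral_add Bochner_Integration.integral_diff
          Bochner_Integration.integrable_diff integrable_mult_right integral_mult_right_zero)
    also have "norm \<dots> \<le> (LINT x|lebesgue. (norm \<xi>)\<^sup>2 * ((norm x)\<^sup>2 * \<bar>w x\<bar>))"
    proof (rule order_trans[OF integral_norm_bound], rule integral_mono)
      show "integrable lebesgue (\<lambda>x. norm (cis (- (x \<bullet> \<xi>)) * complex_of_real (w x) - complex_of_real (w x) + \<i> * complex_of_real ((w x *\<^sub>R x) \<bullet> \<xi>)))"
        by (intro integrable_norm Bochner_Integration.integrable_add Bochner_Integration.integrable_diff i1 i2 integrable_mult_right i3)
      show "integrable lebesgue (\<lambda>x. (norm \<xi>)\<^sup>2 * ((norm x)\<^sup>2 * \<bar>w x\<bar>))"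
        using integrable_mult_right[OF integrable_norm[OF w2], of "(norm \<xi>)\<^sup>2"] by (simp add: abs_mult)
      fix x
      have "norm (cis (- (x \<bullet> \<xi>)) - 1 + \<i> * complex_of_real (x \<bullet> \<xi>)) \<le> \<bar>x \<bullet> \<xi>\<bar>\<^sup>2 / 2"
        using norm_cis_second_order[of "- (x \<bullet> \<xi>)"] by simp
      also have "\<dots> \<le> (norm x * norm \<xi>)\<^sup>2"
      proof -
        have "\<bar>x \<bullet> \<xi>\<bar>\<^sup>2 \<le> (norm x * norm \<xi>)\<^sup>2" by (intro power_mono Cauchy_Schwarz_ineq2) simp
        then show ?thesis using zero_le_power2[of "\<bar>x \<bullet> \<xi>\<bar>"] by linarith
      qed
      finally have "norm (cis (- (x \<bullet> \<xi>)) - 1 + \<i> * complex_of_real (x \<bullet> \<xi>)) * \<bar>w x\<bar> \<le> (norm x * norm \<xi>)\<^sup>2 * \<bar>w x\<bar>"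
        by (rule mult_right_mono) simp
      moreover have "cis (- (x \<bullet> \<xi>)) * complex_of_real (w x) - complex_of_real (w x) + \<i> * complex_of_real ((w x *\<^sub>R x) \<bullet> \<xi>)
        = (cis (- (x \<bullet> \<xi>)) - 1 + \<i> * complex_of_real (x \<bullet> \<xi>)) * complex_of_real (w x)"
        by (simp add: algebra_simps)
      ultimately show "norm (cis (- (x \<bullet> \<xi>)) * complex_of_real (w x) - complex_of_real (w x) + \<i> * complex_of_real ((w x *\<^sub>R x) \<bullet> \<xi>))
        \<le> (norm \<xi>)\<^sup>2 * ((norm x)\<^sup>2 * \<bar>w x\<bar>)"
        by (simp only: norm_mult norm_of_real) (simp add: power_mult_distrib mult_ac)
    qed
    finally show ?thesis by simp
  qed
  then show thesis by (rule that)
qed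

definition phase :: "'n \<Rightarrow> real \<Rightarrow> real^'n \<Rightarrow> complex" where
  "phase k t \<xi> = cis (t * \<xi> $ k * norm \<xi>)"

lemma norm_phase_minus_one: "norm (phase k t \<xi> - 1) \<le> \<bar>t\<bar> * (norm \<xi>)\<^sup>2"
proof -
  have "norm (phase k t \<xi> - 1) \<le> \<bar>t * \<xi> $ k * norm \<xi>\<bar>"
    using norm_one_minus_cis_le(1)[of "t * \<xi> $ k * norm \<xi>"] by (simp add: phase_def norm_minus_commute)
  also have "\<dots> \<le> \<bar>t\<bar> * norm \<xi> * norm \<xi>"
    unfolding abs_mult abs_norm_cancel by (intro mult_right_mono mult_left_mono component_le_norm_cart) auto
  finally show ?thesis by (simp add: power2_eq_square mult.assoc)
qed

text \<open>Near the origin the phase is 1 up to \<open>O(\<bar>\<xi>\<bar>\<^sup>2)\<close> and the transform of \<open>w\<close> is affine up to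
  \<open>O(\<bar>\<xi>\<bar>\<^sup>2)\<close>. The factor \<open>\<xi>\<^sub>k\<close> turns these errors into cubic ones, with constants that
  depend on \<open>w\<close> only through the bound \<open>M\<close> on its moments.\<close>

lemma pairing_nonlinear:
  fixes w :: "real^'n \<Rightarrow> real"
  assumes w0: "integrable lebesgue w" and w2: "integrable lebesgue (\<lambda>x. (norm x)\<^sup>2 * w x)"
    and M: "(LINT x|lebesgue. \<bar>w x\<bar>) \<le> M" "(LINT x|lebesgue. (norm x)\<^sup>2 * \<bar>w x\<bar>) \<le> M"
    and t: "\<bar>t\<bar> \<le> T" and h: "0 < h" and \<rho>: "\<rho> \<le> 1"
    and L2: "square_integrable lebesgue (\<lambda>\<xi>. phase k t \<xi> * (\<i> * complex_of_real (\<xi> $ k) / 2 * fourier w \<xi>))"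
  shows "norm (pairing k \<rho> h (\<lambda>\<xi>. phase k t \<xi> * (\<i> * complex_of_real (\<xi> $ k) / 2 * fourier w \<xi>)))
    \<le> 3456 * ((T + 1) * M) * measure lborel (cball (0::real^'n) 6) * h ^ (CARD('n) + 3)"
proof -
  obtain a :: real and m :: "real^'n" where am:
    "\<And>\<xi>. norm (fourier w \<xi> - complex_of_real a + \<i> * complex_of_real (m \<bullet> \<xi>)) \<le> (norm \<xi>)\<^sup>2 * (LINT x|lebesgue. (norm x)\<^sup>2 * \<bar>w x\<bar>)"
    using fourier_first_order_expansion[OF w0 w2] by blast
  have M0: "0 \<le> M" using M(1) by (meson Bochner_Integration.integral_nonneg abs_ge_zero order_trans)
  have T0: "0 \<le> T" using t by linarith
  show ?thesis
  proof (rule pairing_cubic_remainder[OF L2 _ AE_I2 h \<rho>, where a="\<i> * complex_of_real a / 2" and b="1 / 2" and m=m])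
    show "0 \<le> (T + 1) * M" using M0 T0 by simp
    fix \<xi> :: "real^'n"
    let ?q = "fourier w \<xi>"
    have 1: "norm ((phase k t \<xi> - 1) * ?q) \<le> (T * (norm \<xi>)\<^sup>2) * M"
      unfolding norm_mult
    proof (intro mult_mono)
      show "norm (phase k t \<xi> - 1) \<le> T * (norm \<xi>)\<^sup>2"
        using norm_phase_minus_one[of k t \<xi>] mult_right_mono[OF t, of "(norm \<xi>)\<^sup>2"] by simp
      show "norm ?q \<le> M" using norm_fourier_le[of w \<xi>] M(1) by simp
    qed (use T0 in auto)
    have 2: "norm (?q - complex_of_real a + \<i> * complex_of_real (m \<bullet> \<xi>)) \<le> (norm \<xi>)\<^sup>2 * M"
      using am[of \<xi>] mult_left_mono[OF M(2), of "(norm \<xi>)\<^sup>2"] by simp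
    have eq: "phase k t \<xi> * (\<i> * complex_of_real (\<xi> $ k) / 2 * ?q) - complex_of_real (\<xi> $ k) * (\<i> * complex_of_real a / 2 + 1 / 2 * complex_of_real (m \<bullet> \<xi>))
      = \<i> * complex_of_real (\<xi> $ k) / 2 * ((phase k t \<xi> - 1) * ?q + (?q - complex_of_real a + \<i> * complex_of_real (m \<bullet> \<xi>)))"
      by (simp add: field_simps)
    have "norm (phase k t \<xi> * (\<i> * complex_of_real (\<xi> $ k) / 2 * ?q) - complex_of_real (\<xi> $ k) * (\<i> * complex_of_real a / 2 + 1 / 2 * complex_of_real (m \<bullet> \<xi>)))
      = \<bar>\<xi> $ k\<bar> / 2 * norm ((phase k t \<xi> - 1) * ?q + (?q - complex_of_real a + \<i> * complex_of_real (m \<bullet> \<xi>)))"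
      unfolding eq norm_mult[of "\<i> * complex_of_real (\<xi> $ k) / 2"] by (simp add: norm_divide norm_mult)
    also have "\<dots> \<le> norm \<xi> * ((T * (norm \<xi>)\<^sup>2) * M + (norm \<xi>)\<^sup>2 * M)"
    proof (intro mult_mono)
      show "\<bar>\<xi> $ k\<bar> / 2 \<le> norm \<xi>" using component_le_norm_cart[of \<xi> k] by linarith
      show "norm ((phase k t \<xi> - 1) * ?q + (?q - complex_of_real a + \<i> * complex_of_real (m \<bullet> \<xi>))) \<le> (T * (norm \<xi>)\<^sup>2) * M + (norm \<xi>)\<^sup>2 * M"
        using norm_triangle_ineq[of "(phase k t \<xi> - 1) * ?q" "?q - complex_of_real a + \<i> * complex_of_real (m \<bullet> \<xi>)"] 1 2 by linarith
    qed auto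
    also have "\<dots> = (T + 1) * M * norm \<xi> ^ 3" by (simp add: power2_eq_square power3_eq_cube algebra_simps)
    finally show "norm (phase k t \<xi> * (\<i> * complex_of_real (\<xi> $ k) / 2 * ?q) - complex_of_real (\<xi> $ k) * (\<i> * complex_of_real a / 2 + 1 / 2 * complex_of_real (m \<bullet> \<xi>)))
      \<le> (T + 1) * M * norm \<xi> ^ 3" .
  qed
qed

section \<open>The linear term has a singular limit\<close>

text \<open>The value of the functional of scale 1 on \<open>\<xi>\<^sub>k \<bar>\<xi>\<bar>\<close>.\<close>

definition kappa :: "'n::finite \<Rightarrow> real \<Rightarrow> real" where
  "kappa k \<rho> = (LINT \<eta>|lborel. indicator (ball (- axis k 1 :: real^'n) \<rho>) \<eta> *
     (\<Sum>j\<le>4. diff4 j *\<^sub>R ((\<eta> + real j *\<^sub>R axis k 1) $ k * norm (\<eta> + real j *\<^sub>R axis k 1))))"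

text \<open>On the axis the fourth difference of \<open>t \<bar>t\<bar>\<close> at \<open>-1\<close> is
  \<open>-1 - 4 \<cdot> 0 + 6 \<cdot> 1 - 4 \<cdot> 4 + 9 = -2\<close>; it stays below \<open>-1\<close> near that point.\<close>

lemma kappa_neg:
  fixes k :: "'n::finite"
  obtains \<rho> where "0 < \<rho>" "\<rho> \<le> 1" "kappa k \<rho> < 0"
proof -
  let ?e = "axis k 1 :: real^'n"
  define D where "D \<eta> = (\<Sum>j\<le>4. diff4 j *\<^sub>R ((\<eta> + real j *\<^sub>R ?e) $ k * norm (\<eta> + real j *\<^sub>R ?e)))" for \<eta>
  have Dc: "continuous_on UNIV D" unfolding D_def[abs_def] by (intro continuous_intros)
  have De: "D (- ?e) = - 2"
  proof -
    have "(- ?e + real j *\<^sub>R ?e) $ k * norm (- ?e + real j *\<^sub>R ?e) = (real j - 1) * \<bar>real j - 1\<bar>" for j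
    proof -
      have "- ?e + real j *\<^sub>R ?e = (real j - 1) *\<^sub>R ?e" by (simp add: scaleR_left_diff_distrib)
      then show ?thesis by (simp only:) (simp add: norm_axis_1)
    qed
    then have "D (- ?e) = (\<Sum>j\<le>4. diff4 j *\<^sub>R ((real j - 1) * \<bar>real j - 1\<bar>))" unfolding D_def by (simp only:)
    also have "\<dots> = - 2" unfolding sum_diff4 by simp
    finally show ?thesis .
  qed
  have "isCont D (- ?e)" using Dc by (simp add: continuous_on_eq_continuous_at)
  then obtain d where d: "0 < d" "\<And>\<eta>. dist \<eta> (- ?e) < d \<Longrightarrow> dist (D \<eta>) (D (- ?e)) < 1"
    unfolding continuous_at_eps_delta by (metis zero_less_one)
  define \<rho> where "\<rho> = min d 1"
  have \<rho>: "0 < \<rho>" "\<rho> \<le> 1" using d(1) by (auto simp: \<rho>_def)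
  let ?B = "ball (- ?e) \<rho>"
  have lt: "D \<eta> \<le> - 1" if "\<eta> \<in> ?B" for \<eta>
    using d(2)[of \<eta>] that by (auto simp: De dist_real_def dist_commute \<rho>_def)
  have fin: "emeasure lborel ?B < \<infinity>" by (intro emeasure_bounded_finite bounded_ball)
  have iB: "integrable lborel (\<lambda>\<eta>. - 1 * indicator ?B \<eta> :: real)"
    using fin by (intro integrable_mult_right integrable_real_indicator) auto
  have Bb: "?B \<subseteq> cball 0 2"
  proof
    fix \<eta> assume "\<eta> \<in> ?B"
    then show "\<eta> \<in> cball 0 2" using dist_triangle[of 0 \<eta> "- ?e"] \<rho>(2) by (simp add: norm_axis_1)
  qed
  have Dm: "D \<in> borel_measurable borel" by (rule borel_measurable_continuous_onI[OF Dc])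
  have iD: "integrable lborel (\<lambda>\<eta>. indicator ?B \<eta> * D \<eta>)"
  proof -
    have "continuous_on UNIV (\<lambda>\<eta>. complex_of_real (D \<eta>))" using Dc by (intro continuous_intros)
    moreover have "(indicator ?B :: real^'n \<Rightarrow> real) \<in> borel_measurable borel"
      by (intro borel_measurable_indicator) simp
    moreover have "\<bar>indicator ?B \<eta>\<bar> \<le> (1::real) * indicator (cball 0 2) \<eta>" for \<eta>
      using Bb by (auto simp: indicator_def)
    ultimately have "integrable lborel (\<lambda>\<eta>. complex_of_real (D \<eta>) * complex_of_real (indicator ?B \<eta>))"
      by (rule integrable_continuous_bounded_support)
    then have "integrable lborel (\<lambda>\<eta>. Re (complex_of_real (D \<eta>) * complex_of_real (indicator ?B \<eta>)))"
      by (rule integrable_Re)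
    then show ?thesis by (simp add: mult.commute)
  qed
  have "kappa k \<rho> = (LINT \<eta>|lborel. indicator ?B \<eta> * D \<eta>)" unfolding kappa_def D_def by (rule refl)
  also have "\<dots> \<le> (LINT \<eta>|lborel. - 1 * indicator ?B \<eta>)"
    by (rule integral_mono[OF iD iB]) (use lt in \<open>auto simp: indicator_def\<close>)
  also have "\<dots> = - measure lborel ?B" by simp
  also have "\<dots> < 0"
    using content_ball_pos[OF \<rho>(1), of "- ?e"] by simp
  finally show thesis using that \<rho> by blast
qed

lemma phase_diff_expansion:
  "norm (phase k t1 \<xi> - phase k t2 \<xi> - \<i> * complex_of_real ((t1 - t2) * (\<xi> $ k * norm \<xi>))) \<le> (t1\<^sup>2 + t2\<^sup>2) * norm \<xi> ^ 4"
proof -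
  have 1: "norm (phase k t \<xi> - 1 - \<i> * complex_of_real (t * (\<xi> $ k * norm \<xi>))) \<le> t\<^sup>2 * norm \<xi> ^ 4" for t
  proof -
    have "norm (phase k t \<xi> - 1 - \<i> * complex_of_real (t * (\<xi> $ k * norm \<xi>))) \<le> (t * (\<xi> $ k * norm \<xi>))\<^sup>2 / 2"
      using norm_cis_second_order[of "t * (\<xi> $ k * norm \<xi>)"] by (simp only: phase_def mult.assoc)
    also have "\<dots> \<le> (t * (\<xi> $ k * norm \<xi>))\<^sup>2" by simp
    also have "\<dots> = t\<^sup>2 * (\<bar>\<xi> $ k\<bar>\<^sup>2 * (norm \<xi>)\<^sup>2)" by (simp add: power_mult_distrib)
    also have "\<dots> \<le> t\<^sup>2 * ((norm \<xi>)\<^sup>2 * (norm \<xi>)\<^sup>2)"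
      by (intro mult_left_mono mult_right_mono power_mono component_le_norm_cart) auto
    finally show ?thesis by (simp add: power2_eq_square power4_eq_xxxx mult.assoc)
  qed
  have "phase k t1 \<xi> - phase k t2 \<xi> - \<i> * complex_of_real ((t1 - t2) * (\<xi> $ k * norm \<xi>))
    = (phase k t1 \<xi> - 1 - \<i> * complex_of_real (t1 * (\<xi> $ k * norm \<xi>))) - (phase k t2 \<xi> - 1 - \<i> * complex_of_real (t2 * (\<xi> $ k * norm \<xi>)))"
    by (simp add: algebra_simps)
  then show ?thesis
    using norm_triangle_ineq4[of "phase k t1 \<xi> - 1 - \<i> * complex_of_real (t1 * (\<xi> $ k * norm \<xi>))" "phase k t2 \<xi> - 1 - \<i> * complex_of_real (t2 * (\<xi> $ k * norm \<xi>))"]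
      1[of t1] 1[of t2] by (simp only: distrib_right)
qed

lemma continuous_on_phase: "continuous_on UNIV (phase k t)"
  unfolding phase_def[abs_def] by (intro continuous_intros)

text \<open>After rescaling, the integrand divided by \<open>h\<^sup>2\<close> converges to \<open>i (t\<^sub>1 - t\<^sub>2) U(0)\<close>
  times \<open>\<eta>\<^sub>k \<bar>\<eta>\<bar>\<close>, boundedly on the ball.\<close>

lemma pairing_linear_limit:
  fixes U :: "real^'n \<Rightarrow> complex"
  assumes U: "continuous_on UNIV U" and K: "\<And>\<xi>. norm (U \<xi>) \<le> K" and \<rho>: "\<rho> \<le> 1"
    and h0: "\<And>i::nat. 0 < h i" and hl: "h \<longlonglongrightarrow> 0"
  shows "(\<lambda>i. pairing k \<rho> (h i) (\<lambda>\<xi>. (phase k t1 \<xi> - phase k t2 \<xi>) * U \<xi>) / complex_of_real (h i ^ (CARD('n) + 2)))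
    \<longlonglongrightarrow> \<i> * complex_of_real (t1 - t2) * U 0 * complex_of_real (kappa k \<rho>)"
proof -
  let ?e = "axis k 1 :: real^'n" and ?N = "CARD('n)"
  let ?B = "ball (- ?e) \<rho>"
  define E where "E \<xi> = (phase k t1 \<xi> - phase k t2 \<xi>) * U \<xi>" for \<xi>
  define \<mu> where "\<mu> \<xi> = \<xi> $ k * norm \<xi>" for \<xi> :: "real^'n"
  have Ec: "continuous_on UNIV E" unfolding E_def by (intro continuous_intros continuous_on_phase U)
  then have Em[measurable]: "E \<in> borel_measurable borel" by (rule borel_measurable_continuous_onI)
  have \<mu>m[measurable]: "\<mu> \<in> borel_measurable borel"
    unfolding \<mu>_def[abs_def] by (intro borel_measurable_continuous_onI continuous_intros)
  have Bm: "(\<lambda>\<eta>. complex_of_real (indicator ?B \<eta>)) \<in> borel_measurable borel"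
  proof -
    have "(indicator ?B :: real^'n \<Rightarrow> real) \<in> borel_measurable borel"
      by (intro borel_measurable_indicator) simp
    then show ?thesis by measurable
  qed
  have K0: "0 \<le> K" using K[of 0] norm_ge_zero order_trans by blast
  define S where "S i \<eta> = complex_of_real (indicator ?B \<eta>) * (\<Sum>j\<le>4. diff4 j *\<^sub>R (E (h i *\<^sub>R (\<eta> + real j *\<^sub>R ?e)) / complex_of_real ((h i)\<^sup>2)))" for i \<eta>
  define S' where "S' \<eta> = complex_of_real (indicator ?B \<eta>) * (\<Sum>j\<le>4. diff4 j *\<^sub>R (\<i> * complex_of_real ((t1 - t2) * \<mu> (\<eta> + real j *\<^sub>R ?e)) * U 0))" for \<eta>
  have eq: "pairing k \<rho> (h i) E / complex_of_real (h i ^ (?N + 2)) = (LINT \<eta>|lborel. S i \<eta>)" for i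
  proof -
    have "S i \<eta> = complex_of_real (indicator ?B \<eta>) * (\<Sum>j\<le>4. diff4 j *\<^sub>R E (h i *\<^sub>R (\<eta> + real j *\<^sub>R ?e))) / complex_of_real ((h i)\<^sup>2)" for \<eta>
    proof -
      have aux: "a *\<^sub>R (z / w) = (a *\<^sub>R z) / w" for a and z w :: complex
        by (simp add: scaleR_conv_of_real)
      show ?thesis unfolding S_def aux sum_divide_distrib[symmetric] by simp
    qed
    then have "(LINT \<eta>|lborel. S i \<eta>) = (LINT \<eta>|lborel. complex_of_real (indicator ?B \<eta>) * (\<Sum>j\<le>4. diff4 j *\<^sub>R E (h i *\<^sub>R (\<eta> + real j *\<^sub>R ?e)))) / complex_of_real ((h i)\<^sup>2)"
      by (simp only: integral_divide_zero)
    then show ?thesis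
      unfolding pairing_fourth_difference[OF Ec h0[of i] \<rho>] using h0[of i] by (simp add: power_add power2_eq_square)
  qed
  have Ebound: "norm (E (c *\<^sub>R \<zeta>) / complex_of_real (c\<^sup>2)) \<le> (\<bar>t1\<bar> + \<bar>t2\<bar>) * (norm \<zeta>)\<^sup>2 * K" if "0 < c" for c \<zeta>
  proof -
    have "norm (phase k t1 (c *\<^sub>R \<zeta>) - phase k t2 (c *\<^sub>R \<zeta>)) \<le> (\<bar>t1\<bar> + \<bar>t2\<bar>) * (norm (c *\<^sub>R \<zeta>))\<^sup>2"
      using norm_triangle_ineq4[of "phase k t1 (c *\<^sub>R \<zeta>) - 1" "phase k t2 (c *\<^sub>R \<zeta>) - 1"]
        norm_phase_minus_one[of k t1 "c *\<^sub>R \<zeta>"] norm_phase_minus_one[of k t2 "c *\<^sub>R \<zeta>"]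
      by (simp add: distrib_right)
    then have "norm (E (c *\<^sub>R \<zeta>)) \<le> (\<bar>t1\<bar> + \<bar>t2\<bar>) * (norm (c *\<^sub>R \<zeta>))\<^sup>2 * K"
      unfolding E_def norm_mult using K K0 by (intro mult_mono) auto
    also have "\<dots> = (\<bar>t1\<bar> + \<bar>t2\<bar>) * (norm \<zeta>)\<^sup>2 * K * c\<^sup>2" by (simp add: power_mult_distrib)
    finally show ?thesis using that by (simp add: norm_divide norm_power pos_divide_le_eq)
  qed
  have Elim: "(\<lambda>i. E (h i *\<^sub>R \<zeta>) / complex_of_real ((h i)\<^sup>2)) \<longlonglongrightarrow> \<i> * complex_of_real ((t1 - t2) * \<mu> \<zeta>) * U 0" for \<zeta>
  proof -
    have U0: "(\<lambda>i. U (h i *\<^sub>R \<zeta>)) \<longlonglongrightarrow> U 0"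
    proof -
      have "(\<lambda>i. h i *\<^sub>R \<zeta>) \<longlonglongrightarrow> 0 *\<^sub>R \<zeta>" by (intro tendsto_intros hl)
      then show ?thesis by (intro continuous_on_tendsto_compose[OF U]) auto
    qed
    have "(\<lambda>i. (t1\<^sup>2 + t2\<^sup>2) * norm \<zeta> ^ 4 * (h i)\<^sup>2) \<longlonglongrightarrow> (t1\<^sup>2 + t2\<^sup>2) * norm \<zeta> ^ 4 * 0\<^sup>2"
      by (intro tendsto_intros hl)
    then have z: "(\<lambda>i. (t1\<^sup>2 + t2\<^sup>2) * norm \<zeta> ^ 4 * (h i)\<^sup>2) \<longlonglongrightarrow> 0" by simp
    have "(\<lambda>i. (phase k t1 (h i *\<^sub>R \<zeta>) - phase k t2 (h i *\<^sub>R \<zeta>)) / complex_of_real ((h i)\<^sup>2)) \<longlonglongrightarrow> \<i> * complex_of_real ((t1 - t2) * \<mu> \<zeta>)"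
    proof (rule LIM_zero_cancel, rule Lim_null_comparison[OF always_eventually z], rule allI)
      fix i
      let ?p = "phase k t1 (h i *\<^sub>R \<zeta>) - phase k t2 (h i *\<^sub>R \<zeta>)"
      have hc: "complex_of_real ((h i)\<^sup>2) \<noteq> 0" using h0[of i] by simp
      have \<mu>h: "(h i *\<^sub>R \<zeta>) $ k * norm (h i *\<^sub>R \<zeta>) = (h i)\<^sup>2 * \<mu> \<zeta>"
        using h0[of i] by (simp add: \<mu>_def power2_eq_square)
      have "?p / complex_of_real ((h i)\<^sup>2) - \<i> * complex_of_real ((t1 - t2) * \<mu> \<zeta>)
        = (?p - \<i> * complex_of_real ((t1 - t2) * ((h i *\<^sub>R \<zeta>) $ k * norm (h i *\<^sub>R \<zeta>)))) / complex_of_real ((h i)\<^sup>2)"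
        unfolding \<mu>h of_real_mult using hc by (simp add: diff_divide_distrib)
      then have "norm (?p / complex_of_real ((h i)\<^sup>2) - \<i> * complex_of_real ((t1 - t2) * \<mu> \<zeta>))
        = norm (?p - \<i> * complex_of_real ((t1 - t2) * ((h i *\<^sub>R \<zeta>) $ k * norm (h i *\<^sub>R \<zeta>)))) / (h i)\<^sup>2"
        by (simp only: norm_divide norm_of_real abs_power2)
      also have "\<dots> \<le> (t1\<^sup>2 + t2\<^sup>2) * norm (h i *\<^sub>R \<zeta>) ^ 4 / (h i)\<^sup>2"
        by (intro divide_right_mono phase_diff_expansion) simp
      also have "\<dots> = (t1\<^sup>2 + t2\<^sup>2) * norm \<zeta> ^ 4 * (h i)\<^sup>2"
        using h0[of i] by (simp add: power_mult_distrib power2_eq_square power4_eq_xxxx)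
      finally show "norm (?p / complex_of_real ((h i)\<^sup>2) - \<i> * complex_of_real ((t1 - t2) * \<mu> \<zeta>)) \<le> (t1\<^sup>2 + t2\<^sup>2) * norm \<zeta> ^ 4 * (h i)\<^sup>2" .
    qed
    from tendsto_mult[OF this U0] show ?thesis by (simp add: E_def)
  qed
  have "(\<lambda>i. LINT \<eta>|lborel. S i \<eta>) \<longlonglongrightarrow> (LINT \<eta>|lborel. S' \<eta>)"
  proof (rule integral_dominated_convergence[where w="\<lambda>\<eta>. (16 * ((\<bar>t1\<bar> + \<bar>t2\<bar>) * 36 * K)) * indicator (cball 0 2) \<eta>"])
    show "integrable lborel (\<lambda>\<eta>::real^'n. (16 * ((\<bar>t1\<bar> + \<bar>t2\<bar>) * 36 * K)) * indicator (cball 0 2) \<eta>)"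
      by (rule integrable_indicator_cball)
    show "AE \<eta> in lborel. (\<lambda>i. S i \<eta>) \<longlonglongrightarrow> S' \<eta>"
      unfolding S_def S'_def by (intro AE_I2 tendsto_mult tendsto_const tendsto_sum tendsto_scaleR Elim)
    show "AE \<eta> in lborel. norm (S i \<eta>) \<le> (16 * ((\<bar>t1\<bar> + \<bar>t2\<bar>) * 36 * K)) * indicator (cball 0 2) \<eta>" for i
    proof (rule AE_I2)
      fix \<eta>
      show "norm (S i \<eta>) \<le> (16 * ((\<bar>t1\<bar> + \<bar>t2\<bar>) * 36 * K)) * indicator (cball 0 2) \<eta>"
      proof (cases "\<eta> \<in> ?B")
        case True
        then have n2: "norm \<eta> \<le> 2" using dist_triangle[of 0 \<eta> "- ?e"] \<rho> by (simp add: norm_axis_1)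
        have "norm (S i \<eta>) \<le> (\<Sum>j\<le>4. norm (diff4 j *\<^sub>R (E (h i *\<^sub>R (\<eta> + real j *\<^sub>R ?e)) / complex_of_real ((h i)\<^sup>2))))"
          using True norm_sum[of "\<lambda>j. diff4 j *\<^sub>R (E (h i *\<^sub>R (\<eta> + real j *\<^sub>R ?e)) / complex_of_real ((h i)\<^sup>2))" "{..4}"]
          by (simp add: S_def)
        also have "\<dots> \<le> (\<Sum>j\<le>4. \<bar>diff4 j\<bar> * ((\<bar>t1\<bar> + \<bar>t2\<bar>) * 36 * K))"
        proof (rule sum_mono)
          fix j :: nat assume "j \<in> {..4}"
          then have "norm (\<eta> + real j *\<^sub>R ?e) \<le> 6"
            using norm_triangle_ineq[of \<eta> "real j *\<^sub>R ?e"] n2 by (simp add: norm_axis_1)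
          then have "(norm (\<eta> + real j *\<^sub>R ?e))\<^sup>2 \<le> 6\<^sup>2" by (rule power_mono) simp
          then have "(\<bar>t1\<bar> + \<bar>t2\<bar>) * (norm (\<eta> + real j *\<^sub>R ?e))\<^sup>2 * K \<le> (\<bar>t1\<bar> + \<bar>t2\<bar>) * 36 * K"
            using K0 by (intro mult_right_mono mult_left_mono) auto
          with Ebound[OF h0[of i], of "\<eta> + real j *\<^sub>R ?e"]
          have "norm (E (h i *\<^sub>R (\<eta> + real j *\<^sub>R ?e)) / complex_of_real ((h i)\<^sup>2)) \<le> (\<bar>t1\<bar> + \<bar>t2\<bar>) * 36 * K" by linarith
          then show "norm (diff4 j *\<^sub>R (E (h i *\<^sub>R (\<eta> + real j *\<^sub>R ?e)) / complex_of_real ((h i)\<^sup>2))) \<le> \<bar>diff4 j\<bar> * ((\<bar>t1\<bar> + \<bar>t2\<bar>) * 36 * K)"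
            unfolding norm_scaleR by (rule mult_left_mono) simp
        qed
        also have "\<dots> = 16 * ((\<bar>t1\<bar> + \<bar>t2\<bar>) * 36 * K)" by (simp only: sum_distrib_right[symmetric] sum_abs_diff4)
        finally show ?thesis using n2 by simp
      next
        case False
        then show ?thesis using K0 by (simp add: S_def)
      qed
    qed
    show "S i \<in> borel_measurable lborel" for i
      unfolding S_def[abs_def] using Bm by measurable
    show "S' \<in> borel_measurable lborel"
      unfolding S'_def[abs_def] using Bm by measurable
  qed
  also have "(LINT \<eta>|lborel. S' \<eta>) = \<i> * complex_of_real (t1 - t2) * U 0 * complex_of_real (kappa k \<rho>)"
  proof -
    have "S' \<eta> = \<i> * complex_of_real (t1 - t2) * U 0 * complex_of_real (indicator ?B \<eta> *
        (\<Sum>j\<le>4. diff4 j *\<^sub>R ((\<eta> + real j *\<^sub>R ?e) $ k * norm (\<eta> + real j *\<^sub>R ?e))))" for \<eta>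
    proof -
      have "diff4 j *\<^sub>R (\<i> * complex_of_real ((t1 - t2) * x) * U 0) = \<i> * complex_of_real (t1 - t2) * U 0 * complex_of_real (diff4 j *\<^sub>R x)" for j x
        by (simp add: scaleR_conv_of_real)
      then show ?thesis
        unfolding S'_def \<mu>_def of_real_mult[of "indicator ?B \<eta>"] of_real_sum sum_distrib_left
        by (simp only: mult.left_commute)
    qed
    then show ?thesis unfolding kappa_def by (simp only: integral_mult_right_zero integral_complex_of_real)
  qed
  finally show ?thesis unfolding eq[symmetric] E_def .
qed

section \<open>Consequences of membership in the weighted spaces\<close>

lemma one_plus_square_powr_le:
  fixes t :: real
  assumes "0 \<le> t" "0 \<le> r"
  shows "(1 + t\<^sup>2) powr (r / 2) \<le> 2 powr (r / 2) * (1 + t powr r)"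
proof (cases "t \<le> 1")
  case True
  have "t\<^sup>2 \<le> 1" using True assms by (simp add: power_le_one)
  then have "(1 + t\<^sup>2) powr (r / 2) \<le> 2 powr (r / 2) * 1"
    using assms by (simp add: powr_mono2)
  also have "\<dots> \<le> 2 powr (r / 2) * (1 + t powr r)" by (intro mult_left_mono) auto
  finally show ?thesis .
next
  case False
  then have "1 \<le> t\<^sup>2" by (simp add: one_le_power)
  then have "(1 + t\<^sup>2) powr (r / 2) \<le> (2 * t\<^sup>2) powr (r / 2)"
    using assms by (intro powr_mono2) auto
  also have "\<dots> = 2 powr (r / 2) * t powr r"
  proof -
    have "t\<^sup>2 = t powr 2" using False by simp
    then have "(t\<^sup>2) powr (r / 2) = t powr r"
      by (simp only: powr_powr) simp
    then show ?thesis by (simp add: powr_mult)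
  qed
  also have "\<dots> \<le> 2 powr (r / 2) * (1 + t powr r)" by (intro mult_left_mono) auto
  finally show ?thesis .
qed

lemma weight_measurable:
  fixes f :: "real^'n \<Rightarrow> 'b::{banach, second_countable_topology}"
  assumes "f \<in> borel_measurable lebesgue"
  shows "(\<lambda>x. (1 + (norm x)\<^sup>2) powr a *\<^sub>R f x) \<in> borel_measurable lebesgue"
  by (intro borel_measurable_scaleR assms lebesgue_lborel(5)) measurable

text \<open>The weight \<open>\<bar>x\<bar>\<^sup>r\<close> with \<open>r > n/2\<close> makes \<open>u\<close> integrable. On the Fourier side \<open>s > n/2 + 1\<close>
  leaves enough of the weight for one derivative to have an integrable transform.\<close>

lemma Z_space_regular:
  fixes u :: "real^'n \<Rightarrow> real"
  assumes u: "u \<in> Z_space s r" and s: "s > real CARD('n) / 2 + 1" and r: "r > real CARD('n) / 2"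
  shows "integrable lebesgue u" "square_integrable lebesgue u"
    and "integrable lborel (fourier u)"
    and "integrable lborel (\<lambda>\<xi>. \<i> * complex_of_real (\<xi> $ k) * fourier u \<xi>)"
    and "square_integrable lborel (\<lambda>\<xi>. \<i> * complex_of_real (\<xi> $ k) * fourier u \<xi>)"
proof -
  obtain F where F: "L2_fourier u F"
    and wF: "square_integrable lebesgue (\<lambda>\<xi>. complex_of_real ((1 + (norm \<xi>)\<^sup>2) powr (s / 2)) * F \<xi>)"
    using u by (auto simp: Z_space_def in_Hs_def in_L2_iff)
  have wu: "square_integrable lebesgue (\<lambda>x. norm x powr r * u x)"
    using u by (simp add: Z_space_def in_L2_iff)
  show u2: "square_integrable lebesgue u" by (rule L2_fourierD(1)[OF F])
  note um = square_integrableD(1)[OF u2]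
  have "0 \<le> real CARD('n) / 2" by simp
  then have r0: "0 \<le> r" and s1: "1 \<le> s" using r s by linarith+
  have w0: "y \<le> (1 + (norm x)\<^sup>2) powr (0 / 2) * y" for x :: "real^'n" and y :: real
  proof -
    have "1 + (norm x)\<^sup>2 \<noteq> 0" using zero_le_power2[of "norm x"] by linarith
    then show ?thesis by simp
  qed
  have "square_integrable lebesgue (\<lambda>x. norm (u x) + norm (norm x powr r * u x))"
    using u2 wu by (intro square_integrable_add) (auto simp: square_integrable_def)
  then have "square_integrable lebesgue (\<lambda>x. (1 + (norm x)\<^sup>2) powr (r / 2) *\<^sub>R u x)"
  proof (rule square_integrable_bound[OF _ weight_measurable[OF um] AE_I2, where C="2 powr (r / 2)"])
    fix x :: "real^'n"
    have "(1 + (norm x)\<^sup>2) powr (r / 2) * \<bar>u x\<bar> \<le> 2 powr (r / 2) * (1 + norm x powr r) * \<bar>u x\<bar>"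
      using r0 by (intro mult_right_mono one_plus_square_powr_le) auto
    then show "norm ((1 + (norm x)\<^sup>2) powr (r / 2) *\<^sub>R u x) \<le> 2 powr (r / 2) * norm (norm (u x) + norm (norm x powr r * u x))"
      by (simp add: abs_mult algebra_simps)
  qed
  then show u1: "integrable lebesgue u"
    by (rule integrable_of_weighted_L2[OF _ um um _ AE_I2[OF w0]]) (use r in simp)
  let ?U = "fourier u"
  have Ub: "?U \<in> borel_measurable borel" by (rule fourier_borel[OF u1])
  have Um: "?U \<in> borel_measurable lebesgue" by (rule lebesgue_lborel(5)[OF Ub])
  have wU: "square_integrable lebesgue (\<lambda>\<xi>. (1 + (norm \<xi>)\<^sup>2) powr (s / 2) *\<^sub>R ?U \<xi>)"
    by (rule square_integrable_cong_AE[OF wF weight_measurable[OF Um]])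
      (use L2_fourier_eq_fourier[OF F u1] in \<open>auto simp: scaleR_conv_of_real elim: eventually_mono\<close>)
  have "integrable lebesgue ?U"
    by (rule integrable_of_weighted_L2[OF wU Um Um _ AE_I2[OF w0]]) (use s in simp)
  then show "integrable lborel ?U" using lebesgue_lborel(1)[OF Ub] by simp
  let ?V = "\<lambda>\<xi>. \<i> * complex_of_real (\<xi> $ k) * fourier u \<xi>"
  have Vb: "?V \<in> borel_measurable borel" using Ub by measurable
  have Vm: "?V \<in> borel_measurable lebesgue" by (rule lebesgue_lborel(5)[OF Vb])
  have ck: "\<bar>\<xi> $ k\<bar> \<le> (1 + (norm \<xi>)\<^sup>2) powr (1 / 2)" for \<xi> :: "real^'n"
  proof -
    have "\<bar>\<xi> $ k\<bar> \<le> norm \<xi>" by (rule component_le_norm_cart)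
    also have "\<dots> = sqrt ((norm \<xi>)\<^sup>2)" by simp
    also have "\<dots> \<le> sqrt (1 + (norm \<xi>)\<^sup>2)" by (intro real_sqrt_le_mono) simp
    also have "\<dots> = (1 + (norm \<xi>)\<^sup>2) powr (1 / 2)" by (simp add: powr_half_sqrt)
    finally show ?thesis .
  qed
  have Vle: "norm (?V \<xi>) \<le> (1 + (norm \<xi>)\<^sup>2) powr (1 / 2) * norm (?U \<xi>)" for \<xi>
    using mult_right_mono[OF ck[of \<xi>], of "norm (?U \<xi>)"] by (simp add: norm_mult)
  have "integrable lebesgue ?V"
    by (rule integrable_of_weighted_L2[OF wU Um Vm _ AE_I2[OF Vle]]) (use s in simp)
  then show "integrable lborel ?V" using lebesgue_lborel(1)[OF Vb] by simp
  have "square_integrable lebesgue ?V"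
  proof (rule square_integrable_bound[OF wU Vm AE_I2, where C=1])
    fix \<xi> :: "real^'n"
    have "(1 + (norm \<xi>)\<^sup>2) powr (1 / 2) \<le> (1 + (norm \<xi>)\<^sup>2) powr (s / 2)"
      using s1 by (intro powr_mono) auto
    then have "(1 + (norm \<xi>)\<^sup>2) powr (1 / 2) * norm (?U \<xi>) \<le> (1 + (norm \<xi>)\<^sup>2) powr (s / 2) * norm (?U \<xi>)"
      by (rule mult_right_mono) simp
    then show "norm (?V \<xi>) \<le> 1 * norm ((1 + (norm \<xi>)\<^sup>2) powr (s / 2) *\<^sub>R ?U \<xi>)"
      using Vle[of \<xi>] by simp
  qed
  then show "square_integrable lborel ?V" using lebesgue_lborel(3)[OF Vb] by simp
qed

text \<open>The \<open>H\<^sup>s\<close> part of the norm dominates the \<open>L\<^sup>2\<close> norm by Plancherel, the constant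
  \<open>(2\<pi>)\<^sup>n\<close> being at least 1.\<close>

lemma norms_le_Z_norm:
  fixes f g :: "real^'n \<Rightarrow> real"
  assumes f: "f \<in> Z_space s r" and g: "g \<in> Z_space s r" and s: "0 \<le> s"
  shows "norm2 lebesgue (\<lambda>x. f x - g x) \<le> Z_norm s r (\<lambda>x. f x - g x)"
    and "norm2 lebesgue (\<lambda>x. norm x powr r * (f x - g x)) \<le> Z_norm s r (\<lambda>x. f x - g x)"
proof -
  let ?d = "\<lambda>x. f x - g x"
  let ?w = "\<lambda>\<xi>::real^'n. (1 + (norm \<xi>)\<^sup>2) powr (s / 2)"
  obtain F where F: "L2_fourier f F" "square_integrable lebesgue (\<lambda>\<xi>. complex_of_real (?w \<xi>) * F \<xi>)"
    using f by (auto simp: Z_space_def in_Hs_def in_L2_iff)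
  obtain G where G: "L2_fourier g G" "square_integrable lebesgue (\<lambda>\<xi>. complex_of_real (?w \<xi>) * G \<xi>)"
    using g by (auto simp: Z_space_def in_Hs_def in_L2_iff)
  have d: "L2_fourier ?d (\<lambda>\<xi>. F \<xi> - G \<xi>)" by (rule L2_fourier_diff[OF F(1) G(1)])
  have D: "L2_fourier ?d (fourier_L2 ?d)" by (rule L2_fourier_fourier_L2[OF d])
  note Dm = square_integrableD(1)[OF L2_fourierD(2)[OF D]]
  have wD: "square_integrable lebesgue (\<lambda>\<xi>. ?w \<xi> *\<^sub>R fourier_L2 ?d \<xi>)"
    by (rule square_integrable_cong_AE[OF square_integrable_diff[OF F(2) G(2)] weight_measurable[OF Dm]])
      (use L2_fourier_unique[OF d D] in \<open>auto simp: scaleR_conv_of_real right_diff_distrib[symmetric] elim: eventually_mono\<close>)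
  have "norm2 lebesgue (fourier_L2 ?d) \<le> norm2 lebesgue (\<lambda>\<xi>. ?w \<xi> *\<^sub>R fourier_L2 ?d \<xi>)"
  proof (rule norm2_mono[OF wD Dm AE_I2])
    fix \<xi> :: "real^'n"
    have "1 \<le> ?w \<xi>" using s by (intro ge_one_powr_ge_zero) auto
    then show "norm (fourier_L2 ?d \<xi>) \<le> norm (?w \<xi> *\<^sub>R fourier_L2 ?d \<xi>)"
      using mult_right_mono[of 1 "?w \<xi>" "norm (fourier_L2 ?d \<xi>)"] by simp
  qed
  also have "\<dots> = Hs_norm s ?d" by (simp add: Hs_norm_def L2_norm_eq scaleR_conv_of_real)
  finally have 1: "norm2 lebesgue (fourier_L2 ?d) \<le> Hs_norm s ?d" .
  have "1 \<le> (2 * pi) ^ CARD('n)" by (rule one_le_power) (use pi_ge_two in simp)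
  then have "1 \<le> sqrt ((2 * pi) ^ CARD('n))" by (simp only: real_sqrt_ge_1_iff)
  then have 2: "norm2 lebesgue ?d \<le> norm2 lebesgue (fourier_L2 ?d)"
    using Plancherel_L2_fourier[OF D] mult_right_mono[of 1 "sqrt ((2 * pi) ^ CARD('n))" "norm2 lebesgue ?d"] by simp
  have "norm2 lebesgue ?d \<le> Hs_norm s ?d" using 2 1 by (rule order_trans)
  then show "norm2 lebesgue ?d \<le> Z_norm s r ?d" by (simp add: Z_norm_def L2_norm_eq add_increasing2)
  have "0 \<le> Hs_norm s ?d" by (simp add: Hs_norm_def L2_norm_eq)
  then show "norm2 lebesgue (\<lambda>x. norm x powr r * (f x - g x)) \<le> Z_norm s r ?d"
    by (simp add: Z_norm_def L2_norm_eq)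
qed

lemma bounded_of_norm2_continuous:
  assumes sq: "\<And>t. t \<in> {0..T} \<Longrightarrow> square_integrable M (f t)"
    and le: "\<And>t \<tau>. t \<in> {0..T} \<Longrightarrow> \<tau> \<in> {0..T} \<Longrightarrow> norm2 M (\<lambda>x. f \<tau> x - f t x) \<le> z \<tau> t"
    and z: "\<And>t. t \<in> {0..T::real} \<Longrightarrow> ((\<lambda>\<tau>. z \<tau> t) \<longlongrightarrow> 0) (at t within {0..T})"
  shows "\<exists>K. \<forall>t\<in>{0..T}. norm2 M (f t) \<le> K"
proof -
  have "continuous_on {0..T} (\<lambda>t. norm2 M (f t))"
    unfolding continuous_on_def
  proof
    fix t assume t: "t \<in> {0..T}"
    have "eventually (\<lambda>\<tau>. norm (norm2 M (f \<tau>) - norm2 M (f t)) \<le> z \<tau> t) (at t within {0..T})"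
      unfolding eventually_at_filter
    proof (intro always_eventually allI impI)
      fix \<tau> assume \<tau>: "\<tau> \<in> {0..T}"
      show "norm (norm2 M (f \<tau>) - norm2 M (f t)) \<le> z \<tau> t"
        using norm2_diff_le[OF sq[OF \<tau>] sq[OF t]] le[OF t \<tau>] by simp
    qed
    from Lim_null_comparison[OF this z[OF t]]
    show "((\<lambda>t. norm2 M (f t)) \<longlongrightarrow> norm2 M (f t)) (at t within {0..T})" by (rule LIM_zero_cancel)
  qed
  then have "compact ((\<lambda>t. norm2 M (f t)) ` {0..T})" by (rule compact_continuous_image) simp
  from compact_imp_bounded[OF this] obtain K where "\<forall>y\<in>(\<lambda>t. norm2 M (f t)) ` {0..T}. norm y \<le> K"
    unfolding bounded_iff by auto
  then show ?thesis by (intro exI[of _ K]) auto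
qed

text \<open>Continuity in time is used through compactness of the time interval: it makes the moments of
  \<open>u\<^sup>2\<close> up to order 2 uniformly bounded.\<close>

lemma continuous_into_Z_moments:
  fixes u :: "real \<Rightarrow> real^'n \<Rightarrow> real"
  assumes u: "continuous_into_Z T s r u" and s: "0 \<le> s" and r: "1 \<le> r"
  obtains M where "\<And>t. t \<in> {0..T} \<Longrightarrow> (LINT x|lebesgue. \<bar>(u t x)\<^sup>2\<bar>) \<le> M"
    "\<And>t. t \<in> {0..T} \<Longrightarrow> integrable lebesgue (\<lambda>x. (norm x)\<^sup>2 * (u t x)\<^sup>2)"
    "\<And>t. t \<in> {0..T} \<Longrightarrow> (LINT x|lebesgue. (norm x)\<^sup>2 * \<bar>(u t x)\<^sup>2\<bar>) \<le> M"
proof -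
  have Z: "u t \<in> Z_space s r" "((\<lambda>\<tau>. Z_norm s r (\<lambda>x. u \<tau> x - u t x)) \<longlongrightarrow> 0) (at t within {0..T})"
    if "t \<in> {0..T}" for t
    using u that by (auto simp: continuous_into_Z_def)
  have sq: "square_integrable lebesgue (u t)" "square_integrable lebesgue (\<lambda>x. norm x powr r * u t x)" if "t \<in> {0..T}" for t
    using Z(1)[OF that] by (auto simp: Z_space_def in_Hs_def in_L2_iff dest: L2_fourierD(1))
  have "\<exists>K. \<forall>t\<in>{0..T}. norm2 lebesgue (u t) \<le> K"
    by (rule bounded_of_norm2_continuous[OF sq(1) norms_le_Z_norm(1)[OF Z(1) Z(1) s] Z(2)])
  then obtain K0 where K0: "\<And>t. t \<in> {0..T} \<Longrightarrow> norm2 lebesgue (u t) \<le> K0" by blast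
  have le1: "norm2 lebesgue (\<lambda>x. norm x powr r * u \<tau> x - norm x powr r * u t x) \<le> Z_norm s r (\<lambda>x. u \<tau> x - u t x)"
    if "t \<in> {0..T}" "\<tau> \<in> {0..T}" for t \<tau>
    using norms_le_Z_norm(2)[OF Z(1)[OF that(2)] Z(1)[OF that(1)] s] by (simp add: right_diff_distrib)
  have "\<exists>K. \<forall>t\<in>{0..T}. norm2 lebesgue (\<lambda>x. norm x powr r * u t x) \<le> K"
    by (rule bounded_of_norm2_continuous[OF sq(2) le1 Z(2)])
  then obtain K1 where K1: "\<And>t. t \<in> {0..T} \<Longrightarrow> norm2 lebesgue (\<lambda>x. norm x powr r * u t x) \<le> K1" by blast
  have K0': "(LINT x|lebesgue. (u t x)\<^sup>2) \<le> K0\<^sup>2" if "t \<in> {0..T}" for t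
    using power_mono[OF K0[OF that], of 2] by (simp add: norm2_power2)
  have K1': "(LINT x|lebesgue. (norm x powr r * u t x)\<^sup>2) \<le> K1\<^sup>2" if "t \<in> {0..T}" for t
    using power_mono[OF K1[OF that], of 2] by (simp add: norm2_power2)
  have xr: "(norm x)\<^sup>2 * (v::real)\<^sup>2 \<le> v\<^sup>2 + (norm x powr r * v)\<^sup>2" for x :: "real^'n" and v
  proof -
    have "(norm x)\<^sup>2 \<le> 1 + (norm x powr r)\<^sup>2"
    proof (cases "norm x \<le> 1")
      case True
      then have "(norm x)\<^sup>2 \<le> 1" by (simp add: power_le_one)
      then show ?thesis using zero_le_power2[of "norm x powr r"] by linarith
    next
      case False
      then have "norm x powr 1 \<le> norm x powr r" using r by (intro powr_mono) auto
      then have "(norm x)\<^sup>2 \<le> (norm x powr r)\<^sup>2" using False by (intro power_mono) auto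
      then show ?thesis by linarith
    qed
    then have "(norm x)\<^sup>2 * v\<^sup>2 \<le> (1 + (norm x powr r)\<^sup>2) * v\<^sup>2" by (rule mult_right_mono) simp
    then show ?thesis by (simp add: algebra_simps power_mult_distrib)
  qed
  have i: "integrable lebesgue (\<lambda>x. (u t x)\<^sup>2 + (norm x powr r * u t x)\<^sup>2)" if "t \<in> {0..T}" for t
    using square_integrableD(2)[OF sq(1)[OF that]] square_integrableD(2)[OF sq(2)[OF that]] by simp
  have i2: "integrable lebesgue (\<lambda>x. (norm x)\<^sup>2 * (u t x)\<^sup>2)" if "t \<in> {0..T}" for t
  proof (rule Bochner_Integration.integrable_bound[OF i[OF that] _ AE_I2])
    have n: "(\<lambda>x::real^'n. (norm x)\<^sup>2) \<in> borel_measurable lebesgue" by (intro lebesgue_lborel(5)) measurable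
    show "(\<lambda>x. (norm x)\<^sup>2 * (u t x)\<^sup>2) \<in> borel_measurable lebesgue"
      by (intro borel_measurable_times n borel_measurable_power square_integrableD(1)[OF sq(1)[OF that]])
    show "norm ((norm x)\<^sup>2 * (u t x)\<^sup>2) \<le> norm ((u t x)\<^sup>2 + (norm x powr r * u t x)\<^sup>2)" for x
      using xr[of x "u t x"] by simp
  qed
  show thesis
  proof (rule that[of "K0\<^sup>2 + K1\<^sup>2"])
    fix t assume t: "t \<in> {0..T}"
    show "(LINT x|lebesgue. \<bar>(u t x)\<^sup>2\<bar>) \<le> K0\<^sup>2 + K1\<^sup>2" using K0'[OF t] by (simp add: add_increasing2)
    show "integrable lebesgue (\<lambda>x. (norm x)\<^sup>2 * (u t x)\<^sup>2)" by (rule i2[OF t])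
    have "(LINT x|lebesgue. (norm x)\<^sup>2 * (u t x)\<^sup>2) \<le> (LINT x|lebesgue. (u t x)\<^sup>2 + (norm x powr r * u t x)\<^sup>2)"
      by (intro integral_mono i2 i t xr)
    also have "\<dots> = (LINT x|lebesgue. (u t x)\<^sup>2) + (LINT x|lebesgue. (norm x powr r * u t x)\<^sup>2)"
      using square_integrableD(2)[OF sq(1)[OF t]] square_integrableD(2)[OF sq(2)[OF t]]
      by (intro Bochner_Integration.integral_add) simp_all
    finally show "(LINT x|lebesgue. (norm x)\<^sup>2 * \<bar>(u t x)\<^sup>2\<bar>) \<le> K0\<^sup>2 + K1\<^sup>2"
      using K0'[OF t] K1'[OF t] by simp
  qed
qed

section \<open>The Duhamel integral\<close>

lemma pairing_sum:
  assumes h: "0 < h" "\<rho> \<le> 1" and D: "finite D" "\<And>p. p \<in> D \<Longrightarrow> square_integrable lebesgue (F p)"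
  shows "pairing k \<rho> h (\<lambda>\<xi>. \<Sum>p\<in>D. complex_of_real (a p) * F p \<xi>) = (\<Sum>p\<in>D. complex_of_real (a p) * pairing k \<rho> h (F p))"
proof -
  have i: "integrable lebesgue (\<lambda>\<xi>. complex_of_real (a p) * (F p \<xi> * complex_of_real (test k \<rho> h \<xi>)))" if "p \<in> D" for p
    by (intro integrable_mult_right integrable_mult_square_integrable[OF D(2)[OF that] test_L2[OF h]])
  have "pairing k \<rho> h (\<lambda>\<xi>. \<Sum>p\<in>D. complex_of_real (a p) * F p \<xi>)
      = (LINT \<xi>|lebesgue. (\<Sum>p\<in>D. complex_of_real (a p) * (F p \<xi> * complex_of_real (test k \<rho> h \<xi>))))"
    unfolding pairing_def sum_distrib_right by (simp only: mult.assoc)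
  also have "\<dots> = (\<Sum>p\<in>D. complex_of_real (a p) * pairing k \<rho> h (F p))"
    unfolding pairing_def by (subst Bochner_Integration.integral_sum[OF i]) (simp_all only: integral_mult_right_zero)
  finally show ?thesis .
qed

text \<open>A bound that is uniform in \<open>\<tau>\<close> passes to the Riemann sums, whose weights add up to \<open>t\<close>, and
  by Plancherel also to their \<open>L\<^sup>2\<close> limit.\<close>

lemma pairing_L2_has_integral:
  fixes I :: "real^'n \<Rightarrow> real"
  assumes int: "L2_has_integral G I 0 t" and t: "0 \<le> t"
    and G: "\<And>\<tau>. \<tau> \<in> {0..t} \<Longrightarrow> L2_fourier (G \<tau>) (H \<tau>)"
    and B: "\<And>\<tau>. \<tau> \<in> {0..t} \<Longrightarrow> norm (pairing k \<rho> h (H \<tau>)) \<le> B"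
    and I: "L2_fourier I J" and h: "0 < h" "\<rho> \<le> 1"
  shows "norm (pairing k \<rho> h J) \<le> t * B"
proof (rule field_le_epsilon)
  fix e :: real assume e: "0 < e"
  define c where "c = sqrt ((2 * pi) ^ CARD('n)) * norm2 lebesgue (\<lambda>\<xi>. complex_of_real (test k \<rho> h \<xi>))"
  have c0: "0 \<le> c" by (simp add: c_def)
  define e' where "e' = e / (c + 1)"
  have e': "0 < e'" using e c0 by (simp add: e'_def)
  obtain \<gamma> where \<gamma>: "gauge \<gamma>" and fine: "\<And>D. D tagged_division_of {0..t} \<Longrightarrow> \<gamma> fine D \<Longrightarrow>
      L2_norm (\<lambda>x. (\<Sum>(\<tau>, K)\<in>D. measure lborel K * G \<tau> x) - I x) < e'"
    using int e' unfolding L2_has_integral_def by meson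
  obtain D where D: "D tagged_division_of {0..t}" "\<gamma> fine D"
    using fine_division_exists_real[OF \<gamma>] by blast
  have Df: "finite D" using D(1) by (rule tagged_division_of_finite)
  have tag: "fst p \<in> {0..t}" if "p \<in> D" for p
    using tagged_division_ofD(2,3)[OF D(1), of "fst p" "snd p"] that by auto
  define S where "S x = (\<Sum>p\<in>D. measure lborel (snd p) * G (fst p) x)" for x
  define S' where "S' \<xi> = (\<Sum>p\<in>D. complex_of_real (measure lborel (snd p)) * H (fst p) \<xi>)" for \<xi>
  have S: "L2_fourier S S'"
    unfolding S_def[abs_def] S'_def[abs_def] by (rule L2_fourier_sum[OF Df G[OF tag]])
  have d: "L2_fourier (\<lambda>x. S x - I x) (\<lambda>\<xi>. S' \<xi> - J \<xi>)" by (rule L2_fourier_diff[OF S I])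
  have "norm2 lebesgue (\<lambda>x. S x - I x) < e'"
    using fine[OF D] by (simp add: L2_norm_eq S_def case_prod_unfold)
  then have n: "norm2 lebesgue (\<lambda>\<xi>. S' \<xi> - J \<xi>) \<le> sqrt ((2 * pi) ^ CARD('n)) * e'"
    unfolding Plancherel_L2_fourier[OF d] by (intro mult_left_mono) auto
  have 1: "norm (pairing k \<rho> h (\<lambda>\<xi>. S' \<xi> - J \<xi>)) \<le> e"
  proof -
    have "norm (pairing k \<rho> h (\<lambda>\<xi>. S' \<xi> - J \<xi>)) \<le> norm2 lebesgue (\<lambda>\<xi>. S' \<xi> - J \<xi>) * norm2 lebesgue (\<lambda>\<xi>. complex_of_real (test k \<rho> h \<xi>))"
      by (rule pairing_L2_bound[OF h L2_fourierD(2)[OF d]])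
    also have "\<dots> \<le> (sqrt ((2 * pi) ^ CARD('n)) * e') * norm2 lebesgue (\<lambda>\<xi>. complex_of_real (test k \<rho> h \<xi>))"
      by (rule mult_right_mono[OF n]) simp
    also have "\<dots> = c * e'" by (simp add: c_def mult_ac)
    also have "\<dots> \<le> e" using e c0 by (simp add: e'_def pos_divide_le_eq algebra_simps)
    finally show ?thesis .
  qed
  have 2: "norm (pairing k \<rho> h S') \<le> t * B"
  proof -
    have "pairing k \<rho> h S' = (\<Sum>p\<in>D. complex_of_real (measure lborel (snd p)) * pairing k \<rho> h (H (fst p)))"
      unfolding S'_def[abs_def] by (rule pairing_sum[OF h Df L2_fourierD(2)[OF G[OF tag]]])
    also have "norm \<dots> \<le> (\<Sum>p\<in>D. measure lborel (snd p) * B)"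
      by (intro sum_norm_le) (auto simp: norm_mult intro!: mult_left_mono B tag)
    also have "\<dots> = (\<Sum>p\<in>D. measure lborel (snd p)) * B" by (simp add: sum_distrib_right)
    also have "(\<Sum>p\<in>D. measure lborel (snd p)) = t"
      using additive_content_tagged_division[of D 0 t] D(1) t by (simp add: case_prod_unfold)
    finally show ?thesis .
  qed
  have "pairing k \<rho> h (\<lambda>\<xi>. S' \<xi> - J \<xi>) = pairing k \<rho> h S' - pairing k \<rho> h J"
    by (rule pairing_diff[OF h L2_fourierD(2)[OF S] L2_fourierD(2)[OF I]])
  then have "pairing k \<rho> h J = pairing k \<rho> h S' - pairing k \<rho> h (\<lambda>\<xi>. S' \<xi> - J \<xi>)" by simp
  then show "norm (pairing k \<rho> h J) \<le> t * B + e"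
    using norm_triangle_ineq4[of "pairing k \<rho> h S'" "pairing k \<rho> h (\<lambda>\<xi>. S' \<xi> - J \<xi>)"] 1 2 by simp
qed

lemma propagator_eq: "propagator k t = fourier_multiplier (phase k t)"
  by (simp add: propagator_def phase_def[abs_def] cis_conv_exp)

lemma L2_fourier_propagator:
  fixes Q :: "real^'n \<Rightarrow> complex"
  assumes w: "L2_fourier w Q" and Q: "integrable lborel Q" "square_integrable lborel Q"
    and h: "\<And>\<xi>. Q (- \<xi>) = cnj (Q \<xi>)"
  shows "L2_fourier (propagator k t w) (\<lambda>\<xi>. phase k t \<xi> * Q \<xi>)"
  unfolding propagator_eq
proof (rule L2_fourier_multiplier[OF w])
  have pm[measurable]: "phase k t \<in> borel_measurable borel"
    by (rule borel_measurable_continuous_onI[OF continuous_on_phase])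
  have Qm[measurable]: "Q \<in> borel_measurable borel" using borel_measurable_integrable[OF Q(1)] by simp
  show "integrable lborel (\<lambda>\<xi>. phase k t \<xi> * Q \<xi>)"
    by (rule Bochner_Integration.integrable_bound[OF Q(1) _ AE_I2]) (auto simp: norm_mult phase_def)
  show "square_integrable lborel (\<lambda>\<xi>. phase k t \<xi> * Q \<xi>)"
    by (rule square_integrable_bound[OF Q(2), where C=1]) (auto simp: norm_mult phase_def)
  show "phase k t (- \<xi>) * Q (- \<xi>) = cnj (phase k t \<xi> * Q \<xi>)" for \<xi>
    by (simp add: h phase_def cis_cnj)
qed

section \<open>Two decay times force mean zero\<close>

text \<open>Subtracting Duhamel's formulas at the two times expresses the linear term by the transforms
  at these times and two time integrals. All of these pair to \<open>o(h\<^bsup>n+2\<^esup>)\<close>, which is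
  incompatible with \<open>pairing_linear_limit\<close> unless its limit is 0.\<close>

theorem mean_zero_of_decay_at_two_times:
  fixes u :: "real \<Rightarrow> real^'n \<Rightarrow> real" and u0 :: "real^'n \<Rightarrow> real"
  assumes n: "CARD('n) < 4"
    and T: "T > 0" and sol: "duhamel_solution k T u0 u"
    and u: "continuous_into_Z T s r u"
    and s: "s > real CARD('n) / 2 + 1" and r: "r > real CARD('n) / 2" "r \<ge> 1"
    and times: "t1 \<in> {0..T}" "t2 \<in> {0..T}" "t1 \<noteq> t2"
    and decay: "square_integrable lebesgue (\<lambda>x. norm x powr (real CARD('n) / 2 + 2) * u t1 x)"
      "square_integrable lebesgue (\<lambda>x. norm x powr (real CARD('n) / 2 + 2) * u t2 x)"
  shows "fourier u0 0 = 0"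
proof -
  let ?N = "CARD('n)"
  have "0 \<le> real ?N / 2" by simp
  then have s0: "0 \<le> s" using s by linarith
  obtain M where M: "\<And>t. t \<in> {0..T} \<Longrightarrow> (LINT x|lebesgue. \<bar>(u t x)\<^sup>2\<bar>) \<le> M"
    "\<And>t. t \<in> {0..T} \<Longrightarrow> integrable lebesgue (\<lambda>x. (norm x)\<^sup>2 * (u t x)\<^sup>2)"
    "\<And>t. t \<in> {0..T} \<Longrightarrow> (LINT x|lebesgue. (norm x)\<^sup>2 * \<bar>(u t x)\<^sup>2\<bar>) \<le> M"
    using continuous_into_Z_moments[OF u s0 r(2)] by blast
  obtain \<rho> where \<rho>: "0 < \<rho>" "\<rho> \<le> 1" "kappa k \<rho> < 0" using kappa_neg by blast
  have "u t \<in> Z_space s r" if "t \<in> {0..T}" for t using u that by (simp add: continuous_into_Z_def)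
  note reg = Z_space_regular[OF this s r(1)]
  define U where "U t = fourier (u t)" for t
  define Q where "Q t \<xi> = \<i> * complex_of_real (\<xi> $ k) / 2 * fourier (\<lambda>x. (u t x)\<^sup>2) \<xi>" for t \<xi>
  have uU: "L2_fourier (u t) (U t)" if "t \<in> {0..T}" for t
    unfolding U_def by (rule L2_fourier_fourier[OF reg(1,2)[OF that]])
  note U2 = L2_fourierD(2)[OF uU]
  have zero: "0 \<in> {0..T}" using T by simp
  have ae0: "AE x in lebesgue. u 0 x = u0 x" using sol by (simp add: duhamel_solution_def)
  have U0: "fourier u0 = U 0"
    unfolding U_def by (rule fourier_cong_AE[symmetric, OF borel_measurable_integrable[OF reg(1)[OF zero]] ae0])
  have u0U: "L2_fourier u0 (U 0)" by (rule L2_fourier_cong[OF uU[OF zero] ae0]) simp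
  have U0b: "U 0 \<in> borel_measurable borel" unfolding U_def by (rule fourier_borel[OF reg(1)[OF zero]])
  have U0sq: "square_integrable lborel (U 0)" using U2[OF zero] lebesgue_lborel(3)[OF U0b] by simp
  have lin: "L2_fourier (propagator k t u0) (\<lambda>\<xi>. phase k t \<xi> * U 0 \<xi>)" for t
    by (rule L2_fourier_propagator[OF u0U _ U0sq])
      (auto simp: U_def fourier_uminus intro: reg(3)[OF zero])
  have nonlin: "L2_fourier (propagator k t (\<lambda>x. u \<tau> x * partial_deriv k (u \<tau>) x)) (\<lambda>\<xi>. phase k t \<xi> * Q \<tau> \<xi>)"
    if "\<tau> \<in> {0..T}" for t \<tau>
    unfolding Q_def
    by (rule L2_fourier_propagator[OF L2_fourier_nonlinearity[OF reg[OF that]]]) (simp add: fourier_uminus)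
  define C where "C = 3456 * ((T + 1) * M) * measure lborel (cball (0::real^'n) 6)"
  have nlb: "norm (pairing k \<rho> h (\<lambda>\<xi>. phase k t \<xi> * Q \<tau> \<xi>)) \<le> C * h ^ (?N + 3)"
    if "\<tau> \<in> {0..T}" "\<bar>t\<bar> \<le> T" "0 < h" for t \<tau> h
    unfolding Q_def C_def
    by (rule pairing_nonlinear[OF _ M(2) M(1) M(3) that(2,3) \<rho>(2) L2_fourierD(2)[OF nonlin[unfolded Q_def]]])
      (use that(1) square_integrableD(2)[OF reg(2)[OF that(1)]] in auto)
  have duh: "norm (pairing k \<rho> h (\<lambda>\<xi>. phase k t \<xi> * U 0 \<xi> - U t \<xi>)) \<le> T * (C * h ^ (?N + 3))"
    if t: "t \<in> {0..T}" and h: "0 < h" for t h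
  proof -
    obtain I where I: "L2_has_integral (\<lambda>\<tau>. propagator k (t - \<tau>) (\<lambda>x. u \<tau> x * partial_deriv k (u \<tau>) x)) I 0 t"
      and ae: "AE x in lebesgue. u t x = propagator k t u0 x - I x"
      using sol t unfolding duhamel_solution_def by blast
    have "L2_fourier (\<lambda>x. propagator k t u0 x - u t x) (\<lambda>\<xi>. phase k t \<xi> * U 0 \<xi> - U t \<xi>)"
      by (rule L2_fourier_diff[OF lin uU[OF t]])
    then have IJ: "L2_fourier I (\<lambda>\<xi>. phase k t \<xi> * U 0 \<xi> - U t \<xi>)"
      by (rule L2_fourier_cong) (use ae in \<open>auto elim: eventually_mono\<close>)
    have "norm (pairing k \<rho> h (\<lambda>\<xi>. phase k t \<xi> * U 0 \<xi> - U t \<xi>)) \<le> t * (C * h ^ (?N + 3))"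
    proof (rule pairing_L2_has_integral[OF I _ _ _ IJ h \<rho>(2)])
      show "L2_fourier (propagator k (t - \<tau>) (\<lambda>x. u \<tau> x * partial_deriv k (u \<tau>) x)) (\<lambda>\<xi>. phase k (t - \<tau>) \<xi> * Q \<tau> \<xi>)"
        if "\<tau> \<in> {0..t}" for \<tau> using nonlin[of \<tau> "t - \<tau>"] that t by simp
      show "norm (pairing k \<rho> h (\<lambda>\<xi>. phase k (t - \<tau>) \<xi> * Q \<tau> \<xi>)) \<le> C * h ^ (?N + 3)"
        if "\<tau> \<in> {0..t}" for \<tau> using nlb[of \<tau> "t - \<tau>" h] that t h by simp
    qed (use t in simp)
    also have "\<dots> \<le> T * (C * h ^ (?N + 3))"
    proof (rule mult_right_mono)
      show "0 \<le> C * h ^ (?N + 3)" using order_trans[OF norm_ge_zero nlb[OF zero, of 0 h]] T h by simp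
    qed (use t in simp)
    finally show ?thesis .
  qed
  define h where "h i = inverse (real (Suc i))" for i
  have h0: "0 < h i" for i by (simp add: h_def)
  have hl: "h \<longlonglongrightarrow> 0" unfolding h_def[abs_def] by (rule LIMSEQ_inverse_real_of_nat)
  define X where "X i = pairing k \<rho> (h i) (\<lambda>\<xi>. (phase k t1 \<xi> - phase k t2 \<xi>) * U 0 \<xi>) / complex_of_real (h i ^ (?N + 2))" for i
  define Y where "Y t i = pairing k \<rho> (h i) (U t) / complex_of_real (h i ^ (?N + 2))" for t i
  have X1: "X \<longlonglongrightarrow> \<i> * complex_of_real (t1 - t2) * U 0 0 * complex_of_real (kappa k \<rho>)"
    unfolding X_def[abs_def]
  proof (rule pairing_linear_limit[OF _ _ \<rho>(2) h0 hl])
    show "continuous_on UNIV (U 0)" unfolding U_def by (rule continuous_on_fourier[OF reg(1)[OF zero]])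
    show "norm (U 0 \<xi>) \<le> (LINT x|lebesgue. \<bar>u 0 x\<bar>)" for \<xi> unfolding U_def by (rule norm_fourier_le)
  qed
  have Y1: "Y t1 \<longlonglongrightarrow> 0" "Y t2 \<longlonglongrightarrow> 0"
    unfolding Y_def[abs_def] U_def
    by (intro pairing_decay[OF n \<rho>(2) _ _ _ h0 hl] reg(1,2) times decay)+
  have bound: "norm (X i) \<le> norm (Y t1 i) + norm (Y t2 i) + 2 * T * C * h i" for i
  proof -
    let ?P = "pairing k \<rho> (h i)" and ?H = "h i ^ (?N + 2)"
    have H: "0 < ?H" using h0[of i] by simp
    let ?m = "\<lambda>t \<xi>. phase k t \<xi> * U 0 \<xi>"
    note L = L2_fourierD(2)[OF lin]
    note pd = pairing_diff[OF h0[of i] \<rho>(2)]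
    have "?P (\<lambda>\<xi>. (phase k t1 \<xi> - phase k t2 \<xi>) * U 0 \<xi>) = ?P (?m t1) - ?P (?m t2)"
      unfolding left_diff_distrib by (rule pd[OF L L])
    also have "\<dots> = ?P (\<lambda>\<xi>. ?m t1 \<xi> - U t1 \<xi>) - ?P (\<lambda>\<xi>. ?m t2 \<xi> - U t2 \<xi>) + ?P (U t1) - ?P (U t2)"
      using pd[OF L U2[OF times(1)]] pd[OF L U2[OF times(2)]] by simp
    also have "norm \<dots> \<le> norm (?P (\<lambda>\<xi>. ?m t1 \<xi> - U t1 \<xi>)) + norm (?P (\<lambda>\<xi>. ?m t2 \<xi> - U t2 \<xi>)) + norm (?P (U t1)) + norm (?P (U t2))"
      by (intro order_trans[OF norm_triangle_ineq4] add_mono order_trans[OF norm_triangle_ineq] order_refl)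
    also have "\<dots> \<le> T * (C * h i ^ (?N + 3)) + T * (C * h i ^ (?N + 3)) + norm (?P (U t1)) + norm (?P (U t2))"
      by (intro add_mono order_refl duh times h0)
    finally have "norm (?P (\<lambda>\<xi>. (phase k t1 \<xi> - phase k t2 \<xi>) * U 0 \<xi>)) / ?H
       \<le> (T * (C * h i ^ (?N + 3)) + T * (C * h i ^ (?N + 3)) + norm (?P (U t1)) + norm (?P (U t2))) / ?H"
      using H by (intro divide_right_mono) auto
    also have "\<dots> = norm (?P (U t1)) / ?H + norm (?P (U t2)) / ?H + 2 * T * C * h i"
    proof -
      have hh: "h i ^ (?N + 3) = ?H * h i" by (simp add: power_add eval_nat_numeral)
      have "(T * (C * (A * b)) + T * (C * (A * b)) + p + q) / A = p / A + q / A + 2 * T * C * b"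
        if "0 < A" for A b p q :: real using that by (simp add: field_simps)
      then show ?thesis unfolding hh using H .
    qed
    finally show ?thesis
      unfolding X_def Y_def norm_divide norm_of_real abs_of_pos[OF H] .
  qed
  have "X \<longlonglongrightarrow> 0"
  proof (rule Lim_null_comparison[OF always_eventually[OF allI[OF bound]]])
    have "(\<lambda>i. norm (Y t1 i) + norm (Y t2 i) + 2 * T * C * h i) \<longlonglongrightarrow> 0 + 0 + 2 * T * C * 0"
      by (intro tendsto_add tendsto_norm_zero Y1 tendsto_mult_left hl)
    then show "(\<lambda>i. norm (Y t1 i) + norm (Y t2 i) + 2 * T * C * h i) \<longlonglongrightarrow> 0" by simp
  qed
  with X1 have "\<i> * complex_of_real (t1 - t2) * U 0 0 * complex_of_real (kappa k \<rho>) = 0"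
    by (rule LIMSEQ_unique)
  then have "U 0 0 = 0" using times(3) \<rho>(3) by simp
  then show ?thesis by (simp add: U0)
qed

theorem theorem1p2:
  fixes u :: "real \<Rightarrow> real^'d \<Rightarrow> real" and u0 :: "real^'d \<Rightarrow> real"
    and k :: 'd and T t1 t2 :: real
  assumes T: "T > 0"
    and sol: "duhamel_solution k T u0 u"
    and reg: "CARD('d) = 2 \<and> (\<exists>\<epsilon>>0. continuous_into_Z T (2 + \<epsilon>) 2 u) \<or>
              CARD('d) = 3 \<and> continuous_into_Z T 3 3 u"
    and times: "t1 \<in> {0..T}" "t2 \<in> {0..T}" "t1 \<noteq> t2"
    and decay: "u t1 \<in> Z_space (real CARD('d) / 2 + 2) (real CARD('d) / 2 + 2)"
               "u t2 \<in> Z_space (real CARD('d) / 2 + 2) (real CARD('d) / 2 + 2)"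
  shows "fourier u0 0 = 0"
proof -
  obtain s r where u: "continuous_into_Z T s r u" and n: "CARD('d) < 4"
    and s: "s > real CARD('d) / 2 + 1" and r: "r > real CARD('d) / 2" "r \<ge> 1"
    using reg
  proof (elim disjE conjE exE)
    fix \<epsilon> :: real assume "CARD('d) = 2" "0 < \<epsilon>" "continuous_into_Z T (2 + \<epsilon>) 2 u"
    then show thesis using that[of "2 + \<epsilon>" 2] by simp
  next
    assume "CARD('d) = 3" "continuous_into_Z T 3 3 u"
    then show thesis using that[of 3 3] by simp
  qed
  have "square_integrable lebesgue (\<lambda>x. norm x powr (real CARD('d) / 2 + 2) * u t1 x)"
    "square_integrable lebesgue (\<lambda>x. norm x powr (real CARD('d) / 2 + 2) * u t2 x)"
    using decay by (auto simp: Z_space_def in_L2_iff)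
  from mean_zero_of_decay_at_two_times[OF n T sol u s r times this] show ?thesis .
qed

end
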